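(* Let $n\in\mathbb{N}$, let $U\subset\mathbb{R}^n$ be open and let $\mathbf f:U\to\mathbb{R}^n$ be a locally bi-Lipschitz map. Let $$\mathbf{Sing}^2_{\mathbf f}(n):=\{\boldsymbol\xi\in U:\ (\boldsymbol\xi,\mathbf f(\boldsymbol\xi))\in\mathbf{Sing}^2(n)\}.$$ Then $$\dim\mathbf{Sing}^2_{\mathbf f}(n)\le n-\frac{n}{2(n+1)}<n.$$
   Context: $\mathbf{Sing}^2(n)\subset\mathbb{R}^n\times\mathbb{R}^n$ is the set of jointly singular pairs: $(\boldsymbol\xi_1,\boldsymbol\xi_2)$, $\boldsymbol\xi_j=(\xi_{j,1},\dots,\xi_{j,n})$, is jointly singular if for every $\varepsilon>0$, for all sufficiently large $Q\in\mathbb{N}$ there exists $(p,\mathbf q)\in\mathbb{Z}\times\mathbb{Z}^n$ with $1\le|\mathbf q|\le Q$ such that $\min_{1\le j\le 2}|q_1\xi_{j,1}+\dots+q_n\xi_{j,n}+p|<\varepsilon Q^{-n}$, where $|\mathbf q|=\max_i|q_i|$. $\dim$ denotes Hausdorff dimension. *)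

theory Defs
  imports "HOL-Analysis.Analysis"
begin

(* The conventions diam(\<emptyset>)^s = 0 and diam(A)^0 = 1 for A nonempty are made explicit,
   because 0 powr 0 = 0; with them the 0-dimensional measure is the counting measure. *)
definition diameter_power :: "real \<Rightarrow> 'a::metric_space set \<Rightarrow> real" where
  "diameter_power s A = (if A = {} then 0 else if s = 0 then 1 else diameter A powr s)"

(* Boundedness of the covering sets is required separately because the real-valued
   diameter of an unbounded set is an unspecified number. *)
definition hausdorff_premeasure :: "real \<Rightarrow> real \<Rightarrow> 'a::metric_space set \<Rightarrow> ennreal" where
  "hausdorff_premeasure s \<delta> A =
     Inf {(\<Sum>i. ennreal (diameter_power s (C i))) | C :: nat \<Rightarrow> 'a set.
            A \<subseteq> (\<Union>i. C i) \<and> (\<forall>i. bounded (C i) \<and> diameter (C i) \<le> \<delta>)}"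

definition hausdorff_outer_measure :: "real \<Rightarrow> 'a::metric_space set \<Rightarrow> ennreal" where
  "hausdorff_outer_measure s A = (SUP \<delta>\<in>{0<..}. hausdorff_premeasure s \<delta> A)"

definition hausdorff_dim :: "'a::metric_space set \<Rightarrow> ereal" where
  "hausdorff_dim A = Inf (ereal ` {s. 0 \<le> s \<and> hausdorff_outer_measure s A = 0})"

definition bi_lipschitz_on :: "'a::metric_space set \<Rightarrow> ('a \<Rightarrow> 'b::metric_space) \<Rightarrow> bool" where
  "bi_lipschitz_on S f \<longleftrightarrow>
     (\<exists>L\<ge>1. \<forall>x\<in>S. \<forall>y\<in>S. dist x y / L \<le> dist (f x) (f y) \<and> dist (f x) (f y) \<le> L * dist x y)"

definition locally_bi_lipschitz_on ::
  "'a::metric_space set \<Rightarrow> ('a \<Rightarrow> 'b::metric_space) \<Rightarrow> bool" where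
  "locally_bi_lipschitz_on U f \<longleftrightarrow> (\<forall>x\<in>U. \<exists>r>0. bi_lipschitz_on (ball x r \<inter> U) f)"

definition int_sup_norm :: "int ^ 'n::finite \<Rightarrow> int" where
  "int_sup_norm q = Max (range (\<lambda>i. \<bar>q $ i\<bar>))"

definition affine_form :: "int \<Rightarrow> int ^ 'n::finite \<Rightarrow> real ^ 'n \<Rightarrow> real" where
  "affine_form p q \<xi> = (\<Sum>i\<in>UNIV. real_of_int (q $ i) * \<xi> $ i) + real_of_int p"

definition Sing2 :: "((real ^ 'n::finite) \<times> (real ^ 'n)) set" where
  "Sing2 = {(\<xi>1, \<xi>2). \<forall>\<epsilon>>0. \<forall>\<^sub>F Q :: nat in sequentially.
     \<exists>(p :: int) (q :: int ^ 'n).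
       1 \<le> int_sup_norm q \<and> int_sup_norm q \<le> int Q \<and>
       min \<bar>affine_form p q \<xi>1\<bar> \<bar>affine_form p q \<xi>2\<bar> < \<epsilon> / real Q ^ CARD('n)}"

definition Sing2_map :: "(real ^ 'n::finite) set \<Rightarrow> (real ^ 'n \<Rightarrow> real ^ 'n) \<Rightarrow> (real ^ 'n) set" where
  "Sing2_map U f = {\<xi> \<in> U. (\<xi>, f \<xi>) \<in> Sing2}"

end

theory Submission
  imports Defs
begin

text \<open>
  By the dictionary between Diophantine approximation and dynamics, small values of the linear form of \<open>\<xi>\<close>
  correspond to short vectors in the lattices obtained by applying the diagonal flow
  \<open>g\<^sub>t = diag (e\<^sup>n\<^sup>t, e\<^sup>-\<^sup>t, \<dots>, e\<^sup>-\<^sup>t)\<close> to the unipotent translate of the integer lattice given by \<open>\<xi>\<close>. If the pair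
  \<open>(\<xi>, f \<xi>)\<close> is jointly singular, then at every late time one of the two trajectories is high in the cusp, hence
  one of them spends about half of its time there along a sequence of times. As \<open>f\<close> is locally bi-Lipschitz,
  it is enough to bound the dimension of the set of \<open>\<xi>\<close> whose own trajectory does so.

  For this, following Kadyrov, Kleinbock, Lindenstrauss and Margulis, one uses a height function on lattices that
  is contracted in average: expanding by \<open>b = e\<^sup>t\<close>, a cell is divided into \<open>b\<^sup>n\<^sup>(\<^sup>n\<^sup>+\<^sup>1\<^sup>)\<close> cells, and the mean
  height of these is at most \<open>1 + \<eta> H\<close> where \<open>H\<close> is the height of the original cell and \<open>\<eta>\<close> is \<open>b\<^sup>-\<^sup>n\<close> up to
  a factor linear in \<open>t\<close>. Every visit to the cusp therefore reduces the number of cells that need to be kept by a factor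
  of about \<open>b\<^sup>n\<close>, and visits at half of the times lower the dimension by \<open>n / (2 (n + 1))\<close>.

  The height is built from the products of the first \<open>i\<close> successive minima. The covolume of the subspace
  spanned by the corresponding vectors is never computed: its growth is measured by counting lattice points
  in large balls.
\<close>

section \<open>Hausdorff content\<close>

text \<open>One step of the flow stretches unipotent shifts by \<open>b^(n+1)\<close>, so a cell has
  \<open>N = b^(n+1)\<close> children per coordinate, and saving a factor \<open>b^n\<close> at half
  of the levels means saving \<open>N^(n/(2(n+1)))\<close> per level. The obstacle is that the
  sublattice realizing the first \<open>i\<close> minima may change between parent and child, so one
  term of the height does not control the same term at the children. If the minima
  \<open>i - 1\<close> and \<open>i\<close> (counted from 0) are far apart, the sublattice persists,
  and its covolume grows unless the whole subspace lies close to the contracted hyperplane, which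
  happens for few children. Without a gap, the terms \<open>i - 1\<close> and \<open>i + 1\<close>
  dominate term \<open>i\<close>, and the weight \<open>w\<close> in the height makes it negligible.
  The exponent \<open>n / (n + 1 - i)\<close> turns a growth of the covolume by
  \<open>b^(n+1-i)\<close> into the same gain \<open>b^n\<close> for all \<open>i\<close>. Constants
  and factors linear in \<open>t\<close> are lost at every step; they are harmless because
  \<open>t\<close> is chosen large in terms of the distance from \<open>s\<close> to the critical
  dimension.\<close>

text \<open>The diameters need not be bounded: for \<open>s > 0\<close> a small sum makes them small.\<close>

definition hausdorff_content :: "real \<Rightarrow> 'a::metric_space set \<Rightarrow> ennreal" where
  "hausdorff_content s A =
     Inf {(\<Sum>i. ennreal (diameter_power s (C i))) | C :: nat \<Rightarrow> 'a set.
            A \<subseteq> (\<Union>i. C i) \<and> (\<forall>i. bounded (C i))}"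

lemma hausdorff_content_le:
  fixes C :: "nat \<Rightarrow> 'a::metric_space set"
  assumes "A \<subseteq> (\<Union>i. C i)" "\<And>i. bounded (C i)"
  shows "hausdorff_content s A \<le> (\<Sum>i. ennreal (diameter_power s (C i)))"
  unfolding hausdorff_content_def by (rule Inf_lower) (use assms in blast)

lemma hausdorff_content_approx:
  fixes A :: "'a::metric_space set"
  assumes "hausdorff_content s A < e"
  obtains C :: "nat \<Rightarrow> 'a set" where "A \<subseteq> (\<Union>i. C i)" "\<And>i. bounded (C i)"
    "(\<Sum>i. ennreal (diameter_power s (C i))) < e"
  using assms unfolding hausdorff_content_def Inf_less_iff by blast

lemma hausdorff_content_mono:
  assumes "A \<subseteq> B"
  shows "hausdorff_content s A \<le> hausdorff_content s B"
  unfolding hausdorff_content_def by (rule Inf_superset_mono) (use assms in blast)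

lemma hausdorff_content_UN:
  fixes A :: "nat \<Rightarrow> 'a::metric_space set"
  shows "hausdorff_content s (\<Union>i. A i) \<le> (\<Sum>i. hausdorff_content s (A i))"
proof (rule ennreal_le_epsilon)
  fix e :: real assume e: "e > 0" and fin: "(\<Sum>i. hausdorff_content s (A i)) < top"
  have "\<exists>C :: nat \<Rightarrow> 'a set. A i \<subseteq> (\<Union>j. C j) \<and> (\<forall>j. bounded (C j)) \<and>
     (\<Sum>j. ennreal (diameter_power s (C j))) \<le> hausdorff_content s (A i) + ennreal (e * (1/2)^Suc i)" for i
  proof -
    have "hausdorff_content s (A i) < top"
      using fin ennreal_suminf_lessD by blast
    then have "hausdorff_content s (A i) < hausdorff_content s (A i) + ennreal (e * (1/2)^Suc i)"
      using e by (simp add: ennreal_add_left_cancel_less ennreal_zero_less_mult_iff)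
    then show ?thesis by (rule hausdorff_content_approx) (meson less_imp_le)
  qed
  then obtain C :: "nat \<Rightarrow> nat \<Rightarrow> 'a set" where C: "\<And>i. A i \<subseteq> (\<Union>j. C i j)" "\<And>i j. bounded (C i j)"
     "\<And>i. (\<Sum>j. ennreal (diameter_power s (C i j))) \<le> hausdorff_content s (A i) + ennreal (e * (1/2)^Suc i)"
    by metis
  define D where "D = (\<lambda>m. case prod_decode m of (i,j) \<Rightarrow> C i j)"
  have "(\<Union>i. A i) \<subseteq> (\<Union>m. D m)"
  proof
    fix x assume "x \<in> (\<Union>i. A i)"
    then obtain i j where "x \<in> C i j" using C(1) by blast
    then have "x \<in> D (prod_encode (i,j))" by (simp add: D_def)
    then show "x \<in> (\<Union>m. D m)" by blast
  qed
  moreover have "bounded (D m)" for m using C(2) by (auto simp: D_def split: prod.split)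
  ultimately have "hausdorff_content s (\<Union>i. A i) \<le> (\<Sum>m. ennreal (diameter_power s (D m)))"
    by (rule hausdorff_content_le)
  also have "\<dots> = (\<Sum>m. (case prod_decode m of (i,j) \<Rightarrow> ennreal (diameter_power s (C i j))))"
    by (simp add: D_def case_prod_beta)
  also have "\<dots> = (\<Sum>i. \<Sum>j. ennreal (diameter_power s (C i j)))"
    using suminf_ennreal_2dimen[where f="\<lambda>(i,j). ennreal (diameter_power s (C i j))"
        and g="\<lambda>i. \<Sum>j. ennreal (diameter_power s (C i j))"]
    by (simp add: comp_def)
  also have "\<dots> \<le> (\<Sum>i. hausdorff_content s (A i) + ennreal (e * (1/2)^Suc i))"
    by (intro suminf_le C(3)) auto
  also have "\<dots> = (\<Sum>i. hausdorff_content s (A i)) + (\<Sum>i. ennreal (e * (1/2)^Suc i))"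
    by (rule suminf_add[symmetric]) auto
  also have "(\<Sum>i. ennreal (e * (1/2)^Suc i)) = ennreal e"
  proof (rule suminf_ennreal_eq)
    show "0 \<le> e * (1/2)^Suc i" for i using e by auto
    have "(\<lambda>i. e * (1/2)^Suc i) sums (e * 1)"
      by (rule sums_mult[OF power_half_series])
    then show "(\<lambda>i. e * (1/2)^Suc i) sums e" by simp
  qed
  finally show "hausdorff_content s (\<Union>i. A i) \<le> (\<Sum>i. hausdorff_content s (A i)) + ennreal e" .
qed

lemma hausdorff_content_bounded:
  fixes A :: "'a::metric_space set"
  assumes "bounded A"
  shows "hausdorff_content s A \<le> ennreal (diameter_power s A)"
proof -
  define C where "C i = (if i = 0 then A else {})" for i :: nat
  have "hausdorff_content s A \<le> (\<Sum>i. ennreal (diameter_power s (C i)))"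
    by (rule hausdorff_content_le) (use assms in \<open>auto simp: C_def\<close>)
  also have "\<dots> = (\<Sum>i\<in>{0}. ennreal (diameter_power s (C i)))"
    by (rule suminf_finite) (auto simp: C_def diameter_power_def)
  finally show ?thesis by (simp add: C_def)
qed

lemma hausdorff_content_UN_finite:
  assumes "finite F"
  shows "hausdorff_content s (\<Union>m\<in>F. A m) \<le> (\<Sum>m\<in>F. hausdorff_content s (A m))"
  using assms
proof (induction F)
  case empty
  then show ?case using hausdorff_content_bounded[of "{}" s] by (simp add: diameter_power_def)
next
  case (insert x F)
  define D where "D i = (if i = 0 then A x else if i = 1 then (\<Union>m\<in>F. A m) else {})" for i :: nat
  have [simp]: "hausdorff_content s ({}::'b set) = 0"
    using hausdorff_content_bounded[of "{}::'b set" s] by (simp add: diameter_power_def)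
  have "(\<Union>m\<in>insert x F. A m) = (\<Union>i. D i)"
    by (auto simp: D_def split: if_splits)
  then have "hausdorff_content s (\<Union>m\<in>insert x F. A m) \<le> (\<Sum>i. hausdorff_content s (D i))"
    using hausdorff_content_UN[of s D] by simp
  also have "\<dots> = (\<Sum>i\<in>{0,1}. hausdorff_content s (D i))"
    by (rule suminf_finite) (auto simp: D_def)
  finally show ?case using insert by (auto simp: D_def intro: order_trans add_left_mono)
qed

lemma hausdorff_content_0_UN:
  fixes A :: "nat \<Rightarrow> 'a::metric_space set"
  assumes "\<And>i. hausdorff_content s (A i) = 0"
  shows "hausdorff_content s (\<Union>i. A i) = 0"
  using hausdorff_content_UN[of s A] assms by simp

lemma hausdorff_outer_measure_0:
  fixes A :: "'a::metric_space set"
  assumes "s > 0" "hausdorff_content s A = 0"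
  shows "hausdorff_outer_measure s A = 0"
proof -
  have "hausdorff_premeasure s \<delta> A = 0" if "\<delta> > 0" for \<delta>
  proof -
    have "hausdorff_premeasure s \<delta> A \<le> 0"
    proof (rule ennreal_le_epsilon)
      fix e :: real assume e: "e > 0"
      have "hausdorff_content s A < ennreal (min e (\<delta> powr s))"
        using e that assms by (simp add: ennreal_less_zero_iff)
      then obtain C :: "nat \<Rightarrow> 'a set" where C: "A \<subseteq> (\<Union>i. C i)" "\<And>i. bounded (C i)"
        "(\<Sum>i. ennreal (diameter_power s (C i))) < ennreal (min e (\<delta> powr s))"
        by (rule hausdorff_content_approx) blast
      have "diameter (C i) \<le> \<delta>" for i
      proof (cases "C i = {}")
        case False
        have "ennreal (diameter_power s (C i)) \<le> (\<Sum>i. ennreal (diameter_power s (C i)))"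
          using sum_le_suminf[of "\<lambda>i. ennreal (diameter_power s (C i))" "{i}"] by simp
        also have "\<dots> < ennreal (\<delta> powr s)"
          using C(3) by (simp add: order.strict_trans2 ennreal_leI)
        finally have "diameter (C i) powr s < \<delta> powr s"
          using False assms(1) by (simp add: diameter_power_def ennreal_less_iff)
        then show ?thesis
          using that assms(1) diameter_ge_0[OF C(2)]
          by (meson less_imp_le not_le powr_mono2)
      qed (use that in simp)
      then have "hausdorff_premeasure s \<delta> A \<le> (\<Sum>i. ennreal (diameter_power s (C i)))"
        unfolding hausdorff_premeasure_def by (intro Inf_lower) (use C in blast)
      also have "\<dots> \<le> ennreal e"
        using C(3) by (simp add: order.strict_implies_order order.strict_trans2 ennreal_leI)
      finally show "hausdorff_premeasure s \<delta> A \<le> 0 + ennreal e" by simp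
    qed
    then show ?thesis by simp
  qed
  then show ?thesis unfolding hausdorff_outer_measure_def by (simp add: SUP_constant)
qed

text \<open>The inequality makes the inverse of \<open>f\<close> on \<open>A\<close> Lipschitz, so
  pulling back a cover multiplies its \<open>s\<close>-sum by at most
  \<open>L powr s\<close>.\<close>

lemma hausdorff_content_0_preimage:
  fixes f :: "'a::metric_space \<Rightarrow> 'b::metric_space"
  assumes s: "s > 0" and L: "L > 0" and f: "\<And>x y. x \<in> A \<Longrightarrow> y \<in> A \<Longrightarrow> dist x y \<le> L * dist (f x) (f y)"
    and S: "hausdorff_content s S = 0"
  shows "hausdorff_content s (A \<inter> f -` S) = 0"
proof -
  have "hausdorff_content s (A \<inter> f -` S) \<le> 0"
  proof (rule ennreal_le_epsilon)
    fix e :: real assume e: "e > 0"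
    have "hausdorff_content s S < ennreal (e / L powr s)" using S e L by (simp add: ennreal_less_zero_iff)
    then obtain C :: "nat \<Rightarrow> 'b set" where C: "S \<subseteq> (\<Union>i. C i)" "\<And>i. bounded (C i)"
        "(\<Sum>i. ennreal (diameter_power s (C i))) < ennreal (e / L powr s)"
        by (rule hausdorff_content_approx) blast
    define D where "D i = A \<inter> f -` C i" for i
    have D: "dist x y \<le> L * diameter (C i)" if "x \<in> D i" "y \<in> D i" for x y i
    proof -
      have "dist x y \<le> L * dist (f x) (f y)" using f that by (auto simp: D_def)
      also have "\<dots> \<le> L * diameter (C i)"
        using that C(2) L by (auto simp: D_def intro!: diameter_bounded_bound)
      finally show ?thesis .
    qed
    have bD: "bounded (D i)" for i
      unfolding bounded_two_points using D by blast
    have dp: "diameter_power s (D i) \<le> L powr s * diameter_power s (C i)" for i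
    proof (cases "D i = {}")
      case False
      then have ne: "C i \<noteq> {}" by (auto simp: D_def)
      have "diameter (D i) \<le> L * diameter (C i)"
        unfolding diameter_def[of "D i"] using False by (auto intro!: cSUP_least D)
      then have "diameter (D i) powr s \<le> (L * diameter (C i)) powr s"
        using s diameter_ge_0[OF bD] by (intro powr_mono2) auto
      then show ?thesis using False ne s L diameter_ge_0[OF C(2)]
        by (simp add: diameter_power_def powr_mult)
    qed (simp add: diameter_power_def)
    have "hausdorff_content s (A \<inter> f -` S) \<le> (\<Sum>i. ennreal (diameter_power s (D i)))"
    proof (rule hausdorff_content_le)
      show "A \<inter> f -` S \<subseteq> (\<Union>i. D i)" using C(1) unfolding D_def by blast
    qed (rule bD)
    also have "\<dots> \<le> (\<Sum>i. ennreal (L powr s) * ennreal (diameter_power s (C i)))"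
      by (intro suminf_le) (use dp in \<open>auto simp: ennreal_mult'[symmetric] intro!: ennreal_leI\<close>)
    also have "\<dots> = ennreal (L powr s) * (\<Sum>i. ennreal (diameter_power s (C i)))"
      by simp
    also have "\<dots> \<le> ennreal (L powr s) * ennreal (e / L powr s)"
      by (intro mult_left_mono less_imp_le[OF C(3)]) auto
    also have "\<dots> = ennreal e"
      using L e by (simp add: ennreal_mult'[symmetric])
    finally show "hausdorff_content s (A \<inter> f -` S) \<le> 0 + ennreal e" by simp
  qed
  then show ?thesis by simp
qed

text \<open>Borel-Cantelli for content: the covers from any index on still cover \<open>S\<close>,
  and their total is bounded by a tail of a convergent series.\<close>

lemma hausdorff_content_0_limsup:
  fixes C :: "nat \<Rightarrow> 'b \<Rightarrow> 'a::metric_space set"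
  assumes fin: "\<And>N. finite (F N)" and bdd: "\<And>N m. m \<in> F N \<Longrightarrow> bounded (C N m)"
    and S: "\<And>x. x \<in> S \<Longrightarrow> \<exists>\<^sub>\<infinity>N. x \<in> (\<Union>m\<in>F N. C N m)"
    and le: "\<And>N. (\<Sum>m\<in>F N. diameter_power s (C N m)) \<le> g N" and g: "summable g"
  shows "hausdorff_content s S = 0"
proof -
  have nn: "0 \<le> diameter_power s X" for X :: "'a set"
    by (auto simp: diameter_power_def)
  have g0: "g N \<ge> 0" for N
    using order_trans[OF sum_nonneg le] nn by blast
  have "hausdorff_content s S \<le> 0"
  proof (rule ennreal_le_epsilon)
    fix e :: real assume e: "e > 0"
    obtain M where M: "norm (\<Sum>i. g (i + M)) < e" using suminf_exist_split[OF e g] by blast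
    have "S \<subseteq> (\<Union>i. \<Union>m\<in>F (i+M). C (i+M) m)"
    proof
      fix x assume "x \<in> S"
      then obtain N where N: "N \<ge> M" "x \<in> (\<Union>m\<in>F N. C N m)"
        using S[OF \<open>x \<in> S\<close>] unfolding INFM_nat_le by blast
      then have "x \<in> (\<Union>m\<in>F ((N-M)+M). C ((N-M)+M) m)" by simp
      then show "x \<in> (\<Union>i. \<Union>m\<in>F (i+M). C (i+M) m)" by blast
    qed
    then have "hausdorff_content s S \<le> hausdorff_content s (\<Union>i. \<Union>m\<in>F (i+M). C (i+M) m)"
      by (rule hausdorff_content_mono)
    also have "\<dots> \<le> (\<Sum>i. hausdorff_content s (\<Union>m\<in>F (i+M). C (i+M) m))"
      by (rule hausdorff_content_UN)
    also have "\<dots> \<le> (\<Sum>i. ennreal (g (i + M)))"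
    proof (intro suminf_le)
      fix i
      have "hausdorff_content s (\<Union>m\<in>F (i+M). C (i+M) m) \<le> (\<Sum>m\<in>F (i+M). hausdorff_content s (C (i+M) m))"
        by (rule hausdorff_content_UN_finite[OF fin])
      also have "\<dots> \<le> (\<Sum>m\<in>F (i+M). ennreal (diameter_power s (C (i+M) m)))"
        by (intro sum_mono hausdorff_content_bounded bdd)
      also have "\<dots> = ennreal (\<Sum>m\<in>F (i+M). diameter_power s (C (i+M) m))"
        using nn by (simp add: sum_ennreal)
      also have "\<dots> \<le> ennreal (g (i+M))" by (intro ennreal_leI le)
      finally show "hausdorff_content s (\<Union>m\<in>F (i+M). C (i+M) m) \<le> ennreal (g (i+M))" .
    qed auto
    also have "\<dots> = ennreal (\<Sum>i. g (i + M))"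
      by (rule suminf_ennreal2) (use g0 g in \<open>auto simp: summable_iff_shift\<close>)
    also have "\<dots> \<le> ennreal e" using M by (intro ennreal_leI) auto
    finally show "hausdorff_content s S \<le> 0 + ennreal e" by simp
  qed
  then show ?thesis by simp
qed

section \<open>Lattice points in balls and successive minima\<close>

lemma norm_le_sum_inner:
  fixes B :: "'a::euclidean_space set"
  assumes "pairwise orthogonal B" "\<And>e. e \<in> B \<Longrightarrow> norm e = 1" "v \<in> span B" "finite B"
  shows "norm v \<le> (\<Sum>e\<in>B. \<bar>v \<bullet> e\<bar>)"
proof -
  have "norm v = norm (\<Sum>e\<in>B. (v \<bullet> e) *\<^sub>R e)"
    using orthonormal_basis_expand[OF assms] by simp
  also have "\<dots> \<le> (\<Sum>e\<in>B. \<bar>v \<bullet> e\<bar>)"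
    by (rule sum_norm_le) (simp add: assms)
  finally show ?thesis .
qed

text \<open>Pigeonhole in an orthonormal frame: the box with half-sides \<open>h e\<close> is cut
  into cubes of side \<open>r\<close>, and \<open>m\<close> bounds the points in one cube. The
  hypothesis on \<open>m\<close> speaks of norms instead of coordinates, so that a count of lattice
  points in a ball can supply it.\<close>

lemma box_count:
  fixes \<phi> :: "'b \<Rightarrow> 'a::euclidean_space"
  assumes S: "finite S" and B: "finite B" "pairwise orthogonal B" "\<And>e. e \<in> B \<Longrightarrow> norm e = 1"
    and sp: "\<And>z. z \<in> S \<Longrightarrow> \<phi> z \<in> span B"
    and h: "\<And>z e. z \<in> S \<Longrightarrow> e \<in> B \<Longrightarrow> \<bar>\<phi> z \<bullet> e\<bar> \<le> h e"
    and r: "r > 0" "\<And>e. e \<in> B \<Longrightarrow> r \<le> h e"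
    and m0: "m \<ge> 0" and m: "\<And>z. z \<in> S \<Longrightarrow> real (card {w\<in>S. norm (\<phi> w - \<phi> z) \<le> real (card B) * r}) \<le> m"
  shows "real (card S) \<le> m * (\<Prod>e\<in>B. 4 * h e / r)"
proof -
  define \<kappa> where "\<kappa> z = (\<lambda>e\<in>B. \<lfloor>\<phi> z \<bullet> e / r\<rfloor>)" for z
  define Y where "Y = (\<Pi>\<^sub>E e\<in>B. {\<lfloor>- h e / r\<rfloor>..\<lfloor>h e / r\<rfloor>})"
  have Y: "\<kappa> ` S \<subseteq> Y"
  proof (clarsimp simp: \<kappa>_def Y_def)
    fix z e assume "z \<in> S" "e \<in> B"
    from h[OF this] have "- h e \<le> \<phi> z \<bullet> e" "\<phi> z \<bullet> e \<le> h e" by auto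
    then have "- h e / r \<le> \<phi> z \<bullet> e / r" "\<phi> z \<bullet> e / r \<le> h e / r"
      using divide_right_mono[of "- h e" "\<phi> z \<bullet> e" r] divide_right_mono[of "\<phi> z \<bullet> e" "h e" r] r(1)
      by auto
    then show "\<lfloor>- (h e / r)\<rfloor> \<le> \<lfloor>\<phi> z \<bullet> e / r\<rfloor> \<and> \<lfloor>\<phi> z \<bullet> e / r\<rfloor> \<le> \<lfloor>h e / r\<rfloor>"
      by (simp add: floor_mono)
  qed
  have finY: "finite Y" using B by (auto simp: Y_def intro!: finite_PiE)
  have "real (card Y) = (\<Prod>e\<in>B. real (card {\<lfloor>- h e / r\<rfloor>..\<lfloor>h e / r\<rfloor>}))"
    using B by (simp add: Y_def card_PiE)
  also have "\<dots> \<le> (\<Prod>e\<in>B. 4 * h e / r)"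
  proof (intro prod_mono conjI)
    fix e assume "e \<in> B"
    then have H: "1 \<le> h e / r" using r by (simp add: field_simps)
    have "real (card {\<lfloor>- h e / r\<rfloor>..\<lfloor>h e / r\<rfloor>}) = real_of_int (\<lfloor>h e / r\<rfloor> - \<lfloor>- h e / r\<rfloor> + 1)"
    proof -
      have "\<lfloor>- h e / r\<rfloor> \<le> \<lfloor>h e / r\<rfloor>" using H by (intro floor_mono) auto
      then show ?thesis by simp
    qed
    \<comment> \<open>The floors leave at most \<open>2 * h e / r + 2\<close> cubes along
      \<open>e\<close>; the 2 is absorbed because \<open>h e / r \<ge> 1\<close>.\<close>
    also have "\<dots> \<le> 4 * h e / r" using H by (simp, linarith)
    finally show "real (card {\<lfloor>- h e / r\<rfloor>..\<lfloor>h e / r\<rfloor>}) \<le> 4 * h e / r" .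
  qed auto
  finally have cY: "real (card Y) \<le> (\<Prod>e\<in>B. 4 * h e / r)" .
  have fib: "real (card {w\<in>S. \<kappa> w = y}) \<le> m" if "y \<in> \<kappa> ` S" for y
  proof -
    from that obtain z where z: "z \<in> S" "\<kappa> z = y" by auto
    have "{w\<in>S. \<kappa> w = y} \<subseteq> {w\<in>S. norm (\<phi> w - \<phi> z) \<le> real (card B) * r}"
    proof safe
      fix w assume w: "w \<in> S" "y = \<kappa> w"
      have "\<bar>(\<phi> w - \<phi> z) \<bullet> e\<bar> \<le> r" if "e \<in> B" for e
      proof -
        have "\<lfloor>\<phi> w \<bullet> e / r\<rfloor> = \<lfloor>\<phi> z \<bullet> e / r\<rfloor>"
          using w z that by (metis \<kappa>_def restrict_apply')
        then have "\<bar>\<phi> w \<bullet> e / r - \<phi> z \<bullet> e / r\<bar> \<le> 1" by linarith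
        then have "\<bar>\<phi> w \<bullet> e - \<phi> z \<bullet> e\<bar> / r \<le> 1"
          using r(1) by (simp add: diff_divide_distrib[symmetric])
        then show ?thesis using r(1) by (simp add: inner_diff_left)
      qed
      then have "(\<Sum>e\<in>B. \<bar>(\<phi> w - \<phi> z) \<bullet> e\<bar>) \<le> (\<Sum>e\<in>B. r)" by (intro sum_mono)
      moreover have "norm (\<phi> w - \<phi> z) \<le> (\<Sum>e\<in>B. \<bar>(\<phi> w - \<phi> z) \<bullet> e\<bar>)"
        by (rule norm_le_sum_inner[OF B(2,3) _ B(1)]) (use sp w z in \<open>auto intro: span_diff\<close>)
      ultimately show "norm (\<phi> w - \<phi> z) \<le> real (card B) * r" by simp
    qed
    then have "card {w\<in>S. \<kappa> w = y} \<le> card {w\<in>S. norm (\<phi> w - \<phi> z) \<le> real (card B) * r}"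
      using S by (intro card_mono) auto
    then show ?thesis using m[OF z(1)] by linarith
  qed
  have "card S = card (\<Union>y\<in>\<kappa> ` S. {w\<in>S. \<kappa> w = y})"
    by (rule arg_cong[where f=card]) auto
  also have "\<dots> \<le> (\<Sum>y\<in>\<kappa> ` S. card {w\<in>S. \<kappa> w = y})"
    using S by (intro card_UN_le) auto
  finally have "real (card S) \<le> (\<Sum>y\<in>\<kappa> ` S. real (card {w\<in>S. \<kappa> w = y}))"
    by (simp flip: of_nat_sum)
  also have "\<dots> \<le> (\<Sum>y\<in>\<kappa> ` S. m)" by (intro sum_mono fib)
  also have "\<dots> = m * real (card (\<kappa> ` S))" by simp
  also have "\<dots> \<le> m * real (card Y)"
    using m0 card_mono[OF finY Y] by (intro mult_left_mono) auto
  also have "\<dots> \<le> m * (\<Prod>e\<in>B. 4 * h e / r)" using m0 cY by (intro mult_left_mono)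
  finally show ?thesis .
qed

text \<open>Greedy choice: \<open>j\<close> vectors span dimension at most \<open>j\<close>, so
  \<open>A j\<close> has a vector outside their span. This yields independent vectors that realize
  all minima at once.\<close>

lemma independent_transversal:
  fixes A :: "nat \<Rightarrow> 'a::euclidean_space set"
  assumes "\<And>j. j < i \<Longrightarrow> j < dim (A j)"
  shows "\<exists>v. (\<forall>j<i. v j \<in> A j) \<and> inj_on v {..<i} \<and> independent (v ` {..<i})"
  using assms
proof (induction i)
  case 0
  then show ?case by (auto simp: independent_empty)
next
  case (Suc i)
  then obtain v where v: "\<forall>j<i. v j \<in> A j" "inj_on v {..<i}" "independent (v ` {..<i})" by auto
  have "dim (v ` {..<i}) \<le> card (v ` {..<i})" by (simp add: dim_le_card')
  also have "\<dots> \<le> i" using card_image_le[of "{..<i}" v] by simp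
  also have "\<dots> < dim (A i)" using Suc.prems by simp
  finally have "\<not> A i \<subseteq> span (v ` {..<i})"
    using dim_mono[of "A i" "v ` {..<i}"] by linarith
  then obtain w where w: "w \<in> A i" "w \<notin> span (v ` {..<i})" by blast
  define u where "u = v(i := w)"
  have im: "u ` {..<i} = v ` {..<i}" by (auto simp: u_def image_def)
  have "u ` {..<Suc i} = insert (u i) (u ` {..<i})" by (simp add: lessThan_Suc)
  then have "u ` {..<Suc i} = insert w (v ` {..<i})" unfolding im by (simp add: u_def)
  then have "independent (u ` {..<Suc i})" using independent_insertI[OF w(2) v(3)] by simp
  moreover have "inj_on u {..<Suc i}"
  proof -
    have "w \<notin> u ` {..<i}" unfolding im using w(2) span_base[of w "v ` {..<i}"] by meson
    moreover have "inj_on u {..<i} = inj_on v {..<i}" by (rule inj_on_cong) (simp add: u_def)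
    moreover have "{..<i} - {i} = {..<i}" by auto
    moreover have "u i = w" by (simp add: u_def)
    ultimately show ?thesis using v(2) by (simp only: lessThan_Suc inj_on_insert) simp
  qed
  moreover have "\<forall>j<Suc i. u j \<in> A j" using v(1) w(1) by (simp add: u_def less_Suc_eq)
  ultimately show ?case by blast
qed

lemma subgroup_int_scaleR:
  fixes G :: "'a::real_vector set"
  assumes "\<And>z w. z \<in> G \<Longrightarrow> w \<in> G \<Longrightarrow> z - w \<in> G" "v \<in> G"
  shows "of_int m *\<^sub>R v \<in> G"
proof -
  have 0: "0 \<in> G" using assms by (metis diff_self)
  have neg: "- z \<in> G" if "z \<in> G" for z using assms(1)[OF 0 that] by simp
  have nat: "of_nat k *\<^sub>R v \<in> G" for k
  proof (induction k)
    case (Suc k)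
    have "of_nat k *\<^sub>R v - (- v) \<in> G" using Suc neg assms by blast
    then show ?case by (simp add: scaleR_left_distrib algebra_simps)
  qed (simp add: 0)
  show ?thesis
  proof (cases "m \<ge> 0")
    case True
    then show ?thesis using nat[of "nat m"] by simp
  next
    case False
    then show ?thesis using neg[OF nat[of "nat (-m)"]] by simp
  qed
qed

lemma subgroup_sum:
  fixes G :: "'a::real_vector set"
  assumes G: "\<And>z w. z \<in> G \<Longrightarrow> w \<in> G \<Longrightarrow> z - w \<in> G" "0 \<in> G" and "\<And>j. j \<in> J \<Longrightarrow> f j \<in> G"
  shows "sum f J \<in> G"
  using assms(3)
proof (induction J rule: infinite_finite_induct)
  case (insert x F)
  have "f x - (0 - sum f F) \<in> G" using insert G by blast
  then show ?case using insert by simp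
qed (use G in auto)

text \<open>Integer combinations with coefficients up to \<open>R / (i * \<mu> j)\<close> are
  distinct by independence and have norm at most \<open>R\<close>.\<close>

lemma lattice_count_lower:
  fixes v :: "nat \<Rightarrow> 'a::euclidean_space" and T :: "'a \<Rightarrow> 'b::euclidean_space"
  assumes G: "\<And>z w. z \<in> G \<Longrightarrow> w \<in> G \<Longrightarrow> z - w \<in> G" "0 \<in> G"
    and T: "linear T" and fin: "finite {z\<in>G. norm (T z) \<le> R}"
    and v: "inj_on v {..<i}" "independent (v ` {..<i})" "\<And>j. j < i \<Longrightarrow> v j \<in> G"
    and \<mu>: "\<And>j. j < i \<Longrightarrow> 0 < \<mu> j" "\<And>j. j < i \<Longrightarrow> norm (T (v j)) \<le> \<mu> j" and R: "R > 0"
  shows "(\<Prod>j<i. R / (real i * \<mu> j)) \<le> real (card {z\<in>G. norm (T z) \<le> R})"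
proof -
  define M where "M j = \<lfloor>R / (real i * \<mu> j)\<rfloor>" for j
  define P where "P = (\<Pi>\<^sub>E j\<in>{..<i}. {- M j..M j})"
  define F where "F c = (\<Sum>j<i. of_int (c j) *\<^sub>R v j)" for c :: "nat \<Rightarrow> int"
  have inj: "inj_on F P"
  proof (rule inj_onI)
    fix c d assume cd: "c \<in> P" "d \<in> P" "F c = F d"
    define u where "u y = real_of_int (c (the_inv_into {..<i} v y) - d (the_inv_into {..<i} v y))" for y
    have "(\<Sum>y\<in>v ` {..<i}. u y *\<^sub>R y) = (\<Sum>j<i. u (v j) *\<^sub>R v j)"
      using v(1) by (simp add: sum.reindex)
    also have "\<dots> = (\<Sum>j<i. of_int (c j) *\<^sub>R v j - of_int (d j) *\<^sub>R v j)"
      using v(1) by (intro sum.cong) (auto simp: u_def the_inv_into_f_f scaleR_left_diff_distrib)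
    also have "\<dots> = 0" using cd(3) by (simp add: F_def sum_subtractf)
    finally have "\<forall>y\<in>v ` {..<i}. u y = 0"
      using v(2) by (auto simp: independent_explicit)
    then have "c j = d j" if "j < i" for j
      using that v(1) by (auto simp: u_def the_inv_into_f_f)
    then show "c = d" using cd(1,2) unfolding P_def by (intro PiE_ext) auto
  qed
  have M: "real_of_int (M j) \<le> R / (real i * \<mu> j)" "0 \<le> M j" if "j < i" for j
    using that \<mu>(1)[OF that] R by (auto simp: M_def intro!: divide_nonneg_nonneg)
  have sub: "F ` P \<subseteq> {z\<in>G. norm (T z) \<le> R}"
  proof safe
    fix c assume c: "c \<in> P"
    show "F c \<in> G" unfolding F_def
      by (intro subgroup_sum subgroup_int_scaleR G v) auto
    have "norm (T (F c)) = norm (\<Sum>j<i. of_int (c j) *\<^sub>R T (v j))"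
      using T by (simp add: F_def linear_sum linear_cmul)
    also have "\<dots> \<le> (\<Sum>j<i. R / real i)"
    proof (rule sum_norm_le)
      fix j assume "j \<in> {..<i}"
      then have j: "j < i" by simp
      have "\<bar>c j\<bar> \<le> M j" using c j by (auto simp: P_def PiE_def Pi_def)
      then have "\<bar>real_of_int (c j)\<bar> \<le> R / (real i * \<mu> j)" using M(1)[OF j] by linarith
      then have "\<bar>real_of_int (c j)\<bar> * norm (T (v j)) \<le> R / (real i * \<mu> j) * \<mu> j"
        using \<mu>[OF j] by (intro mult_mono) auto
      then show "norm (of_int (c j) *\<^sub>R T (v j)) \<le> R / real i" using \<mu>(1)[OF j] by simp
    qed
    also have "\<dots> \<le> R" using R by simp
    finally show "norm (T (F c)) \<le> R" .
  qed
  have "(\<Prod>j<i. R / (real i * \<mu> j)) \<le> (\<Prod>j<i. real (card {- M j..M j}))"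
  proof (intro prod_mono conjI)
    fix j assume "j \<in> {..<i}"
    then have j: "j < i" by simp
    show "0 \<le> R / (real i * \<mu> j)" using \<mu>(1)[OF j] R by simp
    have "real (card {- M j..M j}) = 2 * real_of_int (M j) + 1" using M(2)[OF j] by simp
    also have "\<dots> \<ge> R / (real i * \<mu> j)"
      using M(2)[OF j] unfolding M_def by linarith
    finally show "R / (real i * \<mu> j) \<le> real (card {- M j..M j})" .
  qed
  also have "\<dots> = real (card P)" by (simp add: P_def card_PiE)
  also have "\<dots> = real (card (F ` P))" using inj by (simp add: card_image)
  also have "\<dots> \<le> real (card {z\<in>G. norm (T z) \<le> R})" using sub fin by (simp add: card_mono)
  finally show ?thesis .
qed

text \<open>The factor for rank \<open>k + 1\<close> comes from cubes of side
  \<open>r = m / (2 (k + 1))\<close>: the box count then has base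
  \<open>4 \<rho> / r = 8 (k + 1) \<rho> / m\<close>.\<close>

fun count_const :: "nat \<Rightarrow> real" where
  "count_const 0 = 1"
| "count_const (Suc k) = count_const k * (8 * real (Suc k)) ^ Suc k"

lemma count_const_pos: "count_const k > 0"
  by (induction k) auto

text \<open>The ball is cut into cells of diameter less than the last bound; the points in one cell differ by
  elements of a sublattice of smaller rank.\<close>

lemma lattice_count_upper:
  fixes G :: "'a::euclidean_space set" and T :: "'a \<Rightarrow> 'b::euclidean_space"
  assumes T: "linear T" "inj T"
    and G: "\<And>z w. z \<in> G \<Longrightarrow> w \<in> G \<Longrightarrow> z - w \<in> G" and fin: "\<And>r. finite {z\<in>G. norm (T z) \<le> r}"
    and dim: "dim G \<le> k"
    and \<mu>: "\<And>j. j < k \<Longrightarrow> 0 < \<mu> j" "\<And>j. j < k \<Longrightarrow> dim {z\<in>G. norm (T z) < \<mu> j} \<le> j"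
       "\<And>i j. i \<le> j \<Longrightarrow> j < k \<Longrightarrow> \<mu> i \<le> \<mu> j"
    and \<rho>: "\<rho> > 0" "\<And>j. j < k \<Longrightarrow> \<mu> j \<le> \<rho>"
  shows "real (card {z\<in>G. norm (T z) \<le> \<rho>}) \<le> count_const k * \<rho> ^ k / (\<Prod>j<k. \<mu> j)"
  using G fin dim \<mu> \<rho>
proof (induction k arbitrary: G \<rho>)
  case 0
  then have "G \<subseteq> {0}" by (simp add: dim_eq_0)
  then have "card {z\<in>G. norm (T z) \<le> \<rho>} \<le> card {0::'a}" by (intro card_mono) auto
  then show ?case by simp
next
  case (Suc k)
  define m where "m = \<mu> k"
  have m: "m > 0" "m \<le> \<rho>" using Suc.prems by (auto simp: m_def)
  define G' where "G' = G \<inter> span {z\<in>G. norm (T z) < m}"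
  define N where "N = count_const k * m ^ k / (\<Prod>j<k. \<mu> j)"
  have N: "real (card {z\<in>G'. norm (T z) \<le> m}) \<le> N"
    unfolding N_def
  proof (rule Suc.IH)
    show "z - w \<in> G'" if "z \<in> G'" "w \<in> G'" for z w
      using that Suc.prems(1) by (auto simp: G'_def intro: span_diff)
    show "finite {z\<in>G'. norm (T z) \<le> r}" for r
      by (rule finite_subset[OF _ Suc.prems(2)[of r]]) (auto simp: G'_def)
    have "dim G' \<le> dim (span {z\<in>G. norm (T z) < m})"
      by (rule dim_subset) (auto simp: G'_def)
    also have "\<dots> \<le> k" using Suc.prems(5)[of k] by (simp add: m_def)
    finally show "dim G' \<le> k" .
    fix j assume j: "j < k"
    have "dim {z\<in>G'. norm (T z) < \<mu> j} \<le> dim {z\<in>G. norm (T z) < \<mu> j}"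
      by (rule dim_subset) (auto simp: G'_def)
    then show "dim {z\<in>G'. norm (T z) < \<mu> j} \<le> j" using Suc.prems(5)[of j] j by simp
  qed (use Suc.prems m in \<open>auto simp: m_def\<close>)
  have "0 \<le> real (card {z\<in>G'. norm (T z) \<le> m})" by simp
  then have N0: "0 \<le> N" using N by linarith
  obtain B where B: "B \<subseteq> span (T ` G)" "pairwise orthogonal B" "\<And>x. x \<in> B \<Longrightarrow> norm x = 1"
    "independent B" "card B = dim (span (T ` G))" "span B = span (T ` G)"
    by (rule orthonormal_basis_subspace[of "span (T ` G)"]) auto
  have finB: "finite B" using B(4) by (simp add: independent_imp_finite)
  have "dim (T ` G) = dim G"
    using T by (intro dim_image_eq) (auto intro: inj_on_subset)
  then have cB: "card B \<le> Suc k" using B(5) Suc.prems(3) by simp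
  \<comment> \<open>The 2 makes differences within one cube strictly shorter than \<open>m\<close>,
    so that they lie in \<open>G'\<close>, whose dimension is at most \<open>k\<close>.\<close>
  define r where "r = m / (2 * real (Suc k))"
  have r: "r > 0" "r \<le> m" using m by (auto simp: r_def field_simps)
  have cBr: "real (card B) * r < m"
  proof -
    have "real (card B) * r \<le> real (Suc k) * r" using cB r by (intro mult_right_mono) auto
    also have "\<dots> = m / 2" by (simp add: r_def field_simps)
    also have "\<dots> < m" using m by simp
    finally show ?thesis .
  qed
  have "real (card {z\<in>G. norm (T z) \<le> \<rho>}) \<le> N * (\<Prod>e\<in>B. 4 * \<rho> / r)"
  proof (rule box_count[where \<phi>=T])
    show "finite {z\<in>G. norm (T z) \<le> \<rho>}" using Suc.prems by auto
    show "T z \<in> span B" if "z \<in> {z\<in>G. norm (T z) \<le> \<rho>}" for z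
      using that B(6) by (auto intro: span_base)
    show "\<bar>T z \<bullet> e\<bar> \<le> \<rho>" if "z \<in> {z\<in>G. norm (T z) \<le> \<rho>}" "e \<in> B" for z e
      using Cauchy_Schwarz_ineq2[of "T z" e] that B(3) by auto
    fix z assume z: "z \<in> {z\<in>G. norm (T z) \<le> \<rho>}"
    have "(\<lambda>w. w - z) ` {w \<in> {z \<in> G. norm (T z) \<le> \<rho>}. norm (T w - T z) \<le> real (card B) * r}
          \<subseteq> {z\<in>G'. norm (T z) \<le> m}"
      using z cBr Suc.prems(1) T by (auto simp: G'_def linear_diff intro!: span_base)
    moreover have "finite {z\<in>G'. norm (T z) \<le> m}"
      by (rule finite_subset[OF _ Suc.prems(2)[of m]]) (auto simp: G'_def)
    ultimately have "card ((\<lambda>w. w - z) ` {w \<in> {z \<in> G. norm (T z) \<le> \<rho>}. norm (T w - T z) \<le> real (card B) * r})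
       \<le> card {z\<in>G'. norm (T z) \<le> m}" by (intro card_mono)
    then show "real (card {w \<in> {z \<in> G. norm (T z) \<le> \<rho>}. norm (T w - T z) \<le> real (card B) * r}) \<le> N"
      using N by (subst (asm) card_image) (auto simp: inj_on_def)
  qed (use finB B r m N0 in auto)
  also have "(\<Prod>e\<in>B. 4 * \<rho> / r) = (4 * \<rho> / r) ^ card B" by simp
  \<comment> \<open>\<open>card B\<close> may be less than \<open>k + 1\<close>; raising the
    exponent is safe because \<open>r \<le> m \<le> \<rho>\<close> makes the base at least
    1.\<close>
  also have "N * (4 * \<rho> / r) ^ card B \<le> N * (4 * \<rho> / r) ^ Suc k"
    using cB r m N0 by (intro mult_left_mono power_increasing) (auto simp: field_simps)
  also have "4 * \<rho> / r = 8 * real (Suc k) * \<rho> / m" using m by (simp add: r_def field_simps)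
  also have "N * (8 * real (Suc k) * \<rho> / m) ^ Suc k
     = count_const (Suc k) * \<rho> ^ Suc k / (\<Prod>j<Suc k. \<mu> j)"
    using m by (simp add: N_def m_def power_mult_distrib power_divide field_simps del: of_nat_Suc)
  finally show ?case .
qed

section \<open>Successive minima of a lattice measured through a linear map\<close>

text \<open>The group stays fixed and only \<open>T\<close> changes, so lattices at different times
  and points share their vectors and can be compared norm by norm.\<close>

locale lattice_map =
  fixes G :: "'a::euclidean_space set" and T :: "'a \<Rightarrow> 'b::euclidean_space"
  assumes diff: "\<And>z w. z \<in> G \<Longrightarrow> w \<in> G \<Longrightarrow> z - w \<in> G" and zero: "0 \<in> G"
    and lin: "linear T" and inj: "inj T"
    and fin: "\<And>r. finite {z\<in>G. norm (T z) \<le> r}"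
    and full: "dim G = DIM('a)"

text \<open>Minkowski's successive minima of the image of \<open>G\<close> under \<open>T\<close>,
  numbered from 0. For \<open>j \<ge> DIM('a)\<close> the set is empty and the value
  unspecified.\<close>

definition succ_min :: "'a::euclidean_space set \<Rightarrow> ('a \<Rightarrow> 'b::euclidean_space) \<Rightarrow> nat \<Rightarrow> real" where
  "succ_min G T j = Inf {r. 0 \<le> r \<and> j < dim {z\<in>G. norm (T z) \<le> r}}"

context lattice_map
begin

lemma succ_min_le: "0 \<le> r \<Longrightarrow> j < dim {z\<in>G. norm (T z) \<le> r} \<Longrightarrow> succ_min G T j \<le> r"
  unfolding succ_min_def by (rule cInf_lower) (auto intro!: bdd_belowI[of _ 0])

text \<open>Only finitely many norms occur below a given radius, and an admissible radius stays
  admissible when it is lowered to the largest norm it contains. So the infimum may be taken over a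
  finite set.\<close>

lemma succ_min_attained:
  assumes "j < DIM('a)"
  shows "0 \<le> succ_min G T j" "j < dim {z\<in>G. norm (T z) \<le> succ_min G T j}"
proof -
  obtain B where B: "B \<subseteq> G" "independent B" "card B = dim G"
    by (rule basis_exists[of G]) blast
  then have finB: "finite B" using independent_imp_finite by blast
  define X where "X = {r. 0 \<le> r \<and> j < dim {z\<in>G. norm (T z) \<le> r}}"
  obtain r0 where r0: "r0 \<in> X"
  proof
    define r where "r = (\<Sum>z\<in>B. norm (T z))"
    have "norm (T z) \<le> r" if "z \<in> B" for z
      unfolding r_def using that finB by (intro member_le_sum) auto
    then have "B \<subseteq> {z\<in>G. norm (T z) \<le> r}" using B(1) by blast
    then have "dim B \<le> dim {z\<in>G. norm (T z) \<le> r}" by (rule dim_subset)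
    then have "j < dim {z\<in>G. norm (T z) \<le> r}"
      using assms B(3) full dim_eq_card_independent[OF B(2)] by linarith
    then show "r \<in> X" unfolding X_def by (simp add: r_def sum_nonneg)
  qed
  define W where "W = {norm (T z) | z. z \<in> G \<and> norm (T z) \<le> r0} \<inter> X"
  have finW: "finite W"
    using fin[of r0] by (auto simp: W_def setcompr_eq_image)
  have ex: "\<exists>m\<in>W. m \<le> r" if r: "r \<in> X" "r \<le> r0" for r
  proof -
    have "0 \<le> r" using r(1) by (simp add: X_def)
    then have ne: "{z\<in>G. norm (T z) \<le> r} \<noteq> {}" using zero linear_0[OF lin] by force
    obtain z0 where z0: "z0 \<in> {z\<in>G. norm (T z) \<le> r}"
      "\<And>z. z \<in> {z\<in>G. norm (T z) \<le> r} \<Longrightarrow> norm (T z) \<le> norm (T z0)"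
      using obtains_MAX[OF fin[of r] ne, of "\<lambda>z. norm (T z)"] Max_ge[OF finite_imageI[OF fin[of r]]]
      by (metis (no_types, lifting) imageI)
    have "{z\<in>G. norm (T z) \<le> r} = {z\<in>G. norm (T z) \<le> norm (T z0)}"
      using z0(1) z0(2) by force
    then have "norm (T z0) \<in> X" using r(1) by (simp add: X_def)
    then show ?thesis using z0(1) r(2)
      by (intro bexI[of _ "norm (T z0)"]) (auto simp: W_def)
  qed
  have Wne: "W \<noteq> {}"
  proof (cases "\<exists>r\<in>X. r \<le> r0")
    case True
    then show ?thesis using ex by blast
  qed (use r0 in auto)
  have "succ_min G T j = Min W"
  proof -
    have "Inf X = Min W"
    proof (rule cInf_eq_minimum)
      show "Min W \<in> X" using Min_in[OF finW Wne] by (simp add: W_def)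
      show "Min W \<le> r" if "r \<in> X" for r
      proof (cases "r \<le> r0")
        case True
        then show ?thesis using ex[OF that] finW Min_le order_trans by blast
      next
        case False
        have "Min W \<le> r0" using Min_in[OF finW Wne] by (auto simp: W_def)
        then show ?thesis using False by simp
      qed
    qed
    then show ?thesis by (simp add: succ_min_def X_def)
  qed
  then have "succ_min G T j \<in> X" using Min_in[OF finW Wne] by (simp add: W_def)
  then show "0 \<le> succ_min G T j" "j < dim {z\<in>G. norm (T z) \<le> succ_min G T j}"
    by (auto simp: X_def)
qed

lemma dim_less_succ_min: "dim {z\<in>G. norm (T z) < succ_min G T j} \<le> j"
proof (rule ccontr)
  assume "\<not> dim {z\<in>G. norm (T z) < succ_min G T j} \<le> j"
  then have j: "j < dim {z\<in>G. norm (T z) < succ_min G T j}" by simp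
  define S where "S = {z\<in>G. norm (T z) < succ_min G T j}"
  have S: "finite S" by (rule finite_subset[OF _ fin[of "succ_min G T j"]]) (auto simp: S_def)
  have ne: "S \<noteq> {}" using j by (auto simp: S_def[symmetric])
  define r where "r = Max ((\<lambda>z. norm (T z)) ` S)"
  have r: "r < succ_min G T j" "0 \<le> r"
  proof -
    have "r \<in> (\<lambda>z. norm (T z)) ` S" unfolding r_def using S ne by (intro Max_in) auto
    then show "r < succ_min G T j" "0 \<le> r" by (auto simp: S_def)
  qed
  have "S \<subseteq> {z\<in>G. norm (T z) \<le> r}" using S by (auto simp: r_def S_def[symmetric]) (auto simp: S_def)
  then have "j < dim {z\<in>G. norm (T z) \<le> r}" using j dim_subset unfolding S_def by (meson order_less_le_trans)
  then show False using succ_min_le[OF r(2)] r(1) by fastforce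
qed

lemma succ_min_pos:
  assumes "j < DIM('a)" shows "0 < succ_min G T j"
proof (rule ccontr)
  assume "\<not> 0 < succ_min G T j"
  then have "{z\<in>G. norm (T z) \<le> succ_min G T j} \<subseteq> {z\<in>G. T z = 0}"
    using norm_ge_zero order_trans by (fastforce simp: not_less)
  also have "\<dots> \<subseteq> {0}" using lin inj by (auto simp: linear_injective_0)
  finally have "dim {z\<in>G. norm (T z) \<le> succ_min G T j} = 0" by (simp add: dim_eq_0)
  then show False using succ_min_attained(2)[OF assms] by linarith
qed

lemma succ_min_mono:
  assumes "i \<le> j" "j < DIM('a)" shows "succ_min G T i \<le> succ_min G T j"
  using succ_min_attained[OF assms(2)] assms(1) by (intro succ_min_le) auto

end

lemma succ_min_compare:
  assumes "lattice_map G T" "lattice_map G T'" and c: "\<And>z. norm (T z) \<le> c * norm (T' z)" "c \<ge> 0"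
    and j: "j < DIM('a::euclidean_space)"
  shows "succ_min (G :: 'a set) T j \<le> c * succ_min G T' j"
proof -
  interpret A: lattice_map G T by fact
  interpret B: lattice_map G T' by fact
  show ?thesis
  proof (rule A.succ_min_le)
    show "0 \<le> c * succ_min G T' j" using B.succ_min_attained[OF j] c by auto
    have "{z\<in>G. norm (T' z) \<le> succ_min G T' j} \<subseteq> {z\<in>G. norm (T z) \<le> c * succ_min G T' j}"
      using c by (auto intro: order_trans mult_left_mono)
    then show "j < dim {z\<in>G. norm (T z) \<le> c * succ_min G T' j}"
      using B.succ_min_attained(2)[OF j] dim_subset order_less_le_trans by blast
  qed
qed

section \<open>The flow on lattices\<close>

lemma orthonormal_extension:
  fixes S T :: "'a::euclidean_space set"
  assumes S: "pairwise orthogonal S" "\<And>x. x \<in> S \<Longrightarrow> norm x = 1" "S \<subseteq> T" and T: "subspace T"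
  obtains U where "S \<inter> U = {}" "pairwise orthogonal (S \<union> U)" "\<And>x. x \<in> S \<union> U \<Longrightarrow> norm x = 1"
    "span (S \<union> U) = T" "finite (S \<union> U)" "card (S \<union> U) = dim T"
proof -
  obtain U where U: "U \<inter> insert 0 S = {}" "pairwise orthogonal (S \<union> U)" "span (S \<union> U) = span (S \<union> T)"
    using orthogonal_extension_strong[OF S(1)] by blast
  define V where "V = (\<lambda>u. u /\<^sub>R norm u) ` U"
  have U0: "u \<noteq> 0" if "u \<in> U" for u using U(1) that by auto
  have po: "pairwise orthogonal (S \<union> V)"
  proof (unfold pairwise_def, intro ballI impI)
    fix x y assume xy: "x \<in> S \<union> V" "y \<in> S \<union> V" "x \<noteq> y"
    obtain c u where c: "x = c *\<^sub>R u" "u \<in> S \<union> U" "x \<in> S \<Longrightarrow> u = x" "x \<in> V \<Longrightarrow> x = u /\<^sub>R norm u"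
      using xy(1) S(2) unfolding V_def by (cases "x \<in> S") (auto intro: that[of 1 x])
    obtain d v where d: "y = d *\<^sub>R v" "v \<in> S \<union> U" "y \<in> S \<Longrightarrow> v = y" "y \<in> V \<Longrightarrow> y = v /\<^sub>R norm v"
      using xy(2) S(2) unfolding V_def by (cases "y \<in> S") (auto intro: that[of 1 y])
    have "u \<noteq> v"
    proof
      assume "u = v"
      then have "x = v /\<^sub>R norm v" "y = v /\<^sub>R norm v"
        using c d xy S(2) by (metis Un_iff divideR_right inverse_1 scaleR_one zero_neq_one)+
      then show False using xy(3) by simp
    qed
    then have "orthogonal u v" using U(2) c(2) d(2) by (meson pairwiseD)
    then show "orthogonal x y" unfolding c(1) d(1) by (simp add: orthogonal_clauses)
  qed
  have n1: "norm x = 1" if "x \<in> S \<union> V" for x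
    using that S(2) U0 by (auto simp: V_def)
  have dis: "S \<inter> V = {}"
  proof (rule ccontr)
    assume "S \<inter> V \<noteq> {}"
    then obtain u where u: "u \<in> U" "u /\<^sub>R norm u \<in> S" by (auto simp: V_def)
    then have "u /\<^sub>R norm u \<noteq> u" using U(1) by force
    then have "orthogonal (u /\<^sub>R norm u) u" using U(2) u by (meson UnI1 UnI2 pairwiseD)
    then show False using U0[OF u(1)] by (simp add: orthogonal_def)
  qed
  have "span (S \<union> V) = span (S \<union> U)"
  proof (rule subset_antisym; rule span_minimal)
    show "S \<union> V \<subseteq> span (S \<union> U)" by (auto simp: V_def intro: span_base span_scale)
    have "u \<in> span (S \<union> V)" if "u \<in> U" for u
    proof -
      have "norm u *\<^sub>R (u /\<^sub>R norm u) \<in> span (S \<union> V)"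
        using that by (intro span_scale span_base) (auto simp: V_def)
      then show ?thesis using U0[OF that] by simp
    qed
    then show "S \<union> U \<subseteq> span (S \<union> V)" by (auto intro: span_base)
  qed auto
  also have "\<dots> = T" using U(3) S(3) T by (simp add: Un_absorb1 span_eq_iff)
  finally have sp: "span (S \<union> V) = T" .
  have fin: "finite (S \<union> V)" using po pairwise_orthogonal_imp_finite by blast
  have "0 \<notin> S \<union> V" using n1 by fastforce
  then have "independent (S \<union> V)" using po pairwise_orthogonal_independent by blast
  then have "card (S \<union> V) = dim T" using sp by (metis dim_span dim_eq_card_independent)
  then show ?thesis using that[OF dis po n1 sp fin] by blast
qed

text \<open>The unit vector \<open>a\<close> is the normalized projection of \<open>c\<close> to \<open>W\<close>.\<close>

lemma adapted_orthonormal_basis: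
  fixes W :: "'a::euclidean_space set"
  assumes W: "subspace W" and w: "w \<in> W" "\<bar>w \<bullet> c\<bar> > \<sigma> * norm w" and \<sigma>: "\<sigma> \<ge> 0"
  obtains a B where "a \<notin> B" "pairwise orthogonal (insert a B)" "\<And>e. e \<in> insert a B \<Longrightarrow> norm e = 1"
    "span (insert a B) = W" "finite B" "card (insert a B) = dim W" "a \<bullet> c > \<sigma>" "\<And>e. e \<in> B \<Longrightarrow> e \<bullet> c = 0"
proof -
  obtain y z where yz: "y \<in> span W" "\<And>w. w \<in> span W \<Longrightarrow> orthogonal z w" "c = y + z"
    by (rule orthogonal_subspace_decomp_exists[of W c]) blast
  have yW: "y \<in> W" using yz(1) W by (metis span_eq_iff)
  have ic: "u \<bullet> c = u \<bullet> y" if "u \<in> W" for u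
    using yz(2)[of u] that by (simp add: yz(3) inner_add_right orthogonal_def inner_commute span_base)
  \<comment> \<open>\<open>w\<close> sees only the projection \<open>y\<close> of \<open>c\<close>,
    so Cauchy-Schwarz turns the angle of \<open>w\<close> into
    \<open>norm y > \<sigma>\<close>.\<close>
  have "\<sigma> * norm w < \<bar>w \<bullet> y\<bar>" using w ic by simp
  also have "\<dots> \<le> norm w * norm y" by (rule Cauchy_Schwarz_ineq2)
  finally have "norm w * \<sigma> < norm w * norm y" by (simp add: mult.commute)
  then have y: "norm y > \<sigma>" by (simp add: mult_less_cancel_left)
  then have y0: "y \<noteq> 0" "norm y > 0" using \<sigma> by auto
  define a where "a = y /\<^sub>R norm y"
  have aW: "a \<in> W" using yW W by (simp add: a_def subspace_scale)
  have na: "norm a = 1" using y0 by (simp add: a_def)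
  obtain U where U: "{a} \<inter> U = {}" "pairwise orthogonal ({a} \<union> U)" "\<And>x. x \<in> {a} \<union> U \<Longrightarrow> norm x = 1"
    "span ({a} \<union> U) = W" "finite ({a} \<union> U)" "card ({a} \<union> U) = dim W"
    by (rule orthonormal_extension[of "{a}" W]) (use aW na W in auto)
  show ?thesis
  proof (rule that[of a U])
    have "a \<bullet> c = inverse (norm y) * (y \<bullet> y)" using ic[OF aW] by (simp add: a_def)
    also have "\<dots> = norm y" using y0(2) unfolding dot_square_norm by (simp add: power2_eq_square)
    finally have "a \<bullet> c = norm y" .
    then show "a \<bullet> c > \<sigma>" using y by simp
    fix e assume e: "e \<in> U"
    then have "e \<in> W" using U(4) span_base[of e "{a} \<union> U"] by simp
    moreover have "orthogonal e a" using U(1) e by (intro pairwiseD[OF U(2)]) auto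
    ultimately show "e \<bullet> c = 0" using ic y0 by (simp add: a_def orthogonal_def)
  next
    show "a \<notin> U" using U(1) by simp
    show "card (insert a U) = dim W" using U(6) by simp
  qed (use U in simp_all)
qed

section \<open>The integer lattice moved by the flow\<close>

definition int_lattice :: "(real \<times> (real^'n::finite)) set" where
  "int_lattice = {z. fst z \<in> \<int> \<and> (\<forall>i. snd z $ i \<in> \<int>)}"

text \<open>With \<open>b = e\<^sup>t\<close>, this is the unipotent matrix of \<open>x\<close> followed by the \<open>k\<close>-th power of
  \<open>diag (e\<^sup>n\<^sup>t, e\<^sup>-\<^sup>t, \<dots>, e\<^sup>-\<^sup>t)\<close>.\<close>

definition flow_map :: "real \<Rightarrow> nat \<Rightarrow> real^'n::finite \<Rightarrow> real \<times> (real^'n) \<Rightarrow> real \<times> (real^'n)" where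
  "flow_map b k x z = (b ^ (CARD('n) * k) * (fst z + snd z \<bullet> x), (1 / b ^ k) *\<^sub>R snd z)"

lemma linear_flow_map: "linear (flow_map b k x)"
  by (rule linearI) (auto simp: flow_map_def inner_add_left algebra_simps scaleR_add_right)

lemma inj_flow_map:
  assumes "b > 0" shows "inj (flow_map b k x)"
  using assms by (intro injI) (auto simp: flow_map_def prod_eq_iff)

lemma int_lattice_diff: "z \<in> int_lattice \<Longrightarrow> w \<in> int_lattice \<Longrightarrow> z - w \<in> int_lattice"
  by (auto simp: int_lattice_def)

lemma norm_snd_le': "norm (snd z) \<le> norm z" and norm_fst_le': "norm (fst z) \<le> norm z"
  using norm_snd_le[of "snd z" "fst z"] norm_fst_le[of "fst z" "snd z"] by auto

lemma finite_int_lattice: "finite {z\<in>int_lattice :: (real \<times> (real^'n::finite)) set. norm z \<le> r}"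
proof -
  define N where "N = \<lceil>r\<rceil>"
  define F where "F = (\<lambda>(p::int, q::'n \<Rightarrow> int). (real_of_int p, \<chi> i. real_of_int (q i)))"
  have "{z\<in>int_lattice :: (real \<times> (real^'n)) set. norm z \<le> r} \<subseteq> F ` ({-N..N} \<times> (\<Pi>\<^sub>E i\<in>UNIV. {-N..N}))"
  proof clarify
    fix p :: real and q :: "real^'n" assume z: "(p,q) \<in> int_lattice" "norm (p,q) \<le> r"
    have p: "p = of_int \<lfloor>p\<rfloor>" and q: "q $ i = of_int \<lfloor>q $ i\<rfloor>" for i
      using z(1) by (auto simp: int_lattice_def of_int_floor)
    have ap: "\<bar>p\<bar> \<le> r" using norm_fst_le[of p q] z(2) by simp
    have aq: "\<bar>q $ i\<bar> \<le> r" for i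
      using component_le_norm_cart[of q i] norm_snd_le[of q p] z(2) by linarith
    show "(p,q) \<in> F ` ({-N..N} \<times> (\<Pi>\<^sub>E i\<in>UNIV. {-N..N}))"
    proof (rule image_eqI[where x="(\<lfloor>p\<rfloor>, \<lambda>i. \<lfloor>q $ i\<rfloor>)"])
      show "(p,q) = F (\<lfloor>p\<rfloor>, \<lambda>i. \<lfloor>q $ i\<rfloor>)"
        using p q by (simp add: F_def vec_eq_iff)
      have "-N \<le> \<lfloor>p\<rfloor> \<and> \<lfloor>p\<rfloor> \<le> N" using ap unfolding N_def by linarith
      moreover have "-N \<le> \<lfloor>q $ i\<rfloor> \<and> \<lfloor>q $ i\<rfloor> \<le> N" for i using aq[of i] unfolding N_def by linarith
      ultimately show "(\<lfloor>p\<rfloor>, \<lambda>i. \<lfloor>q $ i\<rfloor>) \<in> {-N..N} \<times> (\<Pi>\<^sub>E i\<in>UNIV. {-N..N})" by auto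
    qed
  qed
  then show ?thesis by (rule finite_subset) (intro finite_imageI finite_cartesian_product finite_PiE, auto)
qed

lemma lattice_map_flow_map:
  assumes b: "b > 0"
  shows "lattice_map int_lattice (flow_map b k x)"
proof (rule lattice_map.intro)
  show "finite {z \<in> int_lattice. norm (flow_map b k x z) \<le> r}" for r
  proof -
    obtain B where B: "B > 0" "\<And>z. B * norm z \<le> norm (flow_map b k x z)"
      by (rule linear_inj_bounded_below_pos[OF linear_flow_map inj_flow_map[OF b]]) blast
    have "{z \<in> int_lattice. norm (flow_map b k x z) \<le> r} \<subseteq> {z \<in> int_lattice. norm z \<le> r / B}"
    proof safe
      fix p q assume "norm (flow_map b k x (p, q)) \<le> r"
      then have "B * norm (p,q) \<le> r" using B(2)[of "(p,q)"] by linarith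
      then show "norm (p,q) \<le> r / B" using B(1) by (simp add: field_simps)
    qed
    then show ?thesis using finite_int_lattice finite_subset by blast
  qed
  have "(Basis :: (real \<times> (real^'a)) set) \<subseteq> int_lattice"
    by (auto simp: Basis_prod_def int_lattice_def Basis_vec_def axis_def)
  then have "dim (Basis :: (real \<times> (real^'a)) set) \<le> dim (int_lattice :: (real \<times> (real^'a)) set)"
    by (rule dim_subset)
  then show "dim (int_lattice :: (real \<times> (real^'a)) set) = DIM(real \<times> (real^'a))"
    using dim_subset_UNIV[of "int_lattice :: (real \<times> (real^'a)) set"]
      dim_span[of "Basis :: (real \<times> (real^'a)) set"] by simp
  show "linear (flow_map b k x)" "inj (flow_map b k x)"
    by (rule linear_flow_map) (rule inj_flow_map[OF b])
qed (auto simp: int_lattice_def)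

text \<open>By time \<open>k\<close> the flow stretches a unipotent shift by
  \<open>b^((n+1)k)\<close>, so a shift of size \<open>b^-((n+1)k)\<close> has become bounded. This
  dictates the size of the cells: all points of a cell at level \<open>k\<close> have comparable
  lattices at time \<open>k\<close>.\<close>

lemma norm_flow_map_perturb:
  fixes x x' :: "real^'n::finite"
  assumes b: "b > 0" and x: "\<And>i. \<bar>x' $ i - x $ i\<bar> \<le> 1 / b ^ (Suc CARD('n) * k)"
  shows "norm (flow_map b k x' z) \<le> (1 + real CARD('n)) * norm (flow_map b k x z)"
proof -
  let ?n = "CARD('n)"
  have "norm (x' - x) \<le> (\<Sum>i\<in>UNIV. \<bar>(x' - x) $ i\<bar>)" by (rule norm_le_l1_cart)
  also have "\<dots> \<le> (\<Sum>i\<in>(UNIV::'n set). 1 / b ^ (Suc ?n * k))" by (rule sum_mono) (use x in auto)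
  finally have d: "norm (x' - x) \<le> real ?n / b ^ (Suc ?n * k)" by simp
  have "flow_map b k x' z = flow_map b k x z + (b ^ (?n * k) * (snd z \<bullet> (x' - x)), 0)"
    by (simp add: flow_map_def inner_diff_right algebra_simps)
  then have "norm (flow_map b k x' z) \<le> norm (flow_map b k x z) + norm (b ^ (?n * k) * (snd z \<bullet> (x' - x)), 0::real^'n)"
    by (metis norm_triangle_ineq)
  also have "norm (b ^ (?n * k) * (snd z \<bullet> (x' - x)), 0::real^'n) = b ^ (?n * k) * \<bar>snd z \<bullet> (x' - x)\<bar>"
    using b by (simp add: norm_Pair abs_mult)
  also have "\<dots> \<le> b ^ (?n * k) * (norm (snd z) * (real ?n / b ^ (Suc ?n * k)))"
    using b d by (intro mult_left_mono order_trans[OF Cauchy_Schwarz_ineq2] mult_left_mono) auto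
  also have "\<dots> = real ?n * norm (snd (flow_map b k x z))"
    using b by (simp add: flow_map_def power_add field_simps)
  also have "\<dots> \<le> real ?n * norm (flow_map b k x z)"
    by (intro mult_left_mono norm_snd_le') auto
  finally show ?thesis by (simp add: algebra_simps)
qed

lemma flow_map_Suc:
  fixes x :: "real^'n::finite"
  shows "flow_map b (Suc k) x z = (b ^ CARD('n) * fst (flow_map b k x z), (1 / b) *\<^sub>R snd (flow_map b k x z))"
  by (simp add: flow_map_def power_add)

lemma norm_flow_map_Suc:
  fixes x :: "real^'n::finite"
  assumes b: "b \<ge> 1"
  shows "norm (flow_map b (Suc k) x z) \<le> b ^ CARD('n) * norm (flow_map b k x z)"
    and "norm (flow_map b k x z) \<le> b * norm (flow_map b (Suc k) x z)"
proof -
  define u v where "u = fst (flow_map b k x z)" and "v = snd (flow_map b k x z)"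
  have uv: "flow_map b k x z = (u, v)" "flow_map b (Suc k) x z = (b ^ CARD('n) * u, (1/b) *\<^sub>R v)"
    by (simp_all add: flow_map_Suc u_def v_def)
  have n1: "b ^ CARD('n) \<ge> 1" using b by simp
  have le: "norm (c * u, d *\<^sub>R v) \<le> m * norm (u, v)" if "0 \<le> c" "c \<le> m" "0 \<le> d" "d \<le> m" for c d m
  proof -
    have "norm (c * u, d *\<^sub>R v) = sqrt ((c * u)\<^sup>2 + (d * norm v)\<^sup>2)" using that by (simp add: norm_Pair)
    also have "\<dots> \<le> sqrt ((m * \<bar>u\<bar>)\<^sup>2 + (m * norm v)\<^sup>2)"
      using that by (intro real_sqrt_le_mono add_mono) (auto simp: power_mult_distrib intro!: mult_right_mono power_mono)
    also have "\<dots> = sqrt (m\<^sup>2 * (u\<^sup>2 + (norm v)\<^sup>2))" by (simp add: power_mult_distrib algebra_simps)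
    also have "\<dots> = m * norm (u, v)" using that by (simp add: norm_Pair real_sqrt_mult)
    finally show ?thesis .
  qed
  have "1 / b \<le> b ^ CARD('n)"
    using n1 b by (meson divide_le_eq_1_pos dual_order.trans less_le_trans zero_less_one)
  then show "norm (flow_map b (Suc k) x z) \<le> b ^ CARD('n) * norm (flow_map b k x z)"
    using b n1 unfolding uv by (intro le) auto
  have "1 \<le> b * b ^ CARD('n)" using n1 b by (metis mult_mono' mult_1 zero_le_one)
  have "norm (u, v) = sqrt (u\<^sup>2 + (norm v)\<^sup>2)" by (simp add: norm_Pair)
  also have "\<dots> \<le> sqrt ((b * (b ^ CARD('n) * u))\<^sup>2 + (b * ((1 / b) * norm v))\<^sup>2)"
  proof (intro real_sqrt_le_mono add_mono)
    have "\<bar>u\<bar> \<le> \<bar>b * (b ^ CARD('n) * u)\<bar>"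
      using \<open>1 \<le> b * b ^ CARD('n)\<close> b by (simp add: abs_mult mult.assoc[symmetric] mult_le_cancel_right1)
    then show "u\<^sup>2 \<le> (b * (b ^ CARD('n) * u))\<^sup>2" by (simp add: abs_le_square_iff)
  qed (use b in auto)
  also have "\<dots> = sqrt (b\<^sup>2 * ((b ^ CARD('n) * u)\<^sup>2 + ((1 / b) * norm v)\<^sup>2))"
    by (simp only: power_mult_distrib distrib_left)
  also have "\<dots> = b * norm (b ^ CARD('n) * u, (1/b) *\<^sub>R v)"
    using b by (simp add: norm_Pair real_sqrt_mult)
  finally show "norm (flow_map b k x z) \<le> b * norm (flow_map b (Suc k) x z)" unfolding uv .
qed

section \<open>Products of minima along the flow\<close>

definition minima_at :: "real \<Rightarrow> nat \<Rightarrow> real^'n::finite \<Rightarrow> nat \<Rightarrow> real" where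
  "minima_at b k x j = succ_min int_lattice (flow_map b k x) j"

text \<open>By Minkowski's second theorem this is, up to constants, the reciprocal of the least
  covolume of a sublattice of rank \<open>i\<close>.\<close>

definition inv_minima :: "real \<Rightarrow> nat \<Rightarrow> real^'n::finite \<Rightarrow> nat \<Rightarrow> real" where
  "inv_minima b k x i = (\<Prod>j<i. 1 / minima_at b k x j)"

lemma minima_at_pos:
  fixes x :: "real^'n::finite"
  assumes "b > 0" "j \<le> CARD('n)" shows "minima_at b k x j > 0"
proof -
  interpret lattice_map "int_lattice :: (real \<times> (real^'n)) set" "flow_map b k x"
    by (rule lattice_map_flow_map[OF assms(1)])
  show ?thesis unfolding minima_at_def by (rule succ_min_pos) (use assms in auto)
qed

lemma inv_minima_pos:
  fixes x :: "real^'n::finite"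
  assumes "b > 0" "i \<le> Suc CARD('n)" shows "inv_minima b k x i > 0"
  unfolding inv_minima_def
proof (intro prod_pos ballI)
  fix j assume "j \<in> {..<i}"
  then have "minima_at b k x j > 0" using assms by (intro minima_at_pos) auto
  then show "0 < 1 / minima_at b k x j" by simp
qed

text \<open>A priori bound from the strongest contraction that a vector can suffer in one step. It
  serves where nothing finer is available: for ranks without a gap, and for the few children that
  keep a subspace extremely close to the contracted hyperplane.\<close>

lemma inv_minima_child_le:
  fixes x x' :: "real^'n::finite"
  assumes b: "b \<ge> 1" and near: "\<And>i. \<bar>x' $ i - x $ i\<bar> \<le> 1 / b ^ (Suc CARD('n) * k)" and i: "i \<le> Suc CARD('n)"
  shows "inv_minima b (Suc k) x' i \<le> ((1 + real CARD('n)) * b) ^ i * inv_minima b k x i"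
proof -
  have b0: "b > 0" using b by simp
  define c where "c = (1 + real CARD('n)) * b"
  have c: "c > 0" using b0 by (simp add: c_def add_pos_nonneg)
  have le: "norm (flow_map b k x z) \<le> c * norm (flow_map b (Suc k) x' z)" for z
  proof -
    have "norm (flow_map b k x z) \<le> (1 + real CARD('n)) * norm (flow_map b k x' z)"
      by (rule norm_flow_map_perturb[OF b0]) (use near in \<open>simp add: abs_minus_commute\<close>)
    also have "\<dots> \<le> (1 + real CARD('n)) * (b * norm (flow_map b (Suc k) x' z))"
      by (intro mult_left_mono norm_flow_map_Suc(2)[OF b]) auto
    finally show ?thesis by (simp add: c_def mult_ac)
  qed
  have "inv_minima b (Suc k) x' i \<le> (\<Prod>j<i. c * (1 / minima_at b k x j))"
    unfolding inv_minima_def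
  proof (intro prod_mono conjI)
    fix j assume "j \<in> {..<i}"
    then have j: "j \<le> CARD('n)" using i by auto
    have "minima_at b k x j \<le> c * minima_at b (Suc k) x' j"
      unfolding minima_at_def
      by (rule succ_min_compare[OF lattice_map_flow_map[OF b0] lattice_map_flow_map[OF b0] le])
         (use c j in auto)
    then show "1 / minima_at b (Suc k) x' j \<le> c * (1 / minima_at b k x j)"
      using minima_at_pos[OF b0 j, of k x] minima_at_pos[OF b0 j, of "Suc k" x'] c by (simp add: field_simps)
    show "0 \<le> 1 / minima_at b (Suc k) x' j" using minima_at_pos[OF b0 j, of "Suc k" x'] by simp
  qed
  also have "\<dots> = c ^ i * inv_minima b k x i" unfolding prod.distrib inv_minima_def by simp
  finally show ?thesis unfolding c_def .
qed

lemma minima_at_child_le: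
  fixes x x' :: "real^'n::finite"
  assumes b: "b \<ge> 1" and near: "\<And>i. \<bar>x' $ i - x $ i\<bar> \<le> 1 / b ^ (Suc CARD('n) * k)" and j: "j \<le> CARD('n)"
  shows "minima_at b (Suc k) x' j \<le> (1 + real CARD('n)) * b ^ CARD('n) * minima_at b k x j"
proof -
  have b0: "b > 0" using b by simp
  have "norm (flow_map b (Suc k) x' z) \<le> (1 + real CARD('n)) * b ^ CARD('n) * norm (flow_map b k x z)" for z
  proof -
    have "norm (flow_map b (Suc k) x' z) \<le> b ^ CARD('n) * norm (flow_map b k x' z)"
      by (rule norm_flow_map_Suc[OF b])
    also have "\<dots> \<le> b ^ CARD('n) * ((1 + real CARD('n)) * norm (flow_map b k x z))"
      using b0 near by (intro mult_left_mono norm_flow_map_perturb) auto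
    finally show ?thesis by (simp add: mult_ac)
  qed
  then show ?thesis unfolding minima_at_def
    by (rule succ_min_compare[OF lattice_map_flow_map[OF b0] lattice_map_flow_map[OF b0]])
       (use b0 j in auto)
qed

lemma dim_minima_at:
  fixes x :: "real^'n::finite"
  assumes b: "b > 0"
  shows "j \<le> CARD('n) \<Longrightarrow> j < dim {z\<in>int_lattice. norm (flow_map b k x z) \<le> minima_at b k x j}"
    and "dim {z\<in>int_lattice. norm (flow_map b k x z) < minima_at b k x j} \<le> j"
    and "i \<le> j \<Longrightarrow> j \<le> CARD('n) \<Longrightarrow> minima_at b k x i \<le> minima_at b k x j"
proof -
  interpret lattice_map "int_lattice :: (real \<times> (real^'n)) set" "flow_map b k x"
    by (rule lattice_map_flow_map[OF b])
  show "j \<le> CARD('n) \<Longrightarrow> j < dim {z\<in>int_lattice. norm (flow_map b k x z) \<le> minima_at b k x j}"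
    unfolding minima_at_def by (rule succ_min_attained(2)) simp
  show "dim {z\<in>int_lattice. norm (flow_map b k x z) < minima_at b k x j} \<le> j"
    unfolding minima_at_def by (rule dim_less_succ_min)
  show "i \<le> j \<Longrightarrow> j \<le> CARD('n) \<Longrightarrow> minima_at b k x i \<le> minima_at b k x j"
    unfolding minima_at_def by (rule succ_min_mono) simp_all
qed

lemma finite_flow_map:
  fixes x :: "real^'n::finite"
  assumes "b > 0" shows "finite {z\<in>int_lattice. norm (flow_map b k x z) \<le> r}"
  using lattice_map.fin[OF lattice_map_flow_map[OF assms]] .

text \<open>Turns minima into a number of points of \<open>V\<close>, provided that the vectors
  realizing them lie in \<open>V\<close>. The radius \<open>R\<close> stays free and cancels later
  against an upper count.\<close>

lemma count_lower_minima:
  fixes x :: "real^'n::finite"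
  assumes b: "b > 0" and i: "i \<le> Suc CARD('n)" and V: "subspace V"
    and sub: "\<And>j. j < i \<Longrightarrow> {z\<in>int_lattice. norm (flow_map b k x z) \<le> minima_at b k x j} \<subseteq> V" and R: "R > 0"
  shows "(R / real i) ^ i * inv_minima b k x i \<le> real (card {z\<in>int_lattice \<inter> V. norm (flow_map b k x z) \<le> R})"
proof -
  have "j < dim {z\<in>int_lattice. norm (flow_map b k x z) \<le> minima_at b k x j}" if "j < i" for j
    by (rule dim_minima_at(1)[OF b]) (use that i in simp)
  then obtain v where v: "\<forall>j<i. v j \<in> {z\<in>int_lattice. norm (flow_map b k x z) \<le> minima_at b k x j}"
    "inj_on v {..<i}" "independent (v ` {..<i})"
    using independent_transversal[of i "\<lambda>j. {z\<in>int_lattice. norm (flow_map b k x z) \<le> minima_at b k x j}"]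
    by blast
  have "(\<Prod>j<i. R / (real i * minima_at b k x j)) \<le> real (card {z\<in>int_lattice \<inter> V. norm (flow_map b k x z) \<le> R})"
  proof (rule lattice_count_lower[OF _ _ linear_flow_map _ v(2,3)])
    show "z - w \<in> int_lattice \<inter> V" if "z \<in> int_lattice \<inter> V" "w \<in> int_lattice \<inter> V" for z w
      using that V by (auto intro: int_lattice_diff subspace_diff)
    show "0 \<in> int_lattice \<inter> V" using V by (auto simp: int_lattice_def subspace_0)
    show "finite {z \<in> int_lattice \<inter> V. norm (flow_map b k x z) \<le> R}"
      by (rule finite_subset[OF _ finite_flow_map[OF b, of k x R]]) auto
    fix j assume j: "j < i"
    show "v j \<in> int_lattice \<inter> V" using v(1) sub[OF j] j by blast
    show "0 < minima_at b k x j" by (rule minima_at_pos[OF b]) (use j i in simp)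
    show "norm (flow_map b k x (v j)) \<le> minima_at b k x j" using v(1) j by blast
  qed fact
  also have "(\<Prod>j<i. R / (real i * minima_at b k x j)) = (\<Prod>j<i. (R / real i) * (1 / minima_at b k x j))" by simp
  also have "\<dots> = (R / real i) ^ i * inv_minima b k x i" unfolding prod.distrib inv_minima_def by simp
  finally show ?thesis .
qed

text \<open>The whole lattice has covolume 1 at every time, so its minima cannot all be small. The
  points in a ball are counted from below by the minima and from above by boxes.\<close>

lemma inv_minima_full_le:
  fixes x :: "real^'n::finite"
  assumes b: "b > 0"
  shows "inv_minima b k x (Suc CARD('n)) \<le> (8 * (1 + real CARD('n))\<^sup>2) ^ Suc CARD('n)"
proof -
  define n where "n = CARD('n)"
  \<comment> \<open>Only the shear is applied to the points; the diagonal part enters through the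
    shape \<open>h\<close> of the box, whose half-sides multiply to \<open>R^(n+1)\<close> because
    the flow has determinant 1.\<close>
  define \<phi> where "\<phi> z = (fst z + snd z \<bullet> x, snd z)" for z :: "real \<times> (real^'n)"
  define r :: real where "r = 1 / (2 * (1 + real n))"
  have r: "r > 0" by (simp add: r_def add_pos_nonneg)
  \<comment> \<open>Large enough that every half-side of the box is at least
    \<open>r\<close>.\<close>
  define R where "R = max (r * b ^ (n * k)) (r / b ^ k)"
  have R: "R > 0" using r b by (simp add: R_def less_max_iff_disj)
  define h where "h e = (if fst e = 0 then b ^ k * R else R / b ^ (n * k))" for e :: "real \<times> (real^'n)"
  have Basis: "(Basis :: (real \<times> (real^'n)) set) = insert (1, 0) (Pair 0 ` Basis)"
    by (auto simp: Basis_prod_def)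
  let ?S = "{z\<in>int_lattice. norm (flow_map b k x z) \<le> R}"
  have "real (card ?S) \<le> 1 * (\<Prod>e\<in>Basis. 4 * h e / r)"
  proof (rule box_count[where \<phi>=\<phi>])
    show "finite ?S" by (rule finite_flow_map[OF b])
    show "\<bar>\<phi> z \<bullet> e\<bar> \<le> h e" if "z \<in> ?S" "e \<in> Basis" for z e
    proof -
      have 1: "b ^ (n * k) * \<bar>fst z + snd z \<bullet> x\<bar> \<le> R" "norm (snd z) / b ^ k \<le> R"
        using that(1) b norm_fst_le'[of "flow_map b k x z"] norm_snd_le'[of "flow_map b k x z"]
        by (auto simp: flow_map_def n_def abs_mult)
      from that(2) consider "e = (1,0)" | d where "e = (0,d)" "d \<in> Basis" using Basis by auto
      then show ?thesis
      proof cases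
        case 1
        then show ?thesis using \<open>b ^ (n * k) * \<bar>fst z + snd z \<bullet> x\<bar> \<le> R\<close> b
          by (simp add: h_def \<phi>_def inner_prod_def field_simps)
      next
        case 2
        have "\<bar>snd z \<bullet> d\<bar> \<le> norm (snd z)" using 2 by (simp add: Basis_le_norm)
        also have "\<dots> \<le> b ^ k * R" using 1(2) b by (simp add: field_simps)
        finally show ?thesis using 2 by (simp add: h_def \<phi>_def inner_prod_def)
      qed
    qed
    show "r \<le> h e" for e
      using b r by (auto simp: h_def R_def field_simps max_def split: if_splits)
    fix z assume z: "z \<in> ?S"
    have "{w \<in> ?S. norm (\<phi> w - \<phi> z) \<le> real (card (Basis :: (real \<times> (real^'n)) set)) * r} \<subseteq> {z}"
    proof safe
      fix w1 w2 assume w: "(w1,w2) \<in> int_lattice"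
        "norm (\<phi> (w1,w2) - \<phi> z) \<le> real (card (Basis :: (real \<times> (real^'n)) set)) * r"
      have lt: "norm (\<phi> (w1,w2) - \<phi> z) < 1"
      proof -
        have "real (card (Basis :: (real \<times> (real^'n)) set)) * r = (1 + real n) * r" by (simp add: n_def)
        also have "\<dots> = 1 / 2" using add_pos_nonneg[of 1 "real n"] by (simp add: r_def)
        finally show ?thesis using w(2) by linarith
      qed
      \<comment> \<open>The vector parts are identified first: only then does the shear cancel in
        the remaining coordinate and leave a difference of integers.\<close>
      have sw: "w2 = snd z"
      proof (rule vec_eq_iff[THEN iffD2], intro allI)
        fix j
        have "\<bar>(w2 - snd z) $ j\<bar> \<le> norm (w2 - snd z)" by (rule component_le_norm_cart)
        also have "\<dots> < 1" using lt norm_snd_le'[of "\<phi> (w1,w2) - \<phi> z"] by (simp add: \<phi>_def)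
        finally have "\<bar>w2 $ j - snd z $ j\<bar> < 1" by simp
        moreover have "w2 $ j \<in> \<int>" "snd z $ j \<in> \<int>" using w(1) z by (auto simp: int_lattice_def)
        ultimately show "w2 $ j = snd z $ j" by (metis Ints_diff Ints_nonzero_abs_less1 eq_iff_diff_eq_0)
      qed
      have "\<bar>w1 - fst z\<bar> < 1" using lt norm_fst_le'[of "\<phi> (w1,w2) - \<phi> z"] by (simp add: \<phi>_def sw)
      moreover have "w1 \<in> \<int>" "fst z \<in> \<int>" using w(1) z by (auto simp: int_lattice_def)
      ultimately have "w1 = fst z" by (metis Ints_diff Ints_nonzero_abs_less1 eq_iff_diff_eq_0)
      then show "(w1,w2) = z" using sw by simp
    qed
    then have "card {w \<in> ?S. norm (\<phi> w - \<phi> z) \<le> real (card (Basis :: (real \<times> (real^'n)) set)) * r} \<le> card {z}"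
      by (intro card_mono) auto
    then show "real (card {w \<in> ?S. norm (\<phi> w - \<phi> z) \<le> real (card (Basis :: (real \<times> (real^'n)) set)) * r}) \<le> 1"
      by simp
  qed (use r in \<open>auto simp: pairwise_def orthogonal_def inner_not_same_Basis\<close>)
  also have "1 * (\<Prod>e\<in>Basis. 4 * h e / r) = (4 * (R / b ^ (n * k)) / r) * (4 * (b ^ k * R) / r) ^ n"
    unfolding Basis by (subst prod.insert) (auto simp: h_def prod.reindex inj_on_def n_def)
  also have "\<dots> = (4 * R / r) ^ Suc n"
    using b r by (simp add: power_mult_distrib power_divide power_mult[symmetric] field_simps)
  finally have up: "real (card ?S) \<le> (4 * R / r) ^ Suc n" .
  have "(R / real (Suc n)) ^ Suc n * inv_minima b k x (Suc n) \<le> real (card {z\<in>int_lattice \<inter> UNIV. norm (flow_map b k x z) \<le> R})"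
    unfolding n_def by (rule count_lower_minima[OF b]) (use R in auto)
  also have "\<dots> \<le> (4 * R / r) ^ Suc n" using up by simp
  also have "4 * R / r = (R / real (Suc n)) * (8 * (1 + real n)\<^sup>2)"
    using R by (simp add: r_def power2_eq_square)
  finally have "(R / real (Suc n)) ^ Suc n * inv_minima b k x (Suc n)
      \<le> (R / real (Suc n)) ^ Suc n * (8 * (1 + real n)\<^sup>2) ^ Suc n" by (simp only: power_mult_distrib)
  moreover have "(R / real (Suc n)) ^ Suc n > 0" using R by simp
  ultimately have "inv_minima b k x (Suc n) \<le> (8 * (1 + real n)\<^sup>2) ^ Suc n"
    by (simp only: mult_le_cancel_left_pos)
  then show ?thesis by (simp only: n_def)
qed

section \<open>Growth of the products of minima across a gap\<close>

text \<open>\<open>count_const i\<close> comes from the upper count at the parent, one factor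
  \<open>i\<close> from cubes of side \<open>\<rho> / i\<close>, the other from the lower count, and
  \<open>1 + n\<close> from moving between nearby points.\<close>

definition gap_const :: "nat \<Rightarrow> nat \<Rightarrow> real" where
  "gap_const n i = count_const i * (4 * (real i)\<^sup>2 * (1 + real n)) ^ i"

text \<open>If there is a gap after the first \<open>i\<close> minima, the lattice points realizing them span a subspace \<open>V\<close> that
  still carries the first \<open>i\<close> minima at the children. The growth of the covolume of \<open>V\<close> is read off by
  comparing the number of points of \<open>V\<close> in large balls before and after.\<close>

lemma inv_minima_gap:
  fixes x x' :: "real^'n::finite"
  assumes b: "b \<ge> 1" and near: "\<And>i. \<bar>x' $ i - x $ i\<bar> \<le> 1 / b ^ (Suc CARD('n) * k)"
    and i: "1 \<le> i" "i \<le> CARD('n)"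
    and gap: "(1 + real CARD('n))\<^sup>2 * b ^ Suc CARD('n) * minima_at b k x (i - 1) < minima_at b k x i"
    and V: "V = span {z\<in>int_lattice. norm (flow_map b k x z) \<le> minima_at b k x (i - 1)}"
    and z0: "z0 \<in> V" "\<bar>fst (flow_map b k x' z0)\<bar> > \<sigma> * norm (flow_map b k x' z0)" and \<sigma>: "\<sigma> > 0"
  shows "inv_minima b (Suc k) x' i \<le> gap_const CARD('n) i * b ^ i / (b ^ Suc CARD('n) * \<sigma>) * inv_minima b k x i"
proof -
  define n where "n = CARD('n)"
  define C0 where "C0 = 1 + real n"
  have b0: "b > 0" and C0: "C0 \<ge> 1" using b by (auto simp: C0_def)
  define T where "T = flow_map b k x"
  define T1 where "T1 = flow_map b k x'"
  define T' where "T' = flow_map b (Suc k) x'"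
  define \<rho> where "\<rho> = minima_at b k x (i - 1)"
  have \<rho>: "\<rho> > 0" unfolding \<rho>_def by (rule minima_at_pos[OF b0]) (use i in simp)
  have sV: "subspace V" unfolding V by simp
  have dimV: "dim V = i" and Vlt: "{z\<in>int_lattice. norm (T z) < minima_at b k x i} \<subseteq> V"
  proof -
    let ?A = "{z\<in>int_lattice. norm (T z) \<le> \<rho>}" and ?B = "{z\<in>int_lattice. norm (T z) < minima_at b k x i}"
    have "1 * \<rho> \<le> (1 + real CARD('n))\<^sup>2 * b ^ Suc CARD('n) * \<rho>"
    proof (intro mult_right_mono)
      have "1 * 1 \<le> (1 + real CARD('n))\<^sup>2 * b ^ Suc CARD('n)"
        by (intro mult_mono one_le_power) (use b in auto)
      then show "1 \<le> (1 + real CARD('n))\<^sup>2 * b ^ Suc CARD('n)" by simp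
    qed (use \<rho> in simp)
    then have AB: "?A \<subseteq> ?B" using gap by (auto simp: \<rho>_def)
    have "i - 1 < dim ?A" unfolding T_def \<rho>_def by (rule dim_minima_at(1)[OF b0]) (use i in simp)
    moreover have B: "dim ?B \<le> i" unfolding T_def by (rule dim_minima_at(2)[OF b0])
    moreover have "dim ?A \<le> dim ?B" by (rule dim_subset[OF AB])
    ultimately have dA: "dim ?A = i" by linarith
    have VA: "V = span ?A" unfolding V T_def \<rho>_def ..
    then show "dim V = i" using dA by simp
    have "span ?A = span ?B" by (rule dim_eq_span[OF AB]) (use B dA in linarith)
    then show "?B \<subseteq> V" unfolding VA using span_superset[of ?B] by simp
  qed
  have T_T1: "norm (T z) \<le> C0 * norm (T1 z)" for z
    unfolding T_def T1_def C0_def n_def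
    by (rule norm_flow_map_perturb[OF b0]) (use near in \<open>simp add: abs_minus_commute\<close>)
  have T1_T': "norm (T1 z) \<le> b * norm (T' z)" for z
    unfolding T1_def T'_def by (rule norm_flow_map_Suc[OF b])
  \<comment> \<open>Here the size of the gap is used: minima grow by at most
    \<open>C0 * b ^ n\<close> towards the child, and returning to the parent costs at most
    \<open>C0 * b\<close>. The result is still below the next minimum of the parent, so the vector
    lies in \<open>V\<close>.\<close>
  have T'V: "{z\<in>int_lattice. norm (T' z) \<le> minima_at b (Suc k) x' j} \<subseteq> V" if j: "j < i" for j
  proof safe
    fix p q assume z: "(p,q) \<in> int_lattice" "norm (T' (p,q)) \<le> minima_at b (Suc k) x' j"
    have "norm (T (p,q)) \<le> C0 * (b * norm (T' (p,q)))"
      using T_T1[of "(p,q)"] T1_T'[of "(p,q)"] C0 by (meson mult_left_mono order_trans zero_le_one)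
    also have "\<dots> \<le> C0 * (b * (C0 * b ^ n * \<rho>))"
    proof (intro mult_left_mono)
      have "minima_at b (Suc k) x' j \<le> minima_at b (Suc k) x' (i - 1)"
        by (rule dim_minima_at(3)[OF b0]) (use i j in auto)
      also have "\<dots> \<le> C0 * b ^ n * \<rho>" unfolding C0_def n_def \<rho>_def
        by (rule minima_at_child_le[OF b near]) (use i in auto)
      finally show "norm (T' (p,q)) \<le> C0 * b ^ n * \<rho>" using z by linarith
    qed (use b0 C0 in auto)
    also have "\<dots> = (1 + real CARD('n))\<^sup>2 * b ^ Suc CARD('n) * \<rho>"
      by (simp add: C0_def n_def power2_eq_square)
    also have "\<dots> < minima_at b k x i" using gap by (simp add: \<rho>_def)
    finally show "(p,q) \<in> V" using Vlt z by blast
  qed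
  \<comment> \<open>Any radius will do that makes both half-sides \<open>b * R\<close> and
    \<open>R / (b ^ n * \<sigma>)\<close> of the box below at least \<open>\<rho>\<close>.\<close>
  define R where "R = \<rho> * (1 + b ^ n * \<sigma>)"
  have R: "R > 0" "R \<ge> \<rho>" "R / (b ^ n * \<sigma>) \<ge> \<rho>"
    using \<rho> \<sigma> b0 by (auto simp: R_def field_simps intro!: mult_pos_pos add_pos_pos)
  define S where "S = {z\<in>int_lattice \<inter> V. norm (T' z) \<le> R}"
  have finS: "finite S" unfolding S_def T'_def
    by (rule finite_subset[OF _ finite_flow_map[OF b0, of "Suc k" x' R]]) auto
  have lower: "(R / real i) ^ i * inv_minima b (Suc k) x' i \<le> real (card S)"
    unfolding S_def T'_def
    by (rule count_lower_minima[OF b0 _ sV]) (use i R T'V in \<open>auto simp: T'_def\<close>)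
  \<comment> \<open>Bounds the points in one cube: two of them differ by at most
    \<open>\<rho>\<close> at \<open>x'\<close>, hence by at most \<open>C0 * \<rho>\<close> at
    \<open>x\<close>.\<close>
  define m where "m = count_const i * (C0 * \<rho>) ^ i * inv_minima b k x i"
  have m0: "m \<ge> 0" using count_const_pos[of i] C0 \<rho> inv_minima_pos[OF b0, of i k x] i
    by (auto simp: m_def intro!: mult_nonneg_nonneg)
  have ball: "real (card {z\<in>int_lattice \<inter> V. norm (T z) \<le> C0 * \<rho>}) \<le> m"
  proof -
    have "real (card {z\<in>int_lattice \<inter> V. norm (T z) \<le> C0 * \<rho>})
      \<le> count_const i * (C0 * \<rho>) ^ i / (\<Prod>j<i. minima_at b k x j)"
    proof (rule lattice_count_upper)
      show "linear T" "inj T" unfolding T_def by (rule linear_flow_map) (rule inj_flow_map[OF b0])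
      show "z - w \<in> int_lattice \<inter> V" if "z \<in> int_lattice \<inter> V" "w \<in> int_lattice \<inter> V" for z w
        using that sV by (auto intro: int_lattice_diff subspace_diff)
      show "finite {z \<in> int_lattice \<inter> V. norm (T z) \<le> r}" for r unfolding T_def
        by (rule finite_subset[OF _ finite_flow_map[OF b0, of k x r]]) auto
      show "dim (int_lattice \<inter> V) \<le> i" using dim_subset[of "int_lattice \<inter> V" V] dimV by simp
      show "0 < minima_at b k x j" if "j < i" for j by (rule minima_at_pos[OF b0]) (use that i in simp)
      show "dim {z \<in> int_lattice \<inter> V. norm (T z) < minima_at b k x j} \<le> j" if "j < i" for j
        using dim_minima_at(2)[OF b0, of k x j] unfolding T_def
        by (rule order_trans[rotated]) (auto intro!: dim_subset)
      show "minima_at b k x i' \<le> minima_at b k x j" if "i' \<le> j" "j < i" for i' j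
        by (rule dim_minima_at(3)[OF b0]) (use that i in auto)
      show "0 < C0 * \<rho>" using C0 \<rho> by simp
      show "minima_at b k x j \<le> C0 * \<rho>" if "j < i" for j
      proof -
        have "minima_at b k x j \<le> \<rho>" unfolding \<rho>_def
          by (rule dim_minima_at(3)[OF b0]) (use that i in auto)
        also have "\<dots> \<le> C0 * \<rho>" using C0 \<rho> by simp
        finally show ?thesis .
      qed
    qed
    also have "\<dots> = m" by (simp add: m_def inv_minima_def prod_dividef)
    finally show ?thesis .
  qed
  define W where "W = T1 ` V"
  have linT1: "linear T1" and injT1: "inj T1" unfolding T1_def by (rule linear_flow_map) (rule inj_flow_map[OF b0])
  have sW: "subspace W" unfolding W_def by (rule linear_subspace_image[OF linT1 sV])
  have dW: "dim W = i" unfolding W_def using dimV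
    by (subst dim_image_eq[OF linT1]) (auto intro: inj_on_subset[OF injT1])
  obtain a B where B: "a \<notin> B" "pairwise orthogonal (insert a B)" "\<And>e. e \<in> insert a B \<Longrightarrow> norm e = 1"
    "span (insert a B) = W" "finite B" "card (insert a B) = dim W" "a \<bullet> (1,0) > \<sigma>" "\<And>e. e \<in> B \<Longrightarrow> e \<bullet> (1,0) = 0"
  proof (rule adapted_orthonormal_basis[OF sW, of "T1 z0" \<sigma> "(1,0)"])
    show "T1 z0 \<in> W" using z0(1) by (simp add: W_def)
    show "\<sigma> * norm (T1 z0) < \<bar>T1 z0 \<bullet> (1, 0)\<bar>" using z0(2) by (simp add: T1_def inner_prod_def)
  qed (use \<sigma> in auto)
  have cB: "card B = i - 1" using B(1,5,6) dW by simp
  have fa: "fst a > \<sigma>" and fB: "\<And>e. e \<in> B \<Longrightarrow> fst e = 0"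
    using B(7,8) by (auto simp: inner_prod_def)
  define r where "r = \<rho> / real i"
  have r: "r > 0" "r \<le> \<rho>" using \<rho> i by (auto simp: r_def field_simps)
  \<comment> \<open>For points of the ball at the child, the expanding coordinate before the step is
    at most \<open>R / b ^ n\<close>. On \<open>W\<close> it equals the coordinate along
    \<open>a\<close> times \<open>fst a > \<sigma>\<close>. The other coordinates shrink by at most
    \<open>b\<close> in the step. The half-sides multiply to
    \<open>(b * R) ^ i / (b ^ (n + 1) * \<sigma>)\<close>, whence the factor in the claim.\<close>
  define h where "h e = (if e = a then R / (b ^ n * \<sigma>) else b * R)" for e
  have T'T1: "T' z = (b ^ n * fst (T1 z), (1 / b) *\<^sub>R snd (T1 z))" for z
    unfolding T'_def T1_def n_def by (rule flow_map_Suc)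
  have upper: "real (card S) \<le> m * (\<Prod>e\<in>insert a B. 4 * h e / r)"
  proof (rule box_count[where \<phi>=T1, OF finS _ B(2,3)])
    show "finite (insert a B)" using B(5) by simp
    show "T1 z \<in> span (insert a B)" if "z \<in> S" for z
      using that unfolding B(4) by (auto simp: S_def W_def)
    show "\<bar>T1 z \<bullet> e\<bar> \<le> h e" if z: "z \<in> S" and e: "e \<in> insert a B" for z e
    proof (cases "e = a")
      case False
      then have "e \<in> B" using e by simp
      then have "\<bar>T1 z \<bullet> e\<bar> \<le> norm (T1 z) * norm e" by (intro Cauchy_Schwarz_ineq2)
      also have "norm e = 1" using B(3) e by simp
      finally have "\<bar>T1 z \<bullet> e\<bar> \<le> b * norm (T' z)" using T1_T'[of z] by simp
      also have "\<dots> \<le> b * R" using z b0 by (simp add: S_def)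
      finally show ?thesis using False by (simp add: h_def)
    next
      case True
      have "T1 z \<in> W" using z by (simp add: S_def W_def)
      then have "T1 z = (\<Sum>e\<in>insert a B. (T1 z \<bullet> e) *\<^sub>R e)"
        using orthonormal_basis_expand[OF B(2,3), of "T1 z"] B(4,5) by simp
      then have "fst (T1 z) = fst (\<Sum>e\<in>insert a B. (T1 z \<bullet> e) *\<^sub>R e)" by (rule arg_cong)
      also have "\<dots> = (\<Sum>e\<in>insert a B. (T1 z \<bullet> e) * fst e)" by (simp add: fst_sum)
      also have "\<dots> = (T1 z \<bullet> a) * fst a" using B(1,5) fB by simp
      finally have eq: "fst (T1 z) = (T1 z \<bullet> a) * fst a" .
      have "b ^ n * \<bar>fst (T1 z)\<bar> = norm (fst (T' z))" using b0 by (simp add: T'T1 abs_mult)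
      also have "\<dots> \<le> norm (T' z)" by (rule norm_fst_le')
      also have "\<dots> \<le> R" using z by (simp add: S_def)
      finally have "b ^ n * (\<bar>T1 z \<bullet> a\<bar> * fst a) \<le> R" using fa \<sigma> by (simp add: eq abs_mult)
      moreover have "b ^ n * (\<bar>T1 z \<bullet> a\<bar> * \<sigma>) \<le> b ^ n * (\<bar>T1 z \<bullet> a\<bar> * fst a)"
        using fa b0 by (intro mult_left_mono) auto
      ultimately have "b ^ n * (\<bar>T1 z \<bullet> a\<bar> * \<sigma>) \<le> R" by linarith
      then show ?thesis using True b0 \<sigma> by (simp add: h_def pos_le_divide_eq mult_ac)
    qed
    show "r \<le> h e" if "e \<in> insert a B" for e
    proof -
      have "1 * R \<le> b * R" using R(1) b by (intro mult_right_mono) auto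
      then have "r \<le> b * R" using r R by linarith
      then show ?thesis using r R by (simp add: h_def)
    qed
    show "m \<ge> 0" by (rule m0)
    show "r > 0" by (rule r)
    fix z assume z: "z \<in> S"
    have ci: "real (card (insert a B)) * r = \<rho>" using B(6) dW i by (simp add: r_def)
    have "(\<lambda>w. w - z) ` {w\<in>S. norm (T1 w - T1 z) \<le> real (card (insert a B)) * r}
       \<subseteq> {z\<in>int_lattice \<inter> V. norm (T z) \<le> C0 * \<rho>}"
    proof (rule image_subsetI)
      fix w assume "w \<in> {w\<in>S. norm (T1 w - T1 z) \<le> real (card (insert a B)) * r}"
      then have w: "w \<in> S" "norm (T1 w - T1 z) \<le> real (card (insert a B)) * r" by auto
      have "norm (T (w - z)) \<le> C0 * norm (T1 (w - z))" by (rule T_T1)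
      also have "\<dots> \<le> C0 * \<rho>" using w(2) C0 ci linear_diff[OF linT1, of "w" z]
        by (intro mult_left_mono) auto
      finally have "norm (T (w - z)) \<le> C0 * \<rho>" .
      moreover have "w - z \<in> int_lattice" using w(1) z by (intro int_lattice_diff) (auto simp: S_def)
      moreover have "w - z \<in> V" using w(1) z by (intro subspace_diff[OF sV]) (auto simp: S_def)
      ultimately show "w - z \<in> {z\<in>int_lattice \<inter> V. norm (T z) \<le> C0 * \<rho>}" by blast
    qed
    then have "card ((\<lambda>w. w - z) ` {w\<in>S. norm (T1 w - T1 z) \<le> real (card (insert a B)) * r})
      \<le> card {z\<in>int_lattice \<inter> V. norm (T z) \<le> C0 * \<rho>}"
      unfolding T_def
      by (intro card_mono finite_subset[OF _ finite_flow_map[OF b0, of k x "C0 * \<rho>"]]) auto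
    moreover have "card ((\<lambda>w. w - z) ` {w\<in>S. norm (T1 w - T1 z) \<le> real (card (insert a B)) * r})
      = card {w\<in>S. norm (T1 w - T1 z) \<le> real (card (insert a B)) * r}"
      by (rule card_image) (auto simp: inj_on_def)
    ultimately show "real (card {w\<in>S. norm (T1 w - T1 z) \<le> real (card (insert a B)) * r}) \<le> m"
      using ball by linarith
  qed
  have "(\<Prod>e\<in>insert a B. 4 * h e / r) = (4 * (R / (b ^ n * \<sigma>)) / r) * (\<Prod>e\<in>B. 4 * h e / r)"
    using B(1,5) by (simp add: h_def)
  also have "(\<Prod>e\<in>B. 4 * h e / r) = (\<Prod>e\<in>B. 4 * (b * R) / r)"
    using B(1) by (intro prod.cong) (auto simp: h_def)
  also have "\<dots> = (4 * (b * R) / r) ^ (i - 1)" by (simp add: cB)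
  also have "(4 * (R / (b ^ n * \<sigma>)) / r) = (4 * (b * R) / r) / (b ^ Suc n * \<sigma>)"
    using b0 \<sigma> r by (simp add: field_simps)
  also have "(4 * (b * R) / r) / (b ^ Suc n * \<sigma>) * (4 * (b * R) / r) ^ (i - 1)
      = (4 * (b * R) / r) ^ i / (b ^ Suc n * \<sigma>)"
    using i by (cases i) auto
  also have "4 * (b * R) / r = (R / real i) * (4 * (real i)\<^sup>2 * b / \<rho>)"
    using i \<rho> by (simp add: r_def power2_eq_square)
  finally have P: "(\<Prod>e\<in>insert a B. 4 * h e / r) = (R / real i) ^ i * (4 * (real i)\<^sup>2 * b / \<rho>) ^ i / (b ^ Suc n * \<sigma>)"
    by (simp only: power_mult_distrib)
  have "(R / real i) ^ i * inv_minima b (Suc k) x' i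
     \<le> (R / real i) ^ i * (m * ((4 * (real i)\<^sup>2 * b / \<rho>) ^ i / (b ^ Suc n * \<sigma>)))"
    using lower upper unfolding P by (simp add: mult_ac)
  moreover have "(R / real i) ^ i > 0" using R i by simp
  ultimately have "inv_minima b (Suc k) x' i \<le> m * ((4 * (real i)\<^sup>2 * b / \<rho>) ^ i / (b ^ Suc n * \<sigma>))"
    by (simp only: mult_le_cancel_left_pos)
  also have "\<dots> = gap_const n i * b ^ i / (b ^ Suc n * \<sigma>) * inv_minima b k x i"
    using \<rho> by (simp add: m_def gap_const_def C0_def power_mult_distrib power_divide mult_ac)
  finally show ?thesis unfolding n_def .
qed

section \<open>Subdividing a cell\<close>

definition cells :: "nat \<Rightarrow> (int^'n::finite) set" where
  "cells N = {c. \<forall>i. 0 \<le> c $ i \<and> c $ i < int N}"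

definition rvec :: "int^'n::finite \<Rightarrow> real^'n" where
  "rvec c = (\<chi> i. real_of_int (c $ i))"

definition child :: "nat \<Rightarrow> nat \<Rightarrow> real^'n::finite \<Rightarrow> int^'n \<Rightarrow> real^'n" where
  "child N k x c = x + (1 / real N ^ Suc k) *\<^sub>R rvec c"

lemma cells_eq: "(cells N :: (int^'n::finite) set) = vec_lambda ` (\<Pi>\<^sub>E i\<in>UNIV. {0..<int N})"
proof (intro equalityI subsetI)
  fix c :: "int^'n" assume "c \<in> cells N"
  then have "vec_nth c \<in> (\<Pi>\<^sub>E i\<in>UNIV. {0..<int N})" by (auto simp: cells_def)
  then show "c \<in> vec_lambda ` (\<Pi>\<^sub>E i\<in>UNIV. {0..<int N})" by (intro image_eqI[of _ _ "vec_nth c"]) auto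
qed (auto simp: cells_def)

lemma finite_cells: "finite (cells N :: (int^'n::finite) set)"
  unfolding cells_eq by (intro finite_imageI finite_PiE) auto

lemma card_cells: "card (cells N :: (int^'n::finite) set) = N ^ CARD('n)"
proof -
  have "inj (vec_lambda :: ('n \<Rightarrow> int) \<Rightarrow> int^'n)" by (simp add: inj_def vec_lambda_inject)
  then show ?thesis unfolding cells_eq by (subst card_image) (auto simp: card_PiE intro: inj_on_subset)
qed

lemma norm_rvec_ge_1:
  assumes "c \<noteq> d" shows "norm (rvec c - rvec d) \<ge> 1"
proof -
  obtain i where "c $ i \<noteq> d $ i" using assms by (auto simp: vec_eq_iff)
  then have "1 \<le> \<bar>real_of_int (c $ i - d $ i)\<bar>" by linarith
  also have "\<dots> = \<bar>(rvec c - rvec d) $ i\<bar>" by (simp add: rvec_def)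
  also have "\<dots> \<le> norm (rvec c - rvec d)" by (rule component_le_norm_cart)
  finally show ?thesis .
qed

lemma norm_rvec_cells:
  fixes c d :: "int^'n::finite"
  assumes "c \<in> cells N" "d \<in> cells N" shows "norm (rvec c - rvec d) \<le> real CARD('n) * real N"
proof -
  have "norm (rvec c - rvec d) \<le> (\<Sum>i\<in>UNIV. \<bar>(rvec c - rvec d) $ i\<bar>)" by (rule norm_le_l1_cart)
  also have "\<dots> \<le> (\<Sum>i\<in>(UNIV::'n set). real N)"
  proof (rule sum_mono)
    fix i :: 'n
    have "0 \<le> c $ i" "c $ i < int N" "0 \<le> d $ i" "d $ i < int N" using assms by (auto simp: cells_def)
    then have "\<bar>c $ i - d $ i\<bar> \<le> int N" by linarith
    then have "\<bar>real_of_int (c $ i - d $ i)\<bar> \<le> real N" by linarith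
    then show "\<bar>(rvec c - rvec d) $ i\<bar> \<le> real N" by (simp add: rvec_def)
  qed
  finally show ?thesis by simp
qed

lemma child_near:
  fixes x :: "real^'n::finite"
  assumes N: "real N = b ^ Suc CARD('n)" "N > 0" and c: "c \<in> cells N"
  shows "\<bar>child N k x c $ i - x $ i\<bar> \<le> 1 / b ^ (Suc CARD('n) * k)"
proof -
  have "0 \<le> c $ i" "c $ i < int N" using c by (auto simp: cells_def)
  then have "\<bar>real_of_int (c $ i)\<bar> \<le> real N" by linarith
  then have "1 / real N ^ Suc k * \<bar>real_of_int (c $ i)\<bar> \<le> 1 / real N ^ Suc k * real N"
    by (intro mult_left_mono) auto
  also have "1 / real N ^ Suc k * \<bar>real_of_int (c $ i)\<bar> = \<bar>child N k x c $ i - x $ i\<bar>"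
    by (simp add: child_def rvec_def abs_mult del: power_Suc)
  finally have "\<bar>child N k x c $ i - x $ i\<bar> \<le> 1 / real N ^ Suc k * real N" .
  also have "\<dots> = 1 / real N ^ k" using N(2) by simp
  also have "real N ^ k = b ^ (Suc CARD('n) * k)" unfolding N(1) by (rule power_mult[symmetric])
  finally show ?thesis .
qed

section \<open>Averages over the children of a cell\<close>

text \<open>If all of \<open>V\<close> stays within \<open>\<sigma>\<close> of the contracted
  hyperplane, each unit vector in the projection of \<open>V\<close> confines the index
  \<open>c\<close> to a slab of width about \<open>\<sigma> * N\<close>, and there are
  \<open>i\<close> orthogonal ones. The condition \<open>1 / N \<le> \<sigma>\<close> keeps the
  slabs at least as wide as the spacing of the indices.\<close>

lemma slab_count:
  fixes x :: "real^'n::finite" and V :: "(real \<times> (real^'n)) set"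
  assumes b: "b > 0" and N: "real N = b ^ Suc CARD('n)" "N > 0" and V: "subspace V" "dim V = i"
    and i: "i \<le> CARD('n)" and \<sigma>: "1 / real N \<le> \<sigma>"
  shows "real (card {c\<in>cells N. \<forall>z\<in>V. \<bar>fst (flow_map b k (child N k x c) z)\<bar>
              \<le> \<sigma> * norm (flow_map b k (child N k x c) z)})
         \<le> (32 * (real CARD('n))\<^sup>2) ^ CARD('n) * \<sigma> ^ i * real N ^ CARD('n)" (is "real (card ?S) \<le> ?M")
proof -
  define n where "n = CARD('n)"
  have n1: "real n \<ge> 1" by (simp add: n_def Suc_leI)
  have nn: "real n \<le> (real n)\<^sup>2" using n1 by (simp add: power2_eq_square)
  have N0: "real N > 0" using N by simp
  have \<sigma>0: "\<sigma> > 0" using \<sigma> N0 by (meson divide_pos_pos less_le_trans zero_less_one)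
  have finS: "finite ?S" by (rule finite_subset[OF _ finite_cells[of N]]) auto
  show ?thesis
  \<comment> \<open>For \<open>\<sigma> > 1 / 2\<close> the claimed bound exceeds the number of all
    cells; otherwise terms carrying a factor \<open>\<sigma>\<close> can be absorbed on the
    left.\<close>
  proof (cases "\<sigma> \<le> 1 / 2")
    case False
    have "card ?S \<le> card (cells N :: (int^'n) set)" by (intro card_mono finite_cells) auto
    then have "real (card ?S) \<le> 1 * real N ^ n" using card_cells[where 'n='n, of N]
      by (simp add: n_def flip: of_nat_power)
    also have "1 \<le> (32 * (real n)\<^sup>2) ^ n * \<sigma> ^ i"
    proof -
      have "1 \<le> (2 * \<sigma>) ^ i" using False by (intro one_le_power) auto
      also have "\<dots> = 2 ^ i * \<sigma> ^ i" by (rule power_mult_distrib)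
      also have "2 ^ i \<le> (2::real) ^ n" using i by (simp add: n_def)
      also have "\<dots> \<le> (32 * (real n)\<^sup>2) ^ n"
      proof (rule power_mono)
        have "2 * 1 \<le> 32 * (real n)\<^sup>2"
          by (rule mult_mono[OF _ order_trans[OF n1 nn]]) auto
        then show "2 \<le> 32 * (real n)\<^sup>2" by (simp only: mult_1_right)
      qed simp
      finally show ?thesis using \<sigma>0 by simp
    qed
    finally show ?thesis using N0 by (simp add: n_def mult_ac)
  next
    case True
    show ?thesis
    proof (cases "?S = {}")
      case True
      then show ?thesis using \<sigma>0 by (simp only:) simp
    next
      case False
      then obtain c0 where c0: "c0 \<in> ?S" by blast
      define P where "P = snd ` V"
      have sP: "subspace P" unfolding P_def
        by (rule linear_subspace_image[OF _ V(1)]) (simp add: bounded_linear.linear bounded_linear_snd)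
      \<comment> \<open>A nonzero vector of \<open>V\<close> with \<open>snd z = 0\<close> would be
        purely expanding, against the smallness at \<open>c0\<close>.\<close>
      have inj: "inj_on snd V"
      proof -
        have "z = 0" if z: "z \<in> V" "snd z = 0" for z
        proof -
          define u where "u = b ^ (n * k) * fst z"
          have "flow_map b k (child N k x c0) z = (u, 0)"
            using z by (simp add: flow_map_def u_def n_def)
          then have "\<bar>u\<bar> \<le> \<sigma> * \<bar>u\<bar>" using c0 z(1) by (auto dest!: bspec[of _ _ z])
          also have "\<dots> \<le> 1 / 2 * \<bar>u\<bar>" using True by (intro mult_right_mono) auto
          finally have "u = 0" by simp
          then show "z = 0" using b z(2) by (simp add: u_def prod_eq_iff)
        qed
        then have "x = y" if "x \<in> V" "y \<in> V" "snd x = snd y" for x y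
          using subspace_diff[OF V(1) that(1,2)] that(3) by (metis eq_iff_diff_eq_0 snd_diff)
        then show ?thesis by (auto intro!: inj_onI)
      qed
      have dP: "dim P = i" unfolding P_def using V inj
        by (subst dim_image_eq) (auto simp: bounded_linear.linear bounded_linear_snd span_eq_iff[THEN iffD2])
      obtain B where B: "B \<subseteq> P" "pairwise orthogonal B" "\<And>x. x \<in> B \<Longrightarrow> norm x = 1"
        "independent B" "card B = dim P" "span B = P"
        by (rule orthonormal_basis_subspace[OF sP]) blast
      obtain U where U: "B \<inter> U = {}" "pairwise orthogonal (B \<union> U)" "\<And>x. x \<in> B \<union> U \<Longrightarrow> norm x = 1"
        "span (B \<union> U) = UNIV" "finite (B \<union> U)" "card (B \<union> U) = dim (UNIV :: (real^'n) set)"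
        by (rule orthonormal_extension[OF B(2,3), of UNIV]) auto
      have cBU: "card (B \<union> U) = n" using U(6) by (simp add: n_def)
      have cU: "card U = n - i" using U(1,5) cBU B(5) dP by (simp add: card_Un_disjoint)
      \<comment> \<open>Points of one cube are then at distance at most
        \<open>n * r = 1 / 2\<close>, while distinct indices are at distance at least 1.\<close>
      define r where "r = 1 / (2 * real n)"
      have r: "r > 0" "r \<le> 1" using n1 by (auto simp: r_def)
      define h where "h e = (if e \<in> B then 4 * \<sigma> * real N else real n * real N)" for e
      have "real (card ?S) \<le> 1 * (\<Prod>e\<in>B \<union> U. 4 * h e / r)"
      proof (rule box_count[where \<phi>="\<lambda>c. rvec c - rvec c0", OF finS U(5,2,3)])
        show "rvec c - rvec c0 \<in> span (B \<union> U)" for c using U(4) by simp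
        show "\<bar>(rvec c - rvec c0) \<bullet> e\<bar> \<le> h e" if c: "c \<in> ?S" and e: "e \<in> B \<union> U" for c e
        proof (cases "e \<in> B")
          case False
          have "\<bar>(rvec c - rvec c0) \<bullet> e\<bar> \<le> norm (rvec c - rvec c0) * norm e" by (rule Cauchy_Schwarz_ineq2)
          also have "\<dots> \<le> real n * real N" using U(3)[OF e] norm_rvec_cells[of c N c0] c c0 by (simp add: n_def)
          finally show ?thesis using False by (simp add: h_def)
        next
          case eB: True
          then obtain z where z: "z \<in> V" "snd z = e" using B(1) by (auto simp: P_def)
          have ne: "norm e = 1" using B(3) eB by blast
          define A where "A d = fst (flow_map b k (child N k x d) z)" for d
          \<comment> \<open>The norm on the right contains \<open>A d\<close> itself;
            \<open>\<sigma> \<le> 1 / 2\<close> moves it to the left and doubles the bound.\<close>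
          have A: "\<bar>A d\<bar> \<le> 2 * \<sigma> / b ^ k" if "d \<in> ?S" for d
          proof -
            have "\<bar>A d\<bar> \<le> \<sigma> * norm (flow_map b k (child N k x d) z)" using that z(1) by (auto simp: A_def)
            also have "norm (flow_map b k (child N k x d) z) \<le> \<bar>A d\<bar> + 1 / b ^ k"
            proof -
              have "norm (flow_map b k (child N k x d) z) = norm (A d, (1 / b ^ k) *\<^sub>R e)"
                by (simp add: A_def flow_map_def z(2))
              also have "\<dots> \<le> norm (A d) + norm ((1 / b ^ k) *\<^sub>R e)" by (rule norm_Pair_le)
              finally show ?thesis using b ne by simp
            qed
            finally have "\<bar>A d\<bar> \<le> \<sigma> * \<bar>A d\<bar> + \<sigma> * (1 / b ^ k)" using \<sigma>0 by (simp add: distrib_left)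
            moreover have "\<sigma> * \<bar>A d\<bar> \<le> 1 / 2 * \<bar>A d\<bar>" using True by (intro mult_right_mono) auto
            ultimately show ?thesis by simp
          qed
          \<comment> \<open>The expanding coordinate is affine in the index, so this difference sees
            \<open>c - c0\<close> only through its component along \<open>e\<close>.\<close>
          have "A c - A c0 = b ^ (n * k) * (e \<bullet> (child N k x c - child N k x c0))"
            by (simp add: A_def flow_map_def z(2) n_def inner_diff_right algebra_simps)
          also have "child N k x c - child N k x c0 = (1 / real N ^ Suc k) *\<^sub>R (rvec c - rvec c0)"
            by (simp add: child_def scaleR_diff_right)
          finally have "\<bar>A c - A c0\<bar> = b ^ (n * k) * (\<bar>(rvec c - rvec c0) \<bullet> e\<bar> / real N ^ Suc k)"
            using b N0 by (simp add: abs_mult inner_commute)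
          also have "real N ^ Suc k = real N * (b ^ (n * k) * b ^ k)"
          proof -
            have "real N ^ k = b ^ (Suc n * k)" unfolding N(1) n_def by (rule power_mult[symmetric])
            then show ?thesis by (simp add: power_add mult.commute)
          qed
          finally have "\<bar>A c - A c0\<bar> = \<bar>(rvec c - rvec c0) \<bullet> e\<bar> / (real N * b ^ k)" using b by simp
          moreover have "\<bar>A c - A c0\<bar> \<le> 4 * \<sigma> / b ^ k" using A[OF c] A[OF c0] by linarith
          ultimately have "\<bar>(rvec c - rvec c0) \<bullet> e\<bar> / (real N * b ^ k) \<le> 4 * \<sigma> / b ^ k" by simp
          then show ?thesis using b N0 eB by (simp add: h_def field_simps)
        qed
        show "r \<le> h e" if "e \<in> B \<union> U" for e
        proof -
          have "1 \<le> \<sigma> * real N" using \<sigma> N0 by (simp add: field_simps)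
          moreover have "1 \<le> real n * real N"
            using n1 N(2) by (metis Suc_leI mult_mono' mult_1 of_nat_1 of_nat_le_iff One_nat_def zero_le_one)
          ultimately show ?thesis using r(2) unfolding h_def by (auto simp: mult.assoc)
        qed
        fix z assume "z \<in> ?S"
        have "{w \<in> ?S. norm (rvec w - rvec c0 - (rvec z - rvec c0)) \<le> real (card (B \<union> U)) * r} \<subseteq> {z}"
        proof (rule subsetI, rule ccontr)
          fix w assume w: "w \<in> {w \<in> ?S. norm (rvec w - rvec c0 - (rvec z - rvec c0)) \<le> real (card (B \<union> U)) * r}"
            "w \<notin> {z}"
          then have "norm (rvec w - rvec z) \<le> real n * r" by (simp add: cBU)
          moreover have "real n * r < 1" using n1 by (simp add: r_def)
          ultimately show False using norm_rvec_ge_1[of w z] w(2) by simp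
        qed
        then have "card {w \<in> ?S. norm (rvec w - rvec c0 - (rvec z - rvec c0)) \<le> real (card (B \<union> U)) * r} \<le> card {z}"
          by (intro card_mono) auto
        then show "real (card {w \<in> ?S. norm (rvec w - rvec c0 - (rvec z - rvec c0)) \<le> real (card (B \<union> U)) * r}) \<le> 1"
          by simp
      qed (use r in auto)
      also have "1 * (\<Prod>e\<in>B \<union> U. 4 * h e / r) = (\<Prod>e\<in>B. 4 * h e / r) * (\<Prod>e\<in>U. 4 * h e / r)"
        using U(1,5) by (simp add: prod.union_disjoint)
      also have "(\<Prod>e\<in>B. 4 * h e / r) = (\<Prod>e\<in>B. 32 * real n * \<sigma> * real N)"
        using n1 by (intro prod.cong) (auto simp: h_def r_def)
      also have "(\<Prod>e\<in>U. 4 * h e / r) = (\<Prod>e\<in>U. 8 * (real n)\<^sup>2 * real N)"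
        using n1 U(1) by (intro prod.cong) (auto simp: h_def r_def power2_eq_square)
      also have "(\<Prod>e\<in>B. 32 * real n * \<sigma> * real N) * (\<Prod>e\<in>U. 8 * (real n)\<^sup>2 * real N)
          = (32 * real n * \<sigma> * real N) ^ i * (8 * (real n)\<^sup>2 * real N) ^ (n - i)"
        by (simp only: prod_constant B(5) dP cU)
      \<comment> \<open>Both bases are enlarged to a common constant, so that the exponents
        \<open>i\<close> and \<open>n - i\<close> add up to \<open>n\<close>.\<close>
      also have "\<dots> \<le> (32 * (real n)\<^sup>2 * \<sigma> * real N) ^ i * (32 * (real n)\<^sup>2 * real N) ^ (n - i)"
        using nn n1 \<sigma>0 N0 by (intro mult_mono power_mono mult_right_mono) auto
      also have "\<dots> = (32 * (real n)\<^sup>2) ^ (i + (n - i)) * \<sigma> ^ i * real N ^ (i + (n - i))"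
        unfolding power_add power_mult_distrib by (simp add: mult_ac)
      also have "i + (n - i) = n" using i by (simp add: n_def)
      finally show ?thesis by (simp add: n_def)
    qed
  qed
qed

text \<open>Level \<open>l\<close> has at most \<open>M * 2^(-l i)\<close> elements with values up
  to \<open>A * 2^l\<close>, so \<open>\<beta> \<le> i\<close> bounds its contribution by
  \<open>M * A powr \<beta>\<close> whatever \<open>l\<close> is. The number \<open>L + 1\<close> of
  levels will become the factor linear in \<open>t\<close>.\<close>

lemma dyadic_sum:
  fixes f :: "'b \<Rightarrow> real" and lev :: "'b \<Rightarrow> nat"
  assumes fin: "finite S" and f: "\<And>c. c \<in> S \<Longrightarrow> 0 \<le> f c \<and> f c \<le> A * 2 ^ lev c" and A: "A \<ge> 0"
    and lev: "\<And>c. c \<in> S \<Longrightarrow> lev c \<le> L"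
    and card: "\<And>l. l \<le> L \<Longrightarrow> real (card {c\<in>S. lev c = l}) \<le> M * (1 / 2 ^ l) ^ i"
    and M: "M \<ge> 0" and \<beta>: "0 \<le> \<beta>" "\<beta> \<le> real i"
  shows "(\<Sum>c\<in>S. f c powr \<beta>) \<le> real (Suc L) * M * A powr \<beta>"
proof -
  have "(\<Sum>c\<in>S. f c powr \<beta>) = (\<Sum>l\<le>L. \<Sum>c\<in>{c\<in>S. lev c = l}. f c powr \<beta>)"
    using fin lev by (subst sum.group) auto
  also have "\<dots> \<le> (\<Sum>l\<le>L. M * A powr \<beta>)"
  proof (rule sum_mono)
    fix l assume l: "l \<in> {..L}"
    have "(\<Sum>c\<in>{c\<in>S. lev c = l}. f c powr \<beta>) \<le> (\<Sum>c\<in>{c\<in>S. lev c = l}. (A * 2 ^ l) powr \<beta>)"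
      using f \<beta> by (intro sum_mono powr_mono2) auto
    also have "\<dots> = real (card {c\<in>S. lev c = l}) * (A * 2 ^ l) powr \<beta>" by simp
    also have "\<dots> \<le> M * (1 / 2 ^ l) ^ i * (A * 2 ^ l) powr \<beta>"
      using card[of l] l by (intro mult_right_mono) auto
    also have "(A * 2 ^ l) powr \<beta> = A powr \<beta> * (2 ^ l) powr \<beta>" using A by (simp add: powr_mult)
    also have "M * (1 / 2 ^ l) ^ i * (A powr \<beta> * (2 ^ l) powr \<beta>) \<le> M * (1 / 2 ^ l) ^ i * (A powr \<beta> * (2 ^ l) powr (real i))"
      using M \<beta> by (intro mult_left_mono powr_mono) auto
    also have "\<dots> = M * A powr \<beta>" by (simp add: powr_realpow power_divide)
    finally show "(\<Sum>c\<in>{c\<in>S. lev c = l}. f c powr \<beta>) \<le> M * A powr \<beta>" .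
  qed
  also have "\<dots> = real (Suc L) * M * A powr \<beta>" by simp
  finally show ?thesis .
qed

section \<open>The height function\<close>

definition branch_const :: "nat \<Rightarrow> nat \<Rightarrow> real" where
  "branch_const n i = gap_const n i + (1 + real n) ^ i"

lemma branch_const_ge: "gap_const n i \<le> branch_const n i" "(1 + real n) ^ i \<le> branch_const n i" "1 \<le> branch_const n i"
proof -
  have "gap_const n i \<ge> 0" using count_const_pos[of i] by (simp add: gap_const_def)
  moreover have "(1 + real n) ^ i \<ge> 1" by (rule one_le_power) simp
  ultimately show "gap_const n i \<le> branch_const n i" "(1 + real n) ^ i \<le> branch_const n i" "1 \<le> branch_const n i"
    unfolding branch_const_def by linarith+
qed

lemma dim_gap:
  fixes x :: "real^'n::finite"
  assumes b: "b > 0" and i: "1 \<le> i" "i \<le> CARD('n)" and gap: "minima_at b k x (i - 1) < minima_at b k x i"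
  shows "dim {z\<in>int_lattice. norm (flow_map b k x z) \<le> minima_at b k x (i - 1)} = i"
proof -
  have "i - 1 < dim {z\<in>int_lattice. norm (flow_map b k x z) \<le> minima_at b k x (i - 1)}"
    by (rule dim_minima_at(1)[OF b]) (use i in simp)
  moreover have "dim {z\<in>int_lattice. norm (flow_map b k x z) \<le> minima_at b k x (i - 1)}
      \<le> dim {z\<in>int_lattice. norm (flow_map b k x z) < minima_at b k x i}"
    by (rule dim_subset) (use gap in auto)
  moreover have "\<dots> \<le> i" by (rule dim_minima_at(2)[OF b])
  ultimately show ?thesis by linarith
qed

text \<open>The exponent solves \<open>(n + 1 - i) * \<beta> = n\<close>, so every rank gains
  \<open>b^n\<close>. It satisfies \<open>\<beta> \<le> i\<close>, with equality for
  \<open>i = 1\<close> and \<open>i = n\<close>: the average is at the edge of what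
  \<open>dyadic_sum\<close> allows.\<close>

lemma gap_sum:
  fixes x :: "real^'n::finite"
  defines "n \<equiv> CARD('n)"
  assumes b: "b = 2 ^ t" and N: "N = 2 ^ (Suc n * t)" and i: "1 \<le> i" "i \<le> n"
    and gap: "(1 + real n)\<^sup>2 * b ^ Suc n * minima_at b k x (i - 1) < minima_at b k x i"
    and \<beta>: "\<beta> = real n / real (n + 1 - i)"
  shows "(\<Sum>c\<in>cells N. inv_minima b (Suc k) (child N k x c) i powr \<beta>)
     \<le> real (Suc (Suc n * t)) * ((32 * (real n)\<^sup>2) ^ n * (2 * branch_const n i) ^ n)
        * real N ^ n / b ^ n * inv_minima b k x i powr \<beta>"
proof -
  define L where "L = Suc n * t"
  have b1: "b \<ge> 1" and b0: "b > 0" by (auto simp: b)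
  have NL: "real N = 2 ^ L" by (simp add: N L_def)
  have N0: "N > 0" by (simp add: N)
  have Nb: "real N = b ^ Suc n" unfolding NL L_def b by (simp only: power_mult[symmetric] mult.commute)
  define V where "V = span {z\<in>int_lattice. norm (flow_map b k x z) \<le> minima_at b k x (i - 1)}"
  have "1 * minima_at b k x (i - 1) \<le> (1 + real n)\<^sup>2 * b ^ Suc n * minima_at b k x (i - 1)"
  proof (rule mult_right_mono)
    have "1 * 1 \<le> (1 + real n)\<^sup>2 * b ^ Suc n" by (intro mult_mono one_le_power) (use b1 in auto)
    then show "1 \<le> (1 + real n)\<^sup>2 * b ^ Suc n" by simp
    have "minima_at b k x (i - 1) > 0" by (rule minima_at_pos[OF b0]) (use i in \<open>simp add: n_def\<close>)
    then show "0 \<le> minima_at b k x (i - 1)" by simp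
  qed
  then have dimV: "dim V = i" unfolding V_def dim_span
    by (intro dim_gap[OF b0]) (use i gap in \<open>auto simp: n_def\<close>)
  define cond where "cond c l \<longleftrightarrow> (\<forall>z\<in>V. \<bar>fst (flow_map b k (child N k x c) z)\<bar>
      \<le> 1 / 2 ^ l * norm (flow_map b k (child N k x c) z))" for c l
  \<comment> \<open>The dyadic closeness of \<open>V\<close> to the contracted hyperplane, capped at
    \<open>2 ^ L = N\<close> because narrower slabs cannot be counted. If the cap is not reached,
    the failure at the next level provides the vector \<open>z0\<close> for
    \<open>inv_minima_gap\<close>.\<close>
  define lev where "lev c = Max {l. l \<le> L \<and> cond c l}" for c
  have "\<bar>fst y\<bar> \<le> norm y" for y :: "real \<times> (real^'n)" using norm_fst_le'[of y] by simp
  then have c0: "cond c 0" for c by (simp add: cond_def)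
  have lev_in: "lev c \<in> {l. l \<le> L \<and> cond c l}" for c
    unfolding lev_def by (rule Max_in) (use c0 in auto)
  have lev_max: "\<not> cond c (Suc (lev c))" if "lev c < L" for c
  proof
    assume "cond c (Suc (lev c))"
    then have "Suc (lev c) \<le> lev c" unfolding lev_def[of c] using that
      by (intro Max_ge) (auto simp: lev_def)
    then show False by simp
  qed
  define I where "I = inv_minima b k x i"
  have I: "I > 0" unfolding I_def by (rule inv_minima_pos[OF b0]) (use i in \<open>simp add: n_def\<close>)
  define A where "A = 2 * branch_const n i * (b ^ i / b ^ Suc n) * I"
  have A: "A \<ge> 0" using branch_const_ge(3)[of n i] b0 I by (simp add: A_def)
  define M where "M = (32 * (real n)\<^sup>2) ^ n * real N ^ n"
  have "(\<Sum>c\<in>cells N. inv_minima b (Suc k) (child N k x c) i powr \<beta>) \<le> real (Suc L) * M * A powr \<beta>"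
  proof (rule dyadic_sum[where lev=lev and i=i])
    show "finite (cells N :: (int^'n) set)" by (rule finite_cells)
    show "M \<ge> 0" by (simp add: M_def)
    show "0 \<le> \<beta>" by (simp add: \<beta>)
    have "real n \<le> real i * real (n + 1 - i)"
    proof -
      obtain j where j: "i = Suc j" using i(1) by (cases i) auto
      then obtain m where m: "n = Suc j + m" using i(2) le_Suc_ex by blast
      have "n \<le> i * (n + 1 - i)" using j m by simp
      then show ?thesis by (simp flip: of_nat_mult)
    qed
    then show "\<beta> \<le> real i" using i by (simp add: \<beta> pos_divide_le_eq)
    fix c :: "int^'n" assume c: "c \<in> cells N"
    have near: "\<bar>child N k x c $ j - x $ j\<bar> \<le> 1 / b ^ (Suc CARD('n) * k)" for j
      by (rule child_near) (use Nb N0 c in \<open>simp_all add: n_def\<close>)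
    have "0 \<le> inv_minima b (Suc k) (child N k x c) i"
      by (rule less_imp_le[OF inv_minima_pos[OF b0]]) (use i in \<open>simp add: n_def\<close>)
    moreover have "inv_minima b (Suc k) (child N k x c) i \<le> A * 2 ^ lev c"
    proof (cases "lev c < L")
      case True
      then obtain z where z: "z \<in> V" "\<bar>fst (flow_map b k (child N k x c) z)\<bar>
         > 1 / 2 ^ Suc (lev c) * norm (flow_map b k (child N k x c) z)"
        using lev_max unfolding cond_def by force
      have "inv_minima b (Suc k) (child N k x c) i \<le> gap_const n i * b ^ i / (b ^ Suc n * (1 / 2 ^ Suc (lev c))) * I"
        unfolding I_def n_def
        by (rule inv_minima_gap[OF b1 near _ _ _ V_def z]) (use i gap in \<open>auto simp: n_def\<close>)
      also have "\<dots> = gap_const n i * (2 * (b ^ i / b ^ Suc n) * I * 2 ^ lev c)" by simp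
      also have "\<dots> \<le> branch_const n i * (2 * (b ^ i / b ^ Suc n) * I * 2 ^ lev c)"
        using b0 I by (intro mult_right_mono branch_const_ge) auto
      finally show ?thesis by (simp add: A_def mult_ac)
    next
      \<comment> \<open>At the cap \<open>2 ^ L = N = b ^ (n + 1)\<close> cancels the denominator in
        \<open>A\<close>, and the a priori bound suffices.\<close>
      case False
      then have l: "lev c = L" using lev_in[of c] by auto
      have "inv_minima b (Suc k) (child N k x c) i \<le> ((1 + real n) * b) ^ i * I"
        unfolding I_def n_def by (rule inv_minima_child_le[OF b1 near]) (use i in \<open>auto simp: n_def\<close>)
      also have "\<dots> = (1 + real n) ^ i * (b ^ i * I)" by (simp add: power_mult_distrib)
      also have "\<dots> \<le> branch_const n i * (b ^ i * I)"
        using b0 I by (intro mult_right_mono branch_const_ge) auto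
      also have "\<dots> \<le> 2 * branch_const n i * (b ^ i * I)"
        using b0 I branch_const_ge(3)[of n i] by (intro mult_right_mono) auto
      also have "\<dots> = A * 2 ^ lev c" using b0 unfolding l NL[symmetric] Nb A_def by simp
      finally show ?thesis .
    qed
    ultimately show "0 \<le> inv_minima b (Suc k) (child N k x c) i \<and> inv_minima b (Suc k) (child N k x c) i \<le> A * 2 ^ lev c" ..
    show "lev c \<le> L" using lev_in[of c] by simp
  next
    fix l assume l: "l \<le> L"
    have "{c \<in> cells N. lev c = l} \<subseteq> {c \<in> cells N. cond c l}" using lev_in by auto
    then have "card {c \<in> cells N. lev c = l} \<le> card {c \<in> cells N. cond c l}"
      by (intro card_mono finite_subset[OF _ finite_cells[of N]]) auto
    also have "real (card {c \<in> cells N. cond c l}) \<le> (32 * (real CARD('n))\<^sup>2) ^ CARD('n) * (1 / 2 ^ l) ^ i * real N ^ CARD('n)"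
      unfolding cond_def
    proof (rule slab_count[OF b0])
      show "real N = b ^ Suc CARD('n)" using Nb by (simp add: n_def)
      show "subspace V" by (simp add: V_def)
      show "1 / real N \<le> 1 / 2 ^ l" using l unfolding NL by (intro divide_left_mono) auto
    qed (use N0 dimV i in \<open>auto simp: n_def\<close>)
    finally show "real (card {c \<in> cells N. lev c = l}) \<le> M * (1 / 2 ^ l) ^ i"
      by (simp add: M_def n_def mult_ac)
  qed (rule A)
  also have "A powr \<beta> = (2 * branch_const n i) powr \<beta> * (b ^ i / b ^ Suc n) powr \<beta> * I powr \<beta>"
  proof -
    have "(p * q * r) powr \<beta> = p powr \<beta> * q powr \<beta> * r powr \<beta>" if "p \<ge> 0" "q \<ge> 0" "r \<ge> 0" for p q r :: real
      using that by (simp add: powr_mult)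
    then show ?thesis unfolding A_def by this (use branch_const_ge(3)[of n i] b0 I in auto)
  qed
  also have "(b ^ i / b ^ Suc n) powr \<beta> = 1 / b ^ n"
  proof -
    have "b ^ i / b ^ Suc n = 1 / b ^ (Suc n - i)"
      using b0 i by (simp add: power_diff field_simps)
    also have "\<dots> = b powr - real (n + 1 - i)" using b0 by (simp add: powr_minus powr_realpow divide_inverse)
    finally have "(b ^ i / b ^ Suc n) powr \<beta> = b powr (- (real (n + 1 - i) * \<beta>))" by (simp add: powr_powr)
    also have "real (n + 1 - i) * \<beta> = real n" using i by (simp add: \<beta>)
    finally show ?thesis using b0 by (simp add: powr_minus powr_realpow divide_inverse)
  qed
  also have "real (Suc L) * M * ((2 * branch_const n i) powr \<beta> * (1 / b ^ n) * I powr \<beta>)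
     \<le> real (Suc L) * M * ((2 * branch_const n i) powr (real n) * (1 / b ^ n) * I powr \<beta>)"
  proof (intro mult_left_mono mult_right_mono powr_mono)
    show "\<beta> \<le> real n" using i unfolding \<beta> by (simp add: divide_le_eq mult_le_cancel_left1)
    show "1 \<le> 2 * branch_const n i" using branch_const_ge(3)[of n i] by simp
  qed (use b0 in \<open>auto simp: M_def\<close>)
  also have "(2 * branch_const n i) powr (real n) = (2 * branch_const n i) ^ n"
    using branch_const_ge(3)[of n i] by (intro powr_realpow) simp
  finally show ?thesis by (simp add: M_def I_def L_def mult_ac)
qed

text \<open>In the manner of Eskin, Margulis and Mozes: powers of reciprocal covolumes, with weights
  concave in the rank. The exponents let all terms contract at the same rate, and the summand 1
  keeps the height at least 1.\<close>

definition height :: "real \<Rightarrow> real \<Rightarrow> nat \<Rightarrow> real^'n::finite \<Rightarrow> real" where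
  "height w b k x = 1 + (\<Sum>i=1..CARD('n).
     (inv_minima b k x i / w ^ (i * (CARD('n) + 1 - i))) powr (real CARD('n) / real (CARD('n) + 1 - i)))"

definition height_const :: "nat \<Rightarrow> real" where
  "height_const n = (\<Sum>i=1..n. (32 * (real n)\<^sup>2) ^ n * (2 * branch_const n i) ^ n)"

lemma height_ge_1: "height w b k x \<ge> 1"
  unfolding height_def by (simp add: sum_nonneg)

lemma height_ge_term:
  fixes x :: "real^'n::finite"
  assumes "1 \<le> i" "i \<le> CARD('n)"
  shows "(inv_minima b k x i / w ^ (i * (CARD('n) + 1 - i))) powr (real CARD('n) / real (CARD('n) + 1 - i)) \<le> height w b k x"
proof -
  have "(inv_minima b k x i / w ^ (i * (CARD('n) + 1 - i))) powr (real CARD('n) / real (CARD('n) + 1 - i))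
     \<le> (\<Sum>i=1..CARD('n). (inv_minima b k x i / w ^ (i * (CARD('n) + 1 - i))) powr (real CARD('n) / real (CARD('n) + 1 - i)))"
    by (rule member_le_sum) (use assms in auto)
  then show ?thesis by (simp add: height_def)
qed

text \<open>For \<open>1 \<le> j \<le> n\<close> this inverts one term of the height. The ends
  \<open>j = 0\<close> and \<open>j = n + 1\<close>, absent from the height, obey the same formula
  because the empty product is 1 and the full one is bounded. So both neighbours of any rank are
  covered.\<close>

lemma inv_minima_le_height:
  fixes x :: "real^'n::finite"
  defines "n \<equiv> CARD('n)"
  assumes b: "b > 0" and w: "w > 0" and j: "j \<le> Suc n"
  shows "inv_minima b k x j / w ^ (j * (n + 1 - j))
     \<le> (8 * (1 + real n)\<^sup>2) ^ Suc n * height w b k x powr (real (n + 1 - j) / real n)"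
proof -
  define H where "H = height w b k x"
  have H: "H \<ge> 1" unfolding H_def by (rule height_ge_1)
  have D: "(8 * (1 + real n)\<^sup>2) ^ Suc n \<ge> 1"
  proof (rule one_le_power)
    have "1 * 1 \<le> 8 * (1 + real n)\<^sup>2" by (intro mult_mono one_le_power) auto
    then show "1 \<le> 8 * (1 + real n)\<^sup>2" by simp
  qed
  have H1: "1 \<le> H powr (real (n + 1 - j) / real n)" using H by (intro ge_one_powr_ge_zero) auto
  consider "j = 0" | "1 \<le> j" "j \<le> n" | "j = Suc n" using j by linarith
  then show ?thesis
  proof cases
    case 1
    have "1 * 1 \<le> (8 * (1 + real n)\<^sup>2) ^ Suc n * H powr (real (n + 1 - j) / real n)"
      by (rule mult_mono) (use D H1 in auto)
    then show ?thesis using 1 by (simp add: H_def inv_minima_def)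
  next
    case 3
    then show ?thesis using inv_minima_full_le[OF b, of k x] H by (simp add: n_def H_def)
  next
    case 2
    define a where "a = inv_minima b k x j / w ^ (j * (n + 1 - j))"
    have a: "a > 0" unfolding a_def using inv_minima_pos[OF b, of j k x] w j by (simp add: n_def)
    have "a = (a powr (real n / real (n + 1 - j))) powr (real (n + 1 - j) / real n)"
      using a 2 by (simp add: powr_powr)
    also have "\<dots> \<le> H powr (real (n + 1 - j) / real n)"
      unfolding a_def H_def n_def by (intro powr_mono2 height_ge_term) (use 2 in \<open>auto simp: n_def\<close>)
    also have "1 * H powr (real (n + 1 - j) / real n) \<le> (8 * (1 + real n)\<^sup>2) ^ Suc n * H powr (real (n + 1 - j) / real n)"
      using D by (intro mult_right_mono) auto
    finally show ?thesis by (simp add: a_def H_def)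
  qed
qed

text \<open>The factor \<open>1 / w\<close> comes from the fact that \<open>i (n + 1 - i)\<close> has second difference \<open>-2\<close>.\<close>

lemma no_gap_bound:
  fixes x :: "real^'n::finite"
  defines "n \<equiv> CARD('n)"
  assumes b: "b > 0" and w: "w > 0" and i: "1 \<le> i" "i \<le> n" and K: "K \<ge> 1"
    and no_gap: "minima_at b k x i \<le> K * minima_at b k x (i - 1)"
  shows "inv_minima b k x i / w ^ (i * (n + 1 - i))
     \<le> K * (8 * (1 + real n)\<^sup>2) ^ Suc n / w * height w b k x powr (real (n + 1 - i) / real n)"
proof -
  obtain j where ij: "i = Suc j" using i(1) by (cases i) auto
  then obtain m where m: "n = Suc j + m" using i(2) le_Suc_ex by blast
  define D where "D = (8 * (1 + real n)\<^sup>2) ^ Suc n"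
  have D: "D > 0" unfolding D_def by (intro zero_less_power mult_pos_pos) (auto simp: add_pos_nonneg)
  define H where "H = height w b k x"
  have H: "H \<ge> 1" unfolding H_def by (rule height_ge_1)
  define a where "a l = inv_minima b k x l / w ^ (l * (n + 1 - l))" for l
  have a0: "a l > 0" if "l \<le> Suc n" for l
    unfolding a_def using inv_minima_pos[OF b, of l k x] w that by (simp add: n_def)
  have ale: "a l \<le> D * H powr (real (n + 1 - l) / real n)" if "l \<le> Suc n" for l
    unfolding a_def D_def H_def n_def by (rule inv_minima_le_height[OF b w]) (use that in \<open>simp add: n_def\<close>)
  have lam: "minima_at b k x i > 0" "minima_at b k x j > 0"
    by (rule minima_at_pos[OF b]; use i ij in \<open>simp add: n_def\<close>)+
  have I: "inv_minima b k x i = inv_minima b k x j / minima_at b k x j"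
    "inv_minima b k x (Suc i) = inv_minima b k x i / minima_at b k x i"
    by (simp_all add: inv_minima_def ij)
  have Ipos: "inv_minima b k x i > 0" by (rule inv_minima_pos[OF b]) (use i in \<open>simp add: n_def\<close>)
  \<comment> \<open>As the minima increase, the products are log-concave in the rank; the absence of
    a gap reverses that inequality up to the factor \<open>K\<close>.\<close>
  have sq: "(inv_minima b k x i)\<^sup>2 \<le> K * (inv_minima b k x j * inv_minima b k x (Suc i))"
  proof -
    have "inv_minima b k x j * inv_minima b k x (Suc i)
       = (inv_minima b k x i)\<^sup>2 * (minima_at b k x j / minima_at b k x i)"
      using lam by (simp add: I power2_eq_square)
    moreover have "1 \<le> K * (minima_at b k x j / minima_at b k x i)"
      using no_gap lam by (simp add: ij pos_le_divide_eq)
    then have "(inv_minima b k x i)\<^sup>2 * 1 \<le> (inv_minima b k x i)\<^sup>2 * (K * (minima_at b k x j / minima_at b k x i))"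
      by (rule mult_left_mono) simp
    ultimately show ?thesis by (simp add: mult_ac)
  qed
  have e: "2 * (i * (n + 1 - i)) = 2 + j * (n + 1 - j) + Suc i * (n + 1 - Suc i)"
    unfolding m ij by (simp add: algebra_simps)
  have "(a i)\<^sup>2 = (inv_minima b k x i)\<^sup>2 / w ^ (2 * (i * (n + 1 - i)))"
    by (simp add: a_def power_divide power_mult[symmetric] mult.commute)
  also have "\<dots> \<le> K * (inv_minima b k x j * inv_minima b k x (Suc i)) / w ^ (2 * (i * (n + 1 - i)))"
    by (rule divide_right_mono[OF sq]) (use w in simp)
  also have "\<dots> = K / w\<^sup>2 * (a j * a (Suc i))"
    unfolding e a_def power_add by (simp add: mult_ac)
  also have "\<dots> \<le> K / w\<^sup>2 * ((D * H powr (real (n + 1 - j) / real n)) * (D * H powr (real (n + 1 - Suc i) / real n)))"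
    using K w a0[of j] a0[of "Suc i"] i ij D by (intro mult_left_mono mult_mono ale) auto
  also have "(D * H powr (real (n + 1 - j) / real n)) * (D * H powr (real (n + 1 - Suc i) / real n))
      = D\<^sup>2 * (H powr (real (n + 1 - j) / real n) * H powr (real (n + 1 - Suc i) / real n))"
    by (simp add: power2_eq_square)
  \<comment> \<open>The exponents \<open>(n + 1 - j) / n\<close> are affine in \<open>j\<close>, so
    those of the two neighbours average to that of \<open>i\<close>.\<close>
  also have "H powr (real (n + 1 - j) / real n) * H powr (real (n + 1 - Suc i) / real n)
      = H powr (real (n + 1 - i) / real n + real (n + 1 - i) / real n)"
    unfolding powr_add[symmetric] m ij by (simp add: add_divide_distrib[symmetric] add_ac)
  also have "\<dots> = (H powr (real (n + 1 - i) / real n))\<^sup>2" by (simp only: powr_add power2_eq_square)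
  also have "K / w\<^sup>2 * (D\<^sup>2 * (H powr (real (n + 1 - i) / real n))\<^sup>2)
     \<le> K\<^sup>2 / w\<^sup>2 * (D\<^sup>2 * (H powr (real (n + 1 - i) / real n))\<^sup>2)"
    using K by (intro mult_right_mono divide_right_mono) (auto simp: power2_eq_square)
  also have "\<dots> = (K * D / w * H powr (real (n + 1 - i) / real n))\<^sup>2"
    by (simp add: power_mult_distrib power_divide)
  finally have "a i \<le> K * D / w * H powr (real (n + 1 - i) / real n)"
    by (rule power2_le_imp_le) (use K D w in auto)
  then show ?thesis by (simp add: a_def D_def H_def)
qed

text \<open>The pieces of \<open>w\<close> pay for the losses in a term without a gap: the a priori
  growth towards a child, the gap threshold, the constant from the full lattice, and
  \<open>n * b ^ n\<close>, which leaves each of the at most \<open>n\<close> such terms a share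
  \<open>1 / (n * b ^ n)\<close> of the height. Terms with a gap are averaged by
  \<open>gap_sum\<close>.\<close>

lemma height_recursion:
  fixes x :: "real^'n::finite"
  defines "n \<equiv> CARD('n)"
  assumes b: "b = 2 ^ t" and N: "N = 2 ^ (Suc n * t)"
    and w: "w = ((1 + real n) * b) ^ n * ((1 + real n)\<^sup>2 * b ^ Suc n * (8 * (1 + real n)\<^sup>2) ^ Suc n) * (real n * b ^ n)"
  shows "(\<Sum>c\<in>cells N. height w b (Suc k) (child N k x c))
     \<le> real N ^ n * (1 + (height_const n * real (Suc (Suc n * t)) + 1) / b ^ n * height w b k x)"
proof -
  have b1: "b \<ge> 1" and b0: "b > 0" by (auto simp: b)
  have n1: "real n \<ge> 1" by (simp add: n_def Suc_leI)
  have N0: "N > 0" by (simp add: N)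
  have Nb: "real N = b ^ Suc n" unfolding b N by (simp add: power_mult[symmetric] mult.commute power_add[symmetric])
  define L where "L = Suc n * t"
  define H where "H = height w b k x"
  have H: "H \<ge> 1" unfolding H_def by (rule height_ge_1)
  define K where "K = (1 + real n)\<^sup>2 * b ^ Suc n"
  have K1: "K \<ge> 1"
  proof -
    have "1 * 1 \<le> (1 + real n)\<^sup>2 * b ^ Suc n" by (intro mult_mono one_le_power) (use b1 in auto)
    then show ?thesis by (simp add: K_def)
  qed
  define D where "D = (8 * (1 + real n)\<^sup>2) ^ Suc n"
  have D: "D > 0" unfolding D_def by (intro zero_less_power mult_pos_pos) (auto simp: add_pos_nonneg)
  have w_eq: "w = ((1 + real n) * b) ^ n * (K * D) * (real n * b ^ n)" unfolding w K_def D_def ..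
  have nb: "(1 + real n) * b \<ge> 1" using mult_mono[of 1 "1 + real n" 1 b] b1 by simp
  have w0: "w > 0" unfolding w_eq using K1 D b0 n1 nb by (intro mult_pos_pos zero_less_power) auto
  define \<beta> where "\<beta> i = real n / real (n + 1 - i)" for i
  define E where "E i = (32 * (real n)\<^sup>2) ^ n * (2 * branch_const n i) ^ n" for i
  have E0: "E i \<ge> 0" for i using branch_const_ge(3)[of n i] by (simp add: E_def)
  define a where "a i = inv_minima b k x i / w ^ (i * (n + 1 - i))" for i
  define a' where "a' i c = inv_minima b (Suc k) (child N k x c) i / w ^ (i * (n + 1 - i))" for i c
  have a'0: "a' i c > 0" if "i \<le> Suc n" for i c
    unfolding a'_def using inv_minima_pos[OF b0, of i "Suc k" "child N k x c"] w0 that by (simp add: n_def)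
  have contribution: "(\<Sum>c\<in>cells N. a' i c powr \<beta> i) \<le> (E i * real (Suc L) + 1 / real n) * real N ^ n / b ^ n * H"
    if i: "1 \<le> i" "i \<le> n" for i
  proof (cases "minima_at b k x i \<le> K * minima_at b k x (i - 1)")
    case False
    have q: "w ^ (i * (n + 1 - i)) > 0" using w0 by simp
    have "(\<Sum>c\<in>cells N. a' i c powr \<beta> i)
        = (\<Sum>c\<in>cells N. inv_minima b (Suc k) (child N k x c) i powr \<beta> i) / (w ^ (i * (n + 1 - i))) powr \<beta> i"
      unfolding sum_divide_distrib a'_def by (intro sum.cong refl powr_divide)
    also have "\<dots> \<le> (real (Suc L) * E i * real N ^ n / b ^ n * inv_minima b k x i powr \<beta> i)
         / (w ^ (i * (n + 1 - i))) powr \<beta> i"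
      unfolding L_def E_def n_def
      by (intro divide_right_mono gap_sum) (use False i b N in \<open>auto simp: K_def \<beta>_def n_def\<close>)
    also have "\<dots> = real (Suc L) * E i * real N ^ n / b ^ n * a i powr \<beta> i"
      unfolding a_def using inv_minima_pos[OF b0, of i k x] i q by (subst powr_divide) (auto simp: n_def)
    also have "\<dots> \<le> real (Suc L) * E i * real N ^ n / b ^ n * H"
      unfolding H_def a_def \<beta>_def n_def using b0 E0[of i] i
      by (intro mult_left_mono height_ge_term) (auto simp: n_def)
    also have "\<dots> = (E i * real (Suc L)) * (real N ^ n / b ^ n * H)" by simp
    also have "\<dots> \<le> (E i * real (Suc L) + 1 / real n) * (real N ^ n / b ^ n * H)"
      using b0 H by (intro mult_right_mono) auto
    finally show ?thesis by simp
  next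
    case True
    have "a' i c powr \<beta> i \<le> 1 / (real n * b ^ n) * H" if c: "c \<in> cells N" for c
    proof -
      have near: "\<bar>child N k x c $ j - x $ j\<bar> \<le> 1 / b ^ (Suc CARD('n) * k)" for j
        by (rule child_near) (use Nb N0 c in \<open>simp_all add: n_def\<close>)
      have "inv_minima b (Suc k) (child N k x c) i \<le> ((1 + real n) * b) ^ i * inv_minima b k x i"
        unfolding n_def by (rule inv_minima_child_le[OF b1 near]) (use i in \<open>auto simp: n_def\<close>)
      then have "a' i c \<le> ((1 + real n) * b) ^ i * inv_minima b k x i / w ^ (i * (n + 1 - i))"
        unfolding a'_def using w0 by (intro divide_right_mono) auto
      also have "\<dots> = ((1 + real n) * b) ^ i * a i" by (simp add: a_def)
      also have "\<dots> \<le> ((1 + real n) * b) ^ n * (K * D / w * H powr (real (n + 1 - i) / real n))"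
      proof (intro mult_mono power_increasing)
        show "a i \<le> K * D / w * H powr (real (n + 1 - i) / real n)"
          unfolding a_def D_def H_def n_def
          by (rule no_gap_bound[OF b0 w0]) (use i True K1 in \<open>auto simp: n_def\<close>)
        show "0 \<le> a i" unfolding a_def using inv_minima_pos[OF b0, of i k x] w0 i by (simp add: n_def)
      qed (use nb i in auto)
      also have "\<dots> = (((1 + real n) * b) ^ n * (K * D) / w) * H powr (real (n + 1 - i) / real n)" by simp
      also have "((1 + real n) * b) ^ n * (K * D) / w = 1 / (real n * b ^ n)"
      proof -
        have "((1 + real n) * b) ^ n * (K * D) \<noteq> 0" using nb K1 D by auto
        then show ?thesis unfolding w_eq by (rule nonzero_divide_mult_cancel_left)
      qed
      finally have le: "a' i c \<le> 1 / (real n * b ^ n) * H powr (real (n + 1 - i) / real n)" .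
      have "a' i c powr \<beta> i \<le> (1 / (real n * b ^ n) * H powr (real (n + 1 - i) / real n)) powr \<beta> i"
        by (rule powr_mono2[OF _ _ le]) (use a'0[of i c] i in \<open>auto simp: \<beta>_def\<close>)
      also have "\<dots> = (1 / (real n * b ^ n)) powr \<beta> i * (H powr (real (n + 1 - i) / real n)) powr \<beta> i"
        by (rule powr_mult)
      also have "(H powr (real (n + 1 - i) / real n)) powr \<beta> i = H"
        using H n1 i by (simp add: powr_powr \<beta>_def)
      \<comment> \<open>The base is at most 1 and \<open>\<beta> i \<ge> 1\<close>, so the power
        only decreases it.\<close>
      also have "(1 / (real n * b ^ n)) powr \<beta> i * H \<le> (1 / (real n * b ^ n)) powr 1 * H"
      proof (intro mult_right_mono powr_mono')
        show "1 \<le> \<beta> i" using i by (simp add: \<beta>_def)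
        have "1 * 1 \<le> real n * b ^ n" using n1 b1 by (intro mult_mono one_le_power) auto
        then show "1 / (real n * b ^ n) \<le> 1" by (simp add: divide_le_eq)
      qed (use n1 b0 H in auto)
      finally show ?thesis using n1 b0 by simp
    qed
    then have "(\<Sum>c\<in>cells N. a' i c powr \<beta> i) \<le> (\<Sum>c\<in>(cells N :: (int^'n) set). 1 / (real n * b ^ n) * H)"
      by (rule sum_mono)
    also have "\<dots> = real N ^ n * (1 / (real n * b ^ n) * H)"
      by (simp add: card_cells n_def)
    also have "\<dots> = (0 + 1 / real n) * (real N ^ n / b ^ n * H)" by simp
    also have "\<dots> \<le> (E i * real (Suc L) + 1 / real n) * (real N ^ n / b ^ n * H)"
      using b0 H E0[of i] by (intro mult_right_mono add_right_mono) auto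
    finally show ?thesis by simp
  qed
  have "(\<Sum>c\<in>cells N. height w b (Suc k) (child N k x c))
      = (\<Sum>c\<in>(cells N :: (int^'n) set). 1 + (\<Sum>i=1..n. a' i c powr \<beta> i))"
    unfolding height_def a'_def \<beta>_def n_def ..
  also have "\<dots> = real N ^ n + (\<Sum>i=1..n. \<Sum>c\<in>cells N. a' i c powr \<beta> i)"
    unfolding sum.distrib by (subst sum.swap) (simp add: card_cells n_def)
  also have "(\<Sum>i=1..n. \<Sum>c\<in>cells N. a' i c powr \<beta> i)
      \<le> (\<Sum>i=1..n. (E i * real (Suc L) + 1 / real n) * real N ^ n / b ^ n * H)"
    by (intro sum_mono contribution) auto
  also have "\<dots> = (\<Sum>i=1..n. E i * real (Suc L) + 1 / real n) * (real N ^ n / b ^ n * H)"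
    by (subst sum_distrib_right) (intro sum.cong refl, simp only: times_divide_eq_right mult.assoc times_divide_eq_left)
  also have "(\<Sum>i=1..n. E i * real (Suc L) + 1 / real n) = height_const n * real (Suc L) + 1"
    using n1 by (simp add: sum.distrib height_const_def E_def sum_distrib_right del: of_nat_Suc)
  finally have "(\<Sum>c\<in>cells N. height w b (Suc k) (child N k x c))
      \<le> real N ^ n + (height_const n * real (Suc L) + 1) * (real N ^ n / b ^ n * H)" by simp
  moreover have "p + q * (p / r * s) = p * (1 + q / r * s)" for p q r s :: real
    by (simp add: algebra_simps)
  ultimately show ?thesis by (simp only: H_def L_def)
qed

section \<open>Counting cells with frequent visits to the cusp\<close>

definition subcell :: "nat \<Rightarrow> int^'n::finite \<Rightarrow> int^'n \<Rightarrow> int^'n" where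
  "subcell N m c = (\<chi> i. int N * m $ i + c $ i)"

definition supercell :: "nat \<Rightarrow> int^'n::finite \<Rightarrow> int^'n" where
  "supercell N m = (\<chi> i. m $ i div int N)"

primrec descendants :: "nat \<Rightarrow> int^'n::finite \<Rightarrow> nat \<Rightarrow> (int^'n) set" where
  "descendants N m 0 = {m}"
| "descendants N m (Suc k) = (\<lambda>(d, c). subcell N d c) ` (descendants N m k \<times> cells N)"

text \<open>Levels \<open>0\<close> to \<open>k - 1\<close> are counted, not level \<open>k\<close>
  itself: whether a cell is a visit affects the weight of its children.\<close>

primrec visits :: "nat \<Rightarrow> (nat \<Rightarrow> int^'n::finite \<Rightarrow> bool) \<Rightarrow> nat \<Rightarrow> int^'n \<Rightarrow> nat" where
  "visits N P 0 m = 0"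
| "visits N P (Suc k) m = visits N P k (supercell N m) + (if P k (supercell N m) then 1 else 0)"

lemma supercell_subcell:
  assumes "c \<in> cells N" shows "supercell N (subcell N m c) = m"
proof -
  have "(int N * m $ i + c $ i) div int N = m $ i" for i
  proof -
    have c: "0 \<le> c $ i" "c $ i < int N" using assms by (auto simp: cells_def)
    then have "int N \<noteq> 0" by linarith
    then show ?thesis using c by (simp add: div_pos_pos_trivial)
  qed
  then show ?thesis by (simp add: supercell_def subcell_def vec_eq_iff)
qed

lemma inj_on_subcell: "inj_on (\<lambda>(d, c). subcell N d c) (A \<times> cells N)"
proof (rule inj_onI, clarify)
  fix d c d' c' :: "int^'a" assume c: "c \<in> cells N" "c' \<in> cells N" and eq: "subcell N d c = subcell N d' c'"
  have "d = d'" using supercell_subcell[OF c(1), of d] supercell_subcell[OF c(2), of d'] eq by simp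
  moreover have "c = c'" using eq \<open>d = d'\<close> by (simp add: subcell_def vec_eq_iff)
  ultimately show "d = d' \<and> c = c'" ..
qed

lemma finite_descendants: "finite (descendants N m k)"
  by (induction k) (auto intro!: finite_imageI finite_cells)

text \<open>Dividing by \<open>2 * \<eta>\<close> at every visit of the set where \<open>H\<close> is large turns \<open>H\<close> into a
  supermartingale up to the factor \<open>1 + \<eta>\<close> per step.\<close>

lemma weighted_descendants_sum:
  fixes H :: "nat \<Rightarrow> int^'n::finite \<Rightarrow> real"
  assumes H1: "\<And>k m. H k m \<ge> 1" and M: "M > 0" and \<eta>: "\<eta> > 0"
    and rec: "\<And>k m. (\<Sum>c\<in>cells N. H (Suc k) (subcell N m c)) \<le> M * (1 + \<eta> * H k m)"
    and P: "\<And>k m. P k m \<longleftrightarrow> H k m \<ge> 1 / \<eta>"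
  shows "(\<Sum>m\<in>descendants N m0 k. H k m * (1 / (2 * \<eta>)) ^ visits N P k m) \<le> (M * (1 + \<eta>)) ^ k * H 0 m0"
proof (induction k)
  case 0
  then show ?case by simp
next
  case (Suc k)
  let ?\<theta> = "1 / (2 * \<eta>)"
  have \<theta>: "?\<theta> > 0" using \<eta> by simp
  have "(\<Sum>m\<in>descendants N m0 (Suc k). H (Suc k) m * ?\<theta> ^ visits N P (Suc k) m)
    = (\<Sum>(d, c)\<in>descendants N m0 k \<times> cells N. H (Suc k) (subcell N d c) * ?\<theta> ^ visits N P (Suc k) (subcell N d c))"
    unfolding descendants.simps sum.reindex[OF inj_on_subcell] comp_def
    by (intro sum.cong refl) (simp add: split_beta del: visits.simps)
  also have "\<dots> = (\<Sum>d\<in>descendants N m0 k. \<Sum>c\<in>cells N. H (Suc k) (subcell N d c) * ?\<theta> ^ visits N P (Suc k) (subcell N d c))"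
    by (rule sum.cartesian_product[symmetric])
  also have "\<dots> = (\<Sum>d\<in>descendants N m0 k. \<Sum>c\<in>cells N. H (Suc k) (subcell N d c) *
        (?\<theta> ^ visits N P k d * (if P k d then ?\<theta> else 1)))"
    by (intro sum.cong refl) (simp add: supercell_subcell)
  also have "\<dots> = (\<Sum>d\<in>descendants N m0 k. (\<Sum>c\<in>cells N. H (Suc k) (subcell N d c)) *
        (?\<theta> ^ visits N P k d * (if P k d then ?\<theta> else 1)))"
    by (simp only: sum_distrib_right)
  also have "\<dots> \<le> (\<Sum>d\<in>descendants N m0 k. M * (1 + \<eta>) * (H k d * ?\<theta> ^ visits N P k d))"
  proof (rule sum_mono)
    fix d
    have "(\<Sum>c\<in>cells N. H (Suc k) (subcell N d c)) * (if P k d then ?\<theta> else 1)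
       \<le> M * (1 + \<eta> * H k d) * (if P k d then ?\<theta> else 1)"
      using \<theta> by (intro mult_right_mono rec) auto
    also have "\<dots> \<le> M * ((1 + \<eta>) * H k d)"
    proof -
      \<comment> \<open>At a visit \<open>\<eta> * H \<ge> 1\<close>, so
        \<open>1 + \<eta> * H \<le> 2 * \<eta> * H\<close> and the weight restores \<open>H\<close>;
        elsewhere \<open>H \<ge> 1\<close> is enough.\<close>
      have "(1 + \<eta> * H k d) * (if P k d then ?\<theta> else 1) \<le> (1 + \<eta>) * H k d"
      proof (cases "P k d")
        case True
        then have "1 \<le> \<eta> * H k d" using \<eta> by (simp add: P field_simps)
        then have "(1 + \<eta> * H k d) * ?\<theta> \<le> (2 * (\<eta> * H k d)) * ?\<theta>" using \<theta> by (intro mult_right_mono) auto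
        also have "\<dots> = H k d" using \<eta> by simp
        also have "\<dots> \<le> (1 + \<eta>) * H k d" using \<eta> H1[of k d] by (simp add: distrib_right)
        finally show ?thesis using True by simp
      next
        case False
        then show ?thesis using H1[of k d] by (simp add: distrib_right)
      qed
      then show ?thesis using M by (simp add: mult.assoc)
    qed
    finally have "(\<Sum>c\<in>cells N. H (Suc k) (subcell N d c)) * (if P k d then ?\<theta> else 1) * ?\<theta> ^ visits N P k d
      \<le> M * ((1 + \<eta>) * H k d) * ?\<theta> ^ visits N P k d"
      using \<theta> by (intro mult_right_mono) auto
    then show "(\<Sum>c\<in>cells N. H (Suc k) (subcell N d c)) * (?\<theta> ^ visits N P k d * (if P k d then ?\<theta> else 1))
      \<le> M * (1 + \<eta>) * (H k d * ?\<theta> ^ visits N P k d)"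
      by (simp only: mult_ac)
  qed
  also have "\<dots> = M * (1 + \<eta>) * (\<Sum>d\<in>descendants N m0 k. H k d * ?\<theta> ^ visits N P k d)"
    by (rule sum_distrib_left[symmetric])
  also have "\<dots> \<le> M * (1 + \<eta>) * ((M * (1 + \<eta>)) ^ k * H 0 m0)"
    using M \<eta> Suc by (intro mult_left_mono) auto
  finally show ?case by simp
qed

text \<open>Markov's inequality for the weighted sum: at least \<open>(k - k0) / 2\<close> visits
  give a weight of at least \<open>sqrt (2 * \<eta>)\<close> to the power \<open>k0 - k\<close>.
  This square root is the origin of the 2 in the codimension \<open>n / (2 (n + 1))\<close>.\<close>

lemma card_frequent_descendants:
  fixes H :: "nat \<Rightarrow> int^'n::finite \<Rightarrow> real"
  assumes H1: "\<And>k m. H k m \<ge> 1" and M: "M > 0" and \<eta>: "\<eta> > 0" "2 * \<eta> < 1"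
    and rec: "\<And>k m. (\<Sum>c\<in>cells N. H (Suc k) (subcell N m c)) \<le> M * (1 + \<eta> * H k m)"
    and P: "\<And>k m. P k m \<longleftrightarrow> H k m \<ge> 1 / \<eta>"
  shows "real (card {m\<in>descendants N m0 k. k \<le> 2 * visits N P k m + k0})
     \<le> H 0 m0 / sqrt (2 * \<eta>) ^ k0 * (M * (1 + \<eta>) * sqrt (2 * \<eta>)) ^ k"
proof -
  define \<zeta> where "\<zeta> = sqrt (2 * \<eta>)"
  have \<zeta>: "\<zeta> > 0" "\<zeta> < 1" and \<zeta>2: "\<zeta>\<^sup>2 = 2 * \<eta>" using \<eta> by (auto simp: \<zeta>_def)
  let ?F = "{m\<in>descendants N m0 k. k \<le> 2 * visits N P k m + k0}"
  have "real (card ?F) * (\<zeta> ^ k0 / \<zeta> ^ k) = (\<Sum>m\<in>?F. \<zeta> ^ k0 / \<zeta> ^ k)" by simp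
  also have "\<dots> \<le> (\<Sum>m\<in>?F. H k m * (1 / (2 * \<eta>)) ^ visits N P k m)"
  proof (rule sum_mono)
    fix m assume m: "m \<in> ?F"
    define v where "v = visits N P k m"
    have "\<zeta> ^ (2 * v + k0) \<le> \<zeta> ^ k" using m \<zeta> by (intro power_decreasing) (auto simp: v_def)
    then have "\<zeta> ^ k0 / \<zeta> ^ k \<le> 1 / \<zeta> ^ (2 * v)"
      using \<zeta> by (simp add: power_add field_simps)
    also have "\<dots> = 1 * (1 / (2 * \<eta>)) ^ v" by (simp add: power_mult \<zeta>2 power_one_over)
    also have "\<dots> \<le> H k m * (1 / (2 * \<eta>)) ^ v" using H1[of k m] \<eta> by (intro mult_right_mono) auto
    finally show "\<zeta> ^ k0 / \<zeta> ^ k \<le> H k m * (1 / (2 * \<eta>)) ^ visits N P k m" by (simp add: v_def)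
  qed
  also have "\<dots> \<le> (\<Sum>m\<in>descendants N m0 k. H k m * (1 / (2 * \<eta>)) ^ visits N P k m)"
    using \<eta> by (intro sum_mono2 finite_descendants) (auto intro!: mult_nonneg_nonneg order_trans[OF _ H1])
  also have "\<dots> \<le> (M * (1 + \<eta>)) ^ k * H 0 m0"
    by (rule weighted_descendants_sum[where H=H and M=M and \<eta>=\<eta> and P=P]) (rule H1 M \<eta>(1) rec P)+
  finally have "real (card ?F) * (\<zeta> ^ k0 / \<zeta> ^ k) \<le> (M * (1 + \<eta>)) ^ k * H 0 m0" .
  then have "real (card ?F) \<le> (M * (1 + \<eta>)) ^ k * H 0 m0 / (\<zeta> ^ k0 / \<zeta> ^ k)"
    using \<zeta> by (subst pos_le_divide_eq) auto
  also have "\<dots> = H 0 m0 / \<zeta> ^ k0 * (M * (1 + \<eta>) * \<zeta>) ^ k"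
    by (simp add: power_mult_distrib)
  finally show ?thesis by (simp add: \<zeta>_def)
qed

section \<open>Cells in space and covers by frequently visited cells\<close>

definition cell_index :: "nat \<Rightarrow> nat \<Rightarrow> real^'n::finite \<Rightarrow> int^'n" where
  "cell_index N k x = (\<chi> i. \<lfloor>real N ^ k * x $ i\<rfloor>)"

definition cell_corner :: "nat \<Rightarrow> nat \<Rightarrow> int^'n::finite \<Rightarrow> real^'n" where
  "cell_corner N k m = (1 / real N ^ k) *\<^sub>R rvec m"

lemma cell_corner_subcell:
  assumes "N > 0" shows "cell_corner N (Suc k) (subcell N m c) = child N k (cell_corner N k m) c"
  using assms by (simp add: cell_corner_def child_def subcell_def rvec_def vec_eq_iff field_simps)

lemma supercell_cell_index:
  assumes "N > 0" shows "supercell N (cell_index N (Suc k) x) = cell_index N k x"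
proof -
  have "\<lfloor>real N ^ Suc k * x $ i\<rfloor> div int N = \<lfloor>real N ^ k * x $ i\<rfloor>" for i
  proof -
    have "\<lfloor>real N ^ Suc k * x $ i\<rfloor> div int N = \<lfloor>real N ^ Suc k * x $ i / real N\<rfloor>"
      using floor_divide_real_eq_div[of "int N" "real N ^ Suc k * x $ i"] by simp
    also have "real N ^ Suc k * x $ i / real N = real N ^ k * x $ i" using assms by simp
    finally show ?thesis .
  qed
  then show ?thesis by (simp only: supercell_def cell_index_def vec_lambda_beta)
qed

lemma cell_index_in_descendants:
  assumes "N > 0" shows "cell_index N k x \<in> descendants N (cell_index N 0 x) k"
proof (induction k)
  case (Suc k)
  define c :: "int^'a" where "c = (\<chi> i. cell_index N (Suc k) x $ i mod int N)"
  have "c \<in> cells N" using assms by (simp add: c_def cells_def)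
  moreover have "cell_index N (Suc k) x = subcell N (supercell N (cell_index N (Suc k) x)) c"
    by (simp add: subcell_def supercell_def c_def vec_eq_iff)
  ultimately show ?case using Suc supercell_cell_index[OF assms, of k x]
    by (auto intro!: image_eqI[of _ _ "(cell_index N k x, c)"])
qed simp

lemma near_cell_corner:
  assumes "N > 0"
  shows "\<bar>x $ i - cell_corner N k (cell_index N k x) $ i\<bar> \<le> 1 / real N ^ k"
proof -
  have p: "real N ^ k > 0" using assms by simp
  have "\<bar>real N ^ k * x $ i - real_of_int \<lfloor>real N ^ k * x $ i\<rfloor>\<bar> \<le> 1" by linarith
  then have "\<bar>real N ^ k * x $ i - real_of_int \<lfloor>real N ^ k * x $ i\<rfloor>\<bar> / real N ^ k \<le> 1 / real N ^ k"
    using p by (intro divide_right_mono) auto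
  also have "\<bar>real N ^ k * x $ i - real_of_int \<lfloor>real N ^ k * x $ i\<rfloor>\<bar> / real N ^ k
     = \<bar>(real N ^ k * x $ i - real_of_int \<lfloor>real N ^ k * x $ i\<rfloor>) / real N ^ k\<bar>" using p by simp
  also have "(real N ^ k * x $ i - real_of_int \<lfloor>real N ^ k * x $ i\<rfloor>) / real N ^ k
     = x $ i - cell_corner N k (cell_index N k x) $ i"
    using p by (simp add: cell_corner_def cell_index_def rvec_def diff_divide_distrib)
  finally show ?thesis .
qed

lemma
  fixes m :: "int^'n::finite"
  assumes N: "N > 0"
  shows bounded_cell: "bounded {x. cell_index N k x = m}" (is "bounded ?C")
    and diameter_cell: "diameter {x. cell_index N k x = m} \<le> 2 * real CARD('n) / real N ^ k"
proof -
  have d: "norm (x - y) \<le> 2 * real CARD('n) / real N ^ k" if "x \<in> ?C" "y \<in> ?C" for x y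
  proof -
    have "norm (x - y) \<le> (\<Sum>i\<in>UNIV. \<bar>(x - y) $ i\<bar>)" by (rule norm_le_l1_cart)
    also have "\<dots> \<le> (\<Sum>i\<in>(UNIV::'n set). 2 / real N ^ k)"
    proof (rule sum_mono)
      fix i
      have "\<bar>x $ i - cell_corner N k m $ i\<bar> \<le> 1 / real N ^ k" "\<bar>y $ i - cell_corner N k m $ i\<bar> \<le> 1 / real N ^ k"
        using near_cell_corner[OF N, of x i k] near_cell_corner[OF N, of y i k] that by auto
      then show "\<bar>(x - y) $ i\<bar> \<le> 2 / real N ^ k" by simp
    qed
    finally show ?thesis by (simp add: mult.commute)
  qed
  show "bounded ?C" unfolding bounded_two_points using d by (auto simp: dist_norm)
  show "diameter ?C \<le> 2 * real CARD('n) / real N ^ k"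
    by (rule diameter_le) (use d in auto)
qed

lemma visits_cell_index:
  assumes "N > 0"
  shows "visits N P k (cell_index N k x) = card {j. j < k \<and> P j (cell_index N j x)}"
proof (induction k)
  case (Suc k)
  have "{j. j < Suc k \<and> P j (cell_index N j x)}
    = {j. j < k \<and> P j (cell_index N j x)} \<union> (if P k (cell_index N k x) then {k} else {})"
    by (auto simp: less_Suc_eq)
  then show ?case using Suc by (simp add: supercell_cell_index[OF assms] card_Un_disjoint)
qed simp

text \<open>For a fixed initial cell and fixed \<open>k0\<close>, the frequently visited cells of
  level \<open>k\<close> have an \<open>s\<close>-sum of geometric size, with ratio the left side of
  \<open>small\<close>. The limsup is then null, and there are countably many choices of initial
  cell and \<open>k0\<close>.\<close>

lemma hausdorff_content_0_frequent:
  fixes H :: "nat \<Rightarrow> int^'n::finite \<Rightarrow> real"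
  assumes N: "N > 0" and s: "s > 0"
    and H1: "\<And>k m. H k m \<ge> 1" and M: "M > 0" and \<eta>: "\<eta> > 0" "2 * \<eta> < 1"
    and rec: "\<And>k m. (\<Sum>c\<in>cells N. H (Suc k) (subcell N m c)) \<le> M * (1 + \<eta> * H k m)"
    and P: "\<And>k m. P k m \<longleftrightarrow> H k m \<ge> 1 / \<eta>"
    and small: "M * (1 + \<eta>) * sqrt (2 * \<eta>) * (1 / real N) powr s < 1"
  shows "hausdorff_content s {x. \<exists>k0. \<exists>\<^sub>\<infinity>k. k \<le> 2 * visits N P k (cell_index N k x) + k0} = 0"
proof -
  define S where "S m0 k0 = {x. cell_index N 0 x = m0 \<and> (\<exists>\<^sub>\<infinity>k. k \<le> 2 * visits N P k (cell_index N k x) + k0)}"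
    for m0 :: "int^'n" and k0
  have S0: "hausdorff_content s (S m0 k0) = 0" for m0 k0
  proof -
    define F where "F k = {m\<in>descendants N m0 k. k \<le> 2 * visits N P k m + k0}" for k
    define C where "C k m = {x. cell_index N k x = m}" for k and m :: "int^'n"
    define q where "q = M * (1 + \<eta>) * sqrt (2 * \<eta>) * (1 / real N) powr s"
    define A where "A = H 0 m0 / sqrt (2 * \<eta>) ^ k0 * (2 * real CARD('n)) powr s"
    have q0: "q \<ge> 0" using M \<eta> by (simp add: q_def)
    show ?thesis
    proof (rule hausdorff_content_0_limsup[where F=F and C=C and g="\<lambda>k. A * q ^ k"])
      show "finite (F k)" for k
        unfolding F_def by (rule finite_subset[OF _ finite_descendants[of N m0 k]]) auto
      show "bounded (C k m)" for k m unfolding C_def by (rule bounded_cell[OF N])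
      show "summable (\<lambda>k. A * q ^ k)"
        using small q0 by (intro summable_mult summable_geometric) (simp add: q_def)
      show "\<exists>\<^sub>\<infinity>k. x \<in> (\<Union>m\<in>F k. C k m)" if "x \<in> S m0 k0" for x
      proof -
        have "\<exists>\<^sub>\<infinity>k. k \<le> 2 * visits N P k (cell_index N k x) + k0" using that by (simp add: S_def)
        then show ?thesis
        proof (rule INFM_mono)
          fix k assume "k \<le> 2 * visits N P k (cell_index N k x) + k0"
          then have "cell_index N k x \<in> F k"
            using cell_index_in_descendants[OF N, of k x] that by (simp add: F_def S_def)
          then show "x \<in> (\<Union>m\<in>F k. C k m)" by (auto simp: C_def)
        qed
      qed
      fix k
      have "(\<Sum>m\<in>F k. diameter_power s (C k m)) \<le> (\<Sum>m\<in>F k. (2 * real CARD('n) / real N ^ k) powr s)"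
      proof (rule sum_mono)
        fix m
        have "diameter (C k m) powr s \<le> (2 * real CARD('n) / real N ^ k) powr s"
          unfolding C_def using s by (intro powr_mono2 diameter_cell[OF N] diameter_ge_0 bounded_cell[OF N]) auto
        then show "diameter_power s (C k m) \<le> (2 * real CARD('n) / real N ^ k) powr s"
          using s by (simp add: diameter_power_def)
      qed
      also have "\<dots> = real (card (F k)) * (2 * real CARD('n) / real N ^ k) powr s" by simp
      also have "\<dots> \<le> (H 0 m0 / sqrt (2 * \<eta>) ^ k0 * (M * (1 + \<eta>) * sqrt (2 * \<eta>)) ^ k)
          * (2 * real CARD('n) / real N ^ k) powr s"
        unfolding F_def by (rule mult_right_mono[OF card_frequent_descendants[where H=H and M=M and \<eta>=\<eta> and P=P]])
           (simp_all add: H1 M \<eta> rec P)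
      also have "(2 * real CARD('n) / real N ^ k) powr s = (2 * real CARD('n)) powr s * ((1 / real N) powr s) ^ k"
      proof -
        have "2 * real CARD('n) / real N ^ k = (2 * real CARD('n)) * (1 / real N) ^ k" by (simp add: power_one_over)
        moreover have "((1 / real N) ^ k) powr s = ((1 / real N) powr s) ^ k"
          using N by (simp add: powr_realpow[symmetric] powr_powr mult.commute)
        ultimately show ?thesis by (simp add: powr_mult)
      qed
      finally show "(\<Sum>m\<in>F k. diameter_power s (C k m)) \<le> A * q ^ k"
        by (simp add: A_def q_def power_mult_distrib mult_ac)
    qed
  qed
  have "countable (UNIV :: (int^'n) set)"
  proof -
    have "countable (range (vec_lambda :: ('n \<Rightarrow> int) \<Rightarrow> int^'n))" by (intro countable_image) simp
    moreover have "range (vec_lambda :: ('n \<Rightarrow> int) \<Rightarrow> int^'n) = UNIV" by (metis surjI vec_nth_inverse)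
    ultimately show ?thesis by simp
  qed
  then have "countable ((UNIV :: (int^'n) set) \<times> (UNIV :: nat set))" by (intro countable_SIGMA) auto
  then obtain e :: "nat \<Rightarrow> (int^'n) \<times> nat" where e: "range e = UNIV"
    using range_from_nat_into[of "UNIV :: ((int^'n) \<times> nat) set"] unfolding UNIV_Times_UNIV by blast
  have "{x. \<exists>k0. \<exists>\<^sub>\<infinity>k. k \<le> 2 * visits N P k (cell_index N k x) + k0} \<subseteq> (\<Union>i. S (fst (e i)) (snd (e i)))"
  proof
    fix x assume "x \<in> {x. \<exists>k0. \<exists>\<^sub>\<infinity>k. k \<le> 2 * visits N P k (cell_index N k x) + k0}"
    then obtain k0 where "x \<in> S (cell_index N 0 x) k0" by (auto simp: S_def)
    moreover obtain i where "e i = (cell_index N 0 x, k0)" using e by (metis UNIV_I rangeE)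
    ultimately show "x \<in> (\<Union>i. S (fst (e i)) (snd (e i)))" by (auto intro!: exI[of _ i])
  qed
  then have "hausdorff_content s {x. \<exists>k0. \<exists>\<^sub>\<infinity>k. k \<le> 2 * visits N P k (cell_index N k x) + k0}
      \<le> hausdorff_content s (\<Union>i. S (fst (e i)) (snd (e i)))" by (rule hausdorff_content_mono)
  also have "\<dots> = 0" by (rule hausdorff_content_0_UN) (rule S0)
  finally show ?thesis by simp
qed

section \<open>Jointly singular pairs\<close>

text \<open>The Dani correspondence: a small value of the form is a short vector at
  \<open>\<xi>\<close>, and at the corner of its cell up to another factor \<open>1 + n\<close>. The
  bound comes from the term of rank 1, whose exponent is 1 and whose weight is
  \<open>w ^ n\<close>.\<close>

lemma height_ge_of_small_form:
  fixes \<xi> :: "real^'n::finite" and p :: int and q :: "int^'n"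
  defines "n \<equiv> CARD('n)"
  assumes b: "b \<ge> 1" and w: "w > 0" and N: "real N = b ^ Suc n" "N > 0" and r: "r > 0"
    and q: "1 \<le> int_sup_norm q" "real_of_int (int_sup_norm q) \<le> r * b ^ k"
    and small: "\<bar>affine_form p q \<xi>\<bar> \<le> r / b ^ (n * k)"
  shows "height w b k (cell_corner N k (cell_index N k \<xi>)) \<ge> 1 / ((1 + real n)\<^sup>2 * r * w ^ n)"
proof -
  define x where "x = cell_corner N k (cell_index N k \<xi>)"
  have b0: "b > 0" using b by simp
  have n1: "n \<ge> 1" by (simp add: n_def Suc_leI)
  define z where "z = (real_of_int p, rvec q)"
  have z: "z \<in> int_lattice" by (simp add: z_def int_lattice_def rvec_def)
  have qi: "\<bar>q $ i\<bar> \<le> int_sup_norm q" for i unfolding int_sup_norm_def by (rule Max_ge) auto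
  have "q \<noteq> 0"
  proof
    assume "q = 0"
    then have "int_sup_norm q = 0" by (simp add: int_sup_norm_def)
    then show False using q(1) by simp
  qed
  then have z0: "z \<noteq> 0" by (auto simp: z_def zero_prod_def rvec_def vec_eq_iff)
  have nq: "norm (rvec q) \<le> real n * (r * b ^ k)"
  proof -
    have "norm (rvec q) \<le> (\<Sum>i\<in>UNIV. \<bar>rvec q $ i\<bar>)" by (rule norm_le_l1_cart)
    also have "\<dots> \<le> (\<Sum>i\<in>(UNIV::'n set). r * b ^ k)"
    proof (rule sum_mono)
      fix i
      have "real_of_int \<bar>q $ i\<bar> \<le> real_of_int (int_sup_norm q)" using qi[of i] by linarith
      then show "\<bar>rvec q $ i\<bar> \<le> r * b ^ k" using q(2) by (simp add: rvec_def)
    qed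
    finally show ?thesis by (simp add: n_def)
  qed
  have form: "fst z + snd z \<bullet> \<xi> = affine_form p q \<xi>"
    by (simp add: z_def affine_form_def inner_vec_def rvec_def)
  have "norm (flow_map b k \<xi> z) \<le> norm (b ^ (n * k) * affine_form p q \<xi>) + norm ((1 / b ^ k) *\<^sub>R rvec q)"
    unfolding flow_map_def form n_def[symmetric] by (rule order_trans[OF norm_Pair_le]) (simp add: z_def)
  also have "\<dots> \<le> r + real n * r"
  proof (rule add_mono)
    have "b ^ (n * k) * \<bar>affine_form p q \<xi>\<bar> \<le> b ^ (n * k) * (r / b ^ (n * k))"
      using small b0 by (intro mult_left_mono) auto
    then show "norm (b ^ (n * k) * affine_form p q \<xi>) \<le> r" using b0 by (simp add: abs_mult)
    have "1 / b ^ k * norm (rvec q) \<le> 1 / b ^ k * (real n * (r * b ^ k))"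
      using b0 by (intro mult_left_mono nq) auto
    then show "norm ((1 / b ^ k) *\<^sub>R rvec q) \<le> real n * r" using b0 by simp
  qed
  also have "\<dots> = (1 + real n) * r" by (simp add: algebra_simps)
  finally have le1: "norm (flow_map b k \<xi> z) \<le> (1 + real n) * r" .
  have "norm (flow_map b k x z) \<le> (1 + real n) * norm (flow_map b k \<xi> z)"
    unfolding n_def
  proof (rule norm_flow_map_perturb[OF b0])
    fix i
    have "real N ^ k = b ^ (Suc n * k)" unfolding N(1) by (rule power_mult[symmetric])
    then show "\<bar>x $ i - \<xi> $ i\<bar> \<le> 1 / b ^ (Suc CARD('n) * k)"
      using near_cell_corner[OF N(2), of \<xi> i k] by (simp add: x_def n_def abs_minus_commute)
  qed
  also have "\<dots> \<le> (1 + real n) * ((1 + real n) * r)" by (intro mult_left_mono le1) auto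
  also have "\<dots> = (1 + real n)\<^sup>2 * r" by (simp add: power2_eq_square)
  finally have le2: "norm (flow_map b k x z) \<le> (1 + real n)\<^sup>2 * r" .
  have "minima_at b k x 0 \<le> (1 + real n)\<^sup>2 * r"
    unfolding minima_at_def
  proof (rule lattice_map.succ_min_le[OF lattice_map_flow_map[OF b0]])
    show "0 \<le> (1 + real n)\<^sup>2 * r" using r by simp
    have "z \<in> {z \<in> int_lattice. norm (flow_map b k x z) \<le> (1 + real n)\<^sup>2 * r}" using z le2 by simp
    then have "\<not> {z \<in> int_lattice. norm (flow_map b k x z) \<le> (1 + real n)\<^sup>2 * r} \<subseteq> {0}" using z0 by blast
    then show "0 < dim {z \<in> int_lattice. norm (flow_map b k x z) \<le> (1 + real n)\<^sup>2 * r}"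
      by (simp only: neq0_conv[symmetric] dim_eq_0 not_False_eq_True)
  qed
  moreover have "minima_at b k x 0 > 0" by (rule minima_at_pos[OF b0]) simp
  ultimately have "1 / ((1 + real n)\<^sup>2 * r) \<le> inv_minima b k x 1"
    by (simp add: inv_minima_def frac_le)
  then have "1 / ((1 + real n)\<^sup>2 * r) / w ^ n \<le> inv_minima b k x 1 / w ^ n"
    using w by (intro divide_right_mono) auto
  also have "\<dots> = (inv_minima b k x 1 / w ^ (1 * (n + 1 - 1))) powr (real n / real (n + 1 - 1))"
  proof -
    have "inv_minima b k x 1 > 0" by (rule inv_minima_pos[OF b0]) simp
    then show ?thesis using w n1 by simp
  qed
  also have "\<dots> \<le> height w b k x"
    unfolding n_def by (rule height_ge_term) (use n1 in \<open>auto simp: n_def\<close>)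
  finally show ?thesis by (simp add: x_def)
qed

lemma Sing2_height:
  fixes \<xi>1 \<xi>2 :: "real^'n::finite"
  defines "n \<equiv> CARD('n)"
  assumes b: "b = 2 ^ t" and t: "t \<ge> 1" and N: "N = 2 ^ (Suc n * t)" and w: "w > 0"
    and S: "(\<xi>1, \<xi>2) \<in> Sing2"
  shows "\<exists>K. \<forall>k\<ge>K. height w b k (cell_corner N k (cell_index N k \<xi>1)) \<ge> A
     \<or> height w b k (cell_corner N k (cell_index N k \<xi>2)) \<ge> A"
proof -
  have b1: "b \<ge> 1" by (simp add: b)
  have Nb: "real N = b ^ Suc n" unfolding b N by (simp add: power_mult[symmetric] mult.commute power_add[symmetric])
  obtain a :: nat where a: "A * ((1 + real n)\<^sup>2 * w ^ n) < 2 ^ a"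
    using real_arch_pow[of 2 "A * ((1 + real n)\<^sup>2 * w ^ n)"] by auto
  \<comment> \<open>A power of \<open>1 / 2\<close>, so that \<open>r * b ^ k\<close> is a natural
    number for large \<open>k\<close> and can be taken as \<open>Q\<close>; the choice of
    \<open>\<epsilon>\<close> below then makes \<open>\<epsilon> / Q ^ n\<close> equal to
    \<open>r / b ^ (n * k)\<close>.\<close>
  define r :: real where "r = 1 / 2 ^ a"
  have r: "r > 0" by (simp add: r_def)
  have "A * ((1 + real n)\<^sup>2 * w ^ n) \<le> 1 / r" using a by (simp add: r_def)
  then have Ar: "A \<le> 1 / ((1 + real n)\<^sup>2 * r * w ^ n)"
    using r w by (simp add: field_simps add_pos_nonneg)
  define \<epsilon> where "\<epsilon> = r ^ Suc n"
  have "\<epsilon> > 0" using r by (simp add: \<epsilon>_def)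
  then obtain Q0 :: nat where Q0: "\<And>Q. Q \<ge> Q0 \<Longrightarrow> \<exists>(p :: int) (q :: int^'n).
       1 \<le> int_sup_norm q \<and> int_sup_norm q \<le> int Q \<and>
       min \<bar>affine_form p q \<xi>1\<bar> \<bar>affine_form p q \<xi>2\<bar> < \<epsilon> / real Q ^ n"
    using S unfolding Sing2_def eventually_sequentially n_def by blast
  show ?thesis
  \<comment> \<open>The summand \<open>a\<close> keeps the exponent \<open>t * k - a\<close> from
    being truncated at 0, and \<open>2 ^ y \<ge> y\<close> then gives
    \<open>Q \<ge> Q0\<close>.\<close>
  proof (intro exI[of _ "Q0 + a"] allI impI)
    fix k assume k: "Q0 + a \<le> k"
    have tk: "t * k \<ge> k" using t by simp
    define Q :: nat where "Q = 2 ^ (t * k - a)"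
    have "Q \<ge> t * k - a" unfolding Q_def by (rule less_imp_le[OF less_exp])
    then have "Q \<ge> Q0" using k tk by linarith
    then obtain p :: int and q :: "int^'n" where pq: "1 \<le> int_sup_norm q" "int_sup_norm q \<le> int Q"
       "min \<bar>affine_form p q \<xi>1\<bar> \<bar>affine_form p q \<xi>2\<bar> < \<epsilon> / real Q ^ n"
      using Q0 by blast
    have Q: "real Q = r * b ^ k"
    proof -
      have "a \<le> t * k" using k tk by linarith
      then have "(2::real) ^ (t * k) = 2 ^ (t * k - a) * 2 ^ a" by (simp add: power_add[symmetric])
      then have "real Q = 2 ^ (t * k) / 2 ^ a" by (simp add: Q_def)
      then show ?thesis by (simp add: r_def b power_mult)
    qed
    have "real_of_int (int_sup_norm q) \<le> real_of_int (int Q)" using pq(2) by (simp only: of_int_le_iff)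
    then have q: "real_of_int (int_sup_norm q) \<le> r * b ^ k" using Q by simp
    have "\<epsilon> / real Q ^ n = r / b ^ (n * k)"
      unfolding Q \<epsilon>_def using r by (simp add: power_mult_distrib power_mult[symmetric] mult.commute)
    then have "\<bar>affine_form p q \<xi>1\<bar> \<le> r / b ^ (n * k) \<or> \<bar>affine_form p q \<xi>2\<bar> \<le> r / b ^ (n * k)"
      using pq(3) by (auto simp: min_def split: if_splits)
    moreover have "height w b k (cell_corner N k (cell_index N k \<xi>)) \<ge> A"
      if "\<bar>affine_form p q \<xi>\<bar> \<le> r / b ^ (n * k)" for \<xi>
    proof -
      have "1 / ((1 + real n)\<^sup>2 * r * w ^ n) \<le> height w b k (cell_corner N k (cell_index N k \<xi>))"
        unfolding n_def by (rule height_ge_of_small_form[OF b1 w _ _ r pq(1) q])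
          (use Nb that N in \<open>auto simp: n_def\<close>)
      then show ?thesis using Ar by linarith
    qed
    ultimately show "height w b k (cell_corner N k (cell_index N k \<xi>1)) \<ge> A
     \<or> height w b k (cell_corner N k (cell_index N k \<xi>2)) \<ge> A" by blast
  qed
qed

text \<open>Which of the two points has at least half of the visits may change with
  \<open>k\<close>. Hence frequency is claimed only for infinitely many \<open>k\<close>, which is
  what a limsup cover requires.\<close>

lemma frequent_visits_disj:
  fixes \<xi>1 \<xi>2 :: "real^'n::finite"
  assumes N: "N > 0" and K: "\<And>k. k \<ge> K \<Longrightarrow> P k (cell_index N k \<xi>1) \<or> P k (cell_index N k \<xi>2)"
  shows "(\<exists>k0. \<exists>\<^sub>\<infinity>k. k \<le> 2 * visits N P k (cell_index N k \<xi>1) + k0)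
       \<or> (\<exists>k0. \<exists>\<^sub>\<infinity>k. k \<le> 2 * visits N P k (cell_index N k \<xi>2) + k0)"
proof -
  define v where "v \<xi> k = visits N P k (cell_index N k \<xi>)" for \<xi> k
  have "k \<le> 2 * v \<xi>1 k + K \<or> k \<le> 2 * v \<xi>2 k + K" for k
  proof -
    have "{K..<k} \<subseteq> {j. j < k \<and> P j (cell_index N j \<xi>1)} \<union> {j. j < k \<and> P j (cell_index N j \<xi>2)}"
    proof
      fix j assume "j \<in> {K..<k}"
      then show "j \<in> {j. j < k \<and> P j (cell_index N j \<xi>1)} \<union> {j. j < k \<and> P j (cell_index N j \<xi>2)}"
        using K[of j] by auto
    qed
    then have "card {K..<k} \<le> card ({j. j < k \<and> P j (cell_index N j \<xi>1)} \<union> {j. j < k \<and> P j (cell_index N j \<xi>2)})"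
      by (intro card_mono) auto
    also have "\<dots> \<le> v \<xi>1 k + v \<xi>2 k" unfolding v_def visits_cell_index[OF N] by (rule card_Un_le)
    finally show ?thesis by auto
  qed
  then have "\<exists>\<^sub>\<infinity>k. k \<le> 2 * v \<xi>1 k + K \<or> k \<le> 2 * v \<xi>2 k + K" by (simp add: INFM_nat)
  then show ?thesis unfolding INFM_disj_distrib v_def by blast
qed

text \<open>After squaring, \<open>\<eta>\<close> cancels \<open>2 ^ (n t)\<close> up to a factor
  linear in \<open>t\<close>, and the surplus \<open>2 powr (- 2 \<delta> t)\<close> beats that
  factor. The threshold \<open>1 / 8\<close> compensates
  \<open>2 * (1 + \<eta>)^2 \<le> 8\<close>.\<close>

lemma exists_step_size:
  fixes A \<delta> :: real
  assumes A: "A \<ge> 0" and \<delta>: "\<delta> > 0" and n: "n \<ge> 1"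
  shows "\<exists>t\<ge>1. let \<eta> = (A * real (Suc (Suc n * t)) + 1) / (2 ^ t) ^ n in
     2 * \<eta> < 1 \<and> (1 + \<eta>) * sqrt (2 * \<eta>) * 2 powr ((real n / 2 - \<delta>) * real t) < 1"
proof -
  define \<eta> where "\<eta> t = (A * real (Suc (Suc n * t)) + 1) / (2 ^ t) ^ n" for t
  have lim: "(\<lambda>t. (A * real (Suc (Suc n * t)) + 1) * x ^ t) \<longlonglongrightarrow> 0" if x: "0 \<le> x" "x < 1" for x :: real
  proof -
    have 1: "(\<lambda>t. real t * x ^ t) \<longlonglongrightarrow> 0" using powser_times_n_limit_0[of x] x by simp
    have 2: "(\<lambda>t. x ^ t) \<longlonglongrightarrow> 0" using LIMSEQ_power_zero[of x] x by simp
    have "(\<lambda>t. A * real (Suc n) * (real t * x ^ t) + (A + 1) * x ^ t) \<longlonglongrightarrow> A * real (Suc n) * 0 + (A + 1) * 0"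
      by (intro tendsto_intros 1 2)
    moreover have "(\<lambda>t. (A * real (Suc (Suc n * t)) + 1) * x ^ t)
        = (\<lambda>t. A * real (Suc n) * (real t * x ^ t) + (A + 1) * x ^ t)"
      by (rule ext) (simp add: algebra_simps)
    ultimately show ?thesis by simp
  qed
  have \<eta>_eq: "\<eta> t = (A * real (Suc (Suc n * t)) + 1) * ((1/2) ^ n) ^ t" for t
  proof -
    have "(2 ^ t :: real) ^ n = (2 ^ n) ^ t" by (metis power_mult mult.commute)
    then show ?thesis by (simp add: \<eta>_def power_one_over)
  qed
  have half: "(1/2 :: real) ^ n < 1" using n by (simp add: power_less_one_iff)
  have "\<eta> \<longlonglongrightarrow> 0" unfolding \<eta>_eq[abs_def] by (rule lim) (use half in auto)
  then have ev1: "\<forall>\<^sub>F t in sequentially. \<eta> t < 1 / 2" by (rule order_tendstoD) simp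
  define y :: real where "y = 2 powr (- 2 * \<delta>)"
  have y: "0 \<le> y" "y < 1" using \<delta> by (auto simp: y_def powr_less_one)
  have "\<forall>\<^sub>F t in sequentially. (A * real (Suc (Suc n * t)) + 1) * y ^ t < 1 / 8"
    by (rule order_tendstoD[OF lim[OF y]]) simp
  then have "\<forall>\<^sub>F t in sequentially. \<eta> t < 1 / 2 \<and> (A * real (Suc (Suc n * t)) + 1) * y ^ t < 1 / 8 \<and> t \<ge> 1"
    using ev1 eventually_ge_at_top[of 1] by eventually_elim simp
  then obtain t where t: "\<eta> t < 1 / 2" "(A * real (Suc (Suc n * t)) + 1) * y ^ t < 1 / 8" "t \<ge> 1"
    by (metis (mono_tags, lifting) eventually_sequentially order_refl)
  have \<eta>0: "\<eta> t > 0" using A by (simp add: \<eta>_def add_nonneg_pos)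
  define z where "z = 2 powr ((real n / 2 - \<delta>) * real t)"
  have z0: "z > 0" by (simp add: z_def)
  have "\<eta> t * z\<^sup>2 = (A * real (Suc (Suc n * t)) + 1) * y ^ t"
  proof -
    have "z\<^sup>2 = 2 powr (real n * real t + (- 2 * \<delta>) * real t)"
      by (simp add: z_def power2_eq_square powr_add[symmetric] algebra_simps)
    also have "\<dots> = (2 ^ t) ^ n * y ^ t"
    proof -
      have "2 powr (real n * real t) = (2 ^ t :: real) ^ n"
        by (simp add: powr_realpow power_mult[symmetric] mult.commute flip: of_nat_mult)
      moreover have "2 powr ((- 2 * \<delta>) * real t) = y ^ t"
        unfolding y_def powr_powr[symmetric] by (rule powr_realpow) simp
      ultimately show ?thesis by (simp only: powr_add)
    qed
    finally show ?thesis by (simp add: \<eta>_def)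
  qed
  then have small: "\<eta> t * z\<^sup>2 < 1 / 8" using t(2) by simp
  have "((1 + \<eta> t) * sqrt (2 * \<eta> t) * z)\<^sup>2 = (1 + \<eta> t)\<^sup>2 * 2 * (\<eta> t * z\<^sup>2)"
    using \<eta>0 by (simp add: power_mult_distrib)
  also have "\<dots> \<le> 2\<^sup>2 * 2 * (\<eta> t * z\<^sup>2)"
    using \<eta>0 t(1) by (intro mult_right_mono power_mono) auto
  also have "\<dots> < 1\<^sup>2" using small by simp
  finally have "(1 + \<eta> t) * sqrt (2 * \<eta> t) * z < 1" by (rule power2_less_imp_less) simp
  then show ?thesis using t(1,3) unfolding z_def \<eta>_def Let_def by (intro exI[of _ t]) auto
qed

section \<open>From one null set to the dimension bound\<close>

lemma hausdorff_content_0_Sing2_map: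
  fixes U :: "(real^'n::finite) set" and f :: "real^'n \<Rightarrow> real^'n"
  assumes f: "locally_bi_lipschitz_on U f" and s: "s > 0"
    and s0: "real CARD('n) - real CARD('n) / (2 * (real CARD('n) + 1)) < s"
  shows "hausdorff_content s (Sing2_map U f) = 0"
proof -
  define n where "n = CARD('n)"
  have n1: "n \<ge> 1" by (simp add: n_def Suc_leI)
  \<comment> \<open>Chosen so that \<open>N powr (n - s)\<close> is \<open>2 ^ t\<close> to the
    power \<open>n / 2 - \<delta>\<close>; it is positive exactly when \<open>s\<close> exceeds the
    critical dimension.\<close>
  define \<delta> where "\<delta> = real n / 2 - (real n + 1) * (real n - s)"
  have "\<delta> > 0"
  proof -
    have "(real n + 1) * (real n - s) < (real n + 1) * (real n / (2 * (real n + 1)))"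
      using s0 by (intro mult_strict_left_mono) (auto simp: n_def)
    also have "\<dots> = real n / 2" by (simp add: field_simps add_pos_nonneg)
    finally show ?thesis by (simp add: \<delta>_def)
  qed
  have "height_const n \<ge> 0"
    unfolding height_const_def using branch_const_ge(3)[of n]
    by (intro sum_nonneg mult_nonneg_nonneg zero_le_power) (auto intro: order_trans[of 0 1])
  then obtain t where t: "t \<ge> 1" and step: "let \<eta> = (height_const n * real (Suc (Suc n * t)) + 1) / (2 ^ t) ^ n in
     2 * \<eta> < 1 \<and> (1 + \<eta>) * sqrt (2 * \<eta>) * 2 powr ((real n / 2 - \<delta>) * real t) < 1"
    using exists_step_size[OF _ \<open>\<delta> > 0\<close> n1] by blast
  define b :: real where "b = 2 ^ t"
  define N :: nat where "N = 2 ^ (Suc n * t)"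
  define w where "w = ((1 + real n) * b) ^ n * ((1 + real n)\<^sup>2 * b ^ Suc n * (8 * (1 + real n)\<^sup>2) ^ Suc n) * (real n * b ^ n)"
  define \<eta> where "\<eta> = (height_const n * real (Suc (Suc n * t)) + 1) / b ^ n"
  have \<eta>: "\<eta> > 0" "2 * \<eta> < 1" and q: "(1 + \<eta>) * sqrt (2 * \<eta>) * 2 powr ((real n / 2 - \<delta>) * real t) < 1"
    using step \<open>height_const n \<ge> 0\<close> by (auto simp: \<eta>_def b_def Let_def add_nonneg_pos)
  have N0: "N > 0" by (simp add: N_def)
  have w0: "w > 0" unfolding w_def using n1 by (intro mult_pos_pos zero_less_power) (auto simp: b_def add_pos_nonneg)
  define H where "H k m = height w b k (cell_corner N k m)" for k and m :: "int^'n"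
  define P where "P k m \<longleftrightarrow> H k m \<ge> 1 / \<eta>" for k m
  \<comment> \<open>This set does not depend on \<open>f\<close>: the points in question lie in
    \<open>Bad\<close> or in its preimage under \<open>f\<close>.\<close>
  define Bad where "Bad = {x. \<exists>k0. \<exists>\<^sub>\<infinity>k. k \<le> 2 * visits N P k (cell_index N k x) + k0}"
  have Bad0: "hausdorff_content s Bad = 0"
    unfolding Bad_def
  proof (rule hausdorff_content_0_frequent[where H=H and M="real N ^ n" and \<eta>=\<eta>, OF N0 s])
    show "H k m \<ge> 1" for k m unfolding H_def by (rule height_ge_1)
    show "(\<Sum>c\<in>cells N. H (Suc k) (subcell N m c)) \<le> real N ^ n * (1 + \<eta> * H k m)" for k m
      unfolding H_def cell_corner_subcell[OF N0] \<eta>_def n_def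
      by (rule height_recursion) (simp_all add: b_def N_def w_def n_def)
    show "P k m \<longleftrightarrow> H k m \<ge> 1 / \<eta>" for k m by (rule P_def)
    have "real N ^ n * (1 / real N) powr s = 2 powr ((real n / 2 - \<delta>) * real t)"
    proof -
      have N2: "real N = 2 powr (real (Suc n * t))" 
        unfolding N_def by (subst powr_realpow) auto
      have "real N ^ n * (1 / real N) powr s = real N powr (real n) * real N powr (- s)"
      proof -
        have "1 / real N = real N powr (- 1)" using N0 by (simp add: powr_minus divide_inverse)
        then have "(1 / real N) powr s = real N powr (- s)" by (simp only: powr_powr) simp
        then show ?thesis using N0 by (simp add: powr_realpow)
      qed
      also have "\<dots> = real N powr (real n - s)" by (simp add: powr_add[symmetric])
      also have "\<dots> = 2 powr (real (Suc n * t) * (real n - s))" unfolding N2 by (rule powr_powr)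
      also have "real (Suc n * t) * (real n - s) = (real n / 2 - \<delta>) * real t"
        by (simp add: \<delta>_def algebra_simps)
      finally show ?thesis .
    qed
    moreover have "real N ^ n * (1 + \<eta>) * sqrt (2 * \<eta>) * (1 / real N) powr s
      = (1 + \<eta>) * sqrt (2 * \<eta>) * (real N ^ n * (1 / real N) powr s)" by (simp only: mult_ac)
    ultimately show "real N ^ n * (1 + \<eta>) * sqrt (2 * \<eta>) * (1 / real N) powr s < 1" using q by (simp only:)
  qed (use N0 \<eta> in auto)
  have sub: "\<xi> \<in> Bad \<or> f \<xi> \<in> Bad" if \<xi>: "\<xi> \<in> Sing2_map U f" for \<xi>
  proof -
    have "(\<xi>, f \<xi>) \<in> Sing2" using \<xi> by (simp add: Sing2_map_def)
    then have "\<exists>K. \<forall>k\<ge>K. height w b k (cell_corner N k (cell_index N k \<xi>)) \<ge> 1 / \<eta>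
     \<or> height w b k (cell_corner N k (cell_index N k (f \<xi>))) \<ge> 1 / \<eta>"
      by (intro Sing2_height[OF b_def t _ w0]) (simp_all add: N_def n_def)
    then obtain K where "\<And>k. k \<ge> K \<Longrightarrow> P k (cell_index N k \<xi>) \<or> P k (cell_index N k (f \<xi>))"
      unfolding P_def H_def by blast
    then show ?thesis unfolding Bad_def mem_Collect_eq by (rule frequent_visits_disj[OF N0])
  qed
  obtain r where r: "\<And>x. x \<in> U \<Longrightarrow> r x > 0 \<and> bi_lipschitz_on (ball x (r x) \<inter> U) f"
    using f unfolding locally_bi_lipschitz_on_def by metis
  obtain F where F: "F \<subseteq> (\<lambda>x. ball x (r x)) ` U" "countable F" "\<Union>F = (\<Union>x\<in>U. ball x (r x))"
    by (rule Lindelof[of "(\<lambda>x. ball x (r x)) ` U"]) auto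
  \<comment> \<open>\<open>Bad\<close> is a null default for indices outside \<open>F\<close>; such
    an index can occur because the enumeration runs over \<open>insert {} F\<close>, which is
    nonempty even if \<open>U\<close> is empty.\<close>
  define D where "D B = (if B \<in> F then (B \<inter> U) \<inter> f -` Bad else Bad)" for B
  have D0: "hausdorff_content s (D B) = 0" for B
  proof (cases "B \<in> F")
    case True
    then obtain x where x: "x \<in> U" "B = ball x (r x)" using F(1) by blast
    then obtain L where L: "L \<ge> 1" "\<And>y z. y \<in> B \<inter> U \<Longrightarrow> z \<in> B \<inter> U \<Longrightarrow> dist y z / L \<le> dist (f y) (f z)"
      using r[of x] unfolding bi_lipschitz_on_def by blast
    have "hausdorff_content s ((B \<inter> U) \<inter> f -` Bad) = 0"
    proof (rule hausdorff_content_0_preimage[OF s _ _ Bad0])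
      show "0 < L" using L(1) by simp
      show "dist y z \<le> L * dist (f y) (f z)" if "y \<in> B \<inter> U" "z \<in> B \<inter> U" for y z
        using L(2)[OF that] L(1) by (simp add: field_simps)
    qed
    then show ?thesis using True by (simp add: D_def)
  qed (simp add: D_def Bad0)
  define e where "e = from_nat_into (insert {} F)"
  have e: "range e = insert {} F" unfolding e_def using F(2) by (intro range_from_nat_into) auto
  define D' where "D' i = (case i of 0 \<Rightarrow> Bad | Suc j \<Rightarrow> D (e j))" for i
  have "Sing2_map U f \<subseteq> (\<Union>i. D' i)"
  proof
    fix \<xi> assume \<xi>: "\<xi> \<in> Sing2_map U f"
    then have U: "\<xi> \<in> U" by (simp add: Sing2_map_def)
    consider "\<xi> \<in> Bad" | "f \<xi> \<in> Bad" using sub[OF \<xi>] by blast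
    then show "\<xi> \<in> (\<Union>i. D' i)"
    proof cases
      case 1
      then have "\<xi> \<in> D' 0" by (simp add: D'_def)
      then show ?thesis by blast
    next
      case 2
      have "\<xi> \<in> ball \<xi> (r \<xi>)" using r[OF U] by simp
      then have "\<xi> \<in> \<Union>F" unfolding F(3) using U by blast
      then obtain B where B: "B \<in> F" "\<xi> \<in> B" by blast
      then obtain j where "e j = B" using e by (metis insertI2 rangeE)
      then have "\<xi> \<in> D' (Suc j)" using B U 2 by (simp add: D'_def D_def)
      then show ?thesis by blast
    qed
  qed
  then have "hausdorff_content s (Sing2_map U f) \<le> hausdorff_content s (\<Union>i. D' i)"
    by (rule hausdorff_content_mono)
  also have "\<dots> = 0" by (rule hausdorff_content_0_UN) (auto simp: D'_def D0 Bad0 split: nat.split)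
  finally show ?thesis by simp
qed

theorem theorem9:
  fixes U :: "(real ^ 'n::finite) set" and f :: "real ^ 'n \<Rightarrow> real ^ 'n"
  assumes "open U"
    and "locally_bi_lipschitz_on U f"
  shows "hausdorff_dim (Sing2_map U f)
           \<le> ereal (real CARD('n) - real CARD('n) / (2 * (real CARD('n) + 1)))
         \<and> real CARD('n) - real CARD('n) / (2 * (real CARD('n) + 1)) < real CARD('n)"
proof
  define s0 where "s0 = real CARD('n) - real CARD('n) / (2 * (real CARD('n) + 1))"
  have n0: "real CARD('n) > 0" by simp
  \<comment> \<open>Every \<open>s\<close> above a nonnegative critical value is positive, which the
    passage from content to measure requires.\<close>
  have "real CARD('n) / (2 * (real CARD('n) + 1)) \<le> real CARD('n) / 1"
    using n0 by (intro divide_left_mono) auto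
  then have s0: "s0 \<ge> 0" by (simp add: s0_def)
  have le: "hausdorff_dim (Sing2_map U f) \<le> ereal s" if "s > s0" for s
  proof -
    have "hausdorff_outer_measure s (Sing2_map U f) = 0"
      using that s0 by (intro hausdorff_outer_measure_0 hausdorff_content_0_Sing2_map[OF assms(2)]) (auto simp: s0_def)
    then show ?thesis unfolding hausdorff_dim_def using that s0 by (intro Inf_lower) auto
  qed
  show "hausdorff_dim (Sing2_map U f) \<le> ereal (real CARD('n) - real CARD('n) / (2 * (real CARD('n) + 1)))"
    unfolding s0_def[symmetric]
  proof (rule ereal_le_epsilon2)
    fix e :: real assume "0 < e"
    then show "hausdorff_dim (Sing2_map U f) \<le> ereal s0 + ereal e"
      using le[of "s0 + e"] by simp
  qed
  show "real CARD('n) - real CARD('n) / (2 * (real CARD('n) + 1)) < real CARD('n)"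
    using n0 by simp
qed

end
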